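(* If the maps $\tau_i:I\to I$ are piecewise monotonic and transitive for $i=1,2$, and if the dimension triples for $\tau_1$ and $\tau_2$ are isomorphic, then $\tau_1$ and $\tau_2$ have the same topological entropy, i.e. $h_{\tau_1}=h_{\tau_2}$.
   Context: Let $I=[0,1]$. A (not necessarily continuous) map $\tau:I\to I$ is piecewise monotonic if there are points $0=a_0<a_1<\dots<a_n=1$ such that each $\tau|_{(a_{i-1},a_i)}$ is continuous and strictly monotonic; the points are chosen so that no $(a_{i-1},a_i)$ is contained in a larger open interval on which $\tau$ is continuous and strictly monotonic. Then $\{a_0,\dots,a_n\}$ is the partition associated with $\tau$, and $\tau_i:[a_{i-1},a_i]\to I$ denotes the continuous extension of $\tau|_{(a_{i-1},a_i)}$ (for a single map $\tau$). Actual values of $\tau$ at partition points of discontinuity are ignored: $\widehat\tau(x)$ is the set of left and right limits of $\tau$ at $x$, $\widehat\tau(A)=\bigcup_i\tau_i(A\cap[a_{i-1},a_i])$, and $\widehat\tau^{-1}(A)=\bigcup_i\{x\in[a_{i-1},a_i]:\tau_i(x)\in A\}$. $\tau$ (viewed as undefined at the partition points) is transitive if for all non-empty open $U,V\subset I$ there is $n\ge 0$ with $\tau^n(U)\cap V\ne\emptyset$. The generalized orbit of $x\in I$ is the smallest subset of $I$ containing $x$ that is forward and backward invariant under $\widehat\tau$. $I_1$ is the union of the generalized orbits of $a_0,\dots,a_n$, and $I_0=I\setminus I_1$. $X$ is the totally ordered set obtained from $I$ by replacing each $x\in I_1\setminus\{0,1\}$ by two points $x^-<x^+$, with the order topology (homeomorphic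 to a compact subset of $\mathbb R$); $\pi:X\to I$ is the collapse map ($\pi(x^\pm)=x$), and $X_0=\pi^{-1}(I_0)$. The local homeomorphism associated with $\tau$ is the unique continuous map $\sigma:X\to X$ with $\pi\circ\sigma=\tau\circ\pi$ on $X_0$. Let $(\mathcal L f)(x)=\sum_{\sigma y=x}f(y)$ for $f\in C(X,\mathbb Z)$. $DG(\tau)$ is $C(X,\mathbb Z)$ modulo $f\sim g$ iff $\mathcal L^nf=\mathcal L^ng$ for some $n\ge0$, ordered by $[f]\ge0$ iff $\mathcal L^nf\ge0$ for some $n$, with $\mathcal L_*[f]=[\mathcal Lf]$. The dimension triple of $\tau$ is $(DG(\tau),DG(\tau)^+,\mathcal L_* )$; an isomorphism of dimension triples is a group isomorphism carrying positive cone onto positive cone and intertwining the endomorphisms $\mathcal L_*$. The entropy $h_\tau$ is the topological entropy of $\tau$ if $\tau$ is continuous, and in general the topological entropy of the shift on $\Sigma_\tau=\{(s_i)_{i\ge0}\in\{1,\dots,n\}^{\mathbb N}:\bigcap_{i=0}^k\tau^{-i}((a_{s_i-1},a_{s_i}))\neq\emptyset\ \text{for all }k\ge 0\}$ (these agree for continuous $\tau$). *)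

theory Defs
  imports "HOL-Analysis.Analysis" "HOL-Algebra.Group"
begin

text \<open>Maps \<open>[0,1] \<rightarrow> [0,1]\<close> are represented by functions on \<open>real\<close>; only their values on
  \<open>{0..1}\<close> are ever used.\<close>

definition cont_strict_monotonic_on :: "real set \<Rightarrow> (real \<Rightarrow> real) \<Rightarrow> bool" where
  "cont_strict_monotonic_on J \<tau> \<longleftrightarrow>
     continuous_on J \<tau> \<and> (monotone_on J (<) (<) \<tau> \<or> monotone_on J (<) (>) \<tau>)"

text \<open>The points \<open>0 = a\<^sub>0 < \<dots> < a\<^sub>n = 1\<close> are the entries \<open>P ! 0, \<dots>, P ! n\<close> of a list of length
  \<open>n + 1\<close>; thus \<open>{1..<length P}\<close> is the index set \<open>{1, \<dots>, n}\<close>.\<close>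

definition monotonicity_partition :: "(real \<Rightarrow> real) \<Rightarrow> real list \<Rightarrow> bool" where
  "monotonicity_partition \<tau> P \<longleftrightarrow>
     P \<noteq> [] \<and> sorted_wrt (<) P \<and> hd P = 0 \<and> last P = 1 \<and>
     (\<forall>i\<in>{1..<length P}. cont_strict_monotonic_on {P ! (i - 1)<..<P ! i} \<tau>)"

definition piecewise_monotonic :: "(real \<Rightarrow> real) \<Rightarrow> bool" where
  "piecewise_monotonic \<tau> \<longleftrightarrow>
     \<tau> \<in> {0..1} \<rightarrow> {0..1} \<and> (\<exists>P. monotonicity_partition \<tau> P)"

definition maximal_partition :: "(real \<Rightarrow> real) \<Rightarrow> real list \<Rightarrow> bool" where
  "maximal_partition \<tau> P \<longleftrightarrow> monotonicity_partition \<tau> P \<and>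
     (\<forall>i\<in>{1..<length P}. \<not> (\<exists>c d. 0 \<le> c \<and> d \<le> 1 \<and>
        {P ! (i - 1)<..<P ! i} \<subset> {c<..<d} \<and> cont_strict_monotonic_on {c<..<d} \<tau>))"

text \<open>The maximal partition of a piecewise monotonic map exists and is unique: its interior points
  are exactly the points of \<open>(0,1)\<close> having no neighbourhood on which the map is continuous and
  strictly monotonic.\<close>

definition assoc_partition :: "(real \<Rightarrow> real) \<Rightarrow> real list" where
  "assoc_partition \<tau> = (THE P. maximal_partition \<tau> P)"

definition pieces :: "(real \<Rightarrow> real) \<Rightarrow> nat set" where
  "pieces \<tau> = {1..<length (assoc_partition \<tau>)}"

definition open_piece :: "(real \<Rightarrow> real) \<Rightarrow> nat \<Rightarrow> real set" where
  "open_piece \<tau> i = {assoc_partition \<tau> ! (i - 1)<..<assoc_partition \<tau> ! i}"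

definition closed_piece :: "(real \<Rightarrow> real) \<Rightarrow> nat \<Rightarrow> real set" where
  "closed_piece \<tau> i = {assoc_partition \<tau> ! (i - 1)..assoc_partition \<tau> ! i}"

text \<open>At an end point of the piece this is the one-sided limit, at an interior point it is
  \<open>\<tau> x\<close>.\<close>

definition branch :: "(real \<Rightarrow> real) \<Rightarrow> nat \<Rightarrow> real \<Rightarrow> real" where
  "branch \<tau> i x = Lim (at x within open_piece \<tau> i) \<tau>"

definition hat_image :: "(real \<Rightarrow> real) \<Rightarrow> real set \<Rightarrow> real set" where
  "hat_image \<tau> A = (\<Union>i\<in>pieces \<tau>. branch \<tau> i ` (A \<inter> closed_piece \<tau> i))"

definition hat_preimage :: "(real \<Rightarrow> real) \<Rightarrow> real set \<Rightarrow> real set" where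
  "hat_preimage \<tau> A = (\<Union>i\<in>pieces \<tau>. {x \<in> closed_piece \<tau> i. branch \<tau> i x \<in> A})"

text \<open>Since the map is regarded as undefined at the partition points, these are removed before
  each application.\<close>

definition punctured_image :: "(real \<Rightarrow> real) \<Rightarrow> real set \<Rightarrow> real set" where
  "punctured_image \<tau> A = \<tau> ` (A - set (assoc_partition \<tau>))"

definition transitive_map :: "(real \<Rightarrow> real) \<Rightarrow> bool" where
  "transitive_map \<tau> \<longleftrightarrow>
     (\<forall>U V. openin (top_of_set {0..1}) U \<and> U \<noteq> {} \<and> openin (top_of_set {0..1}) V \<and> V \<noteq> {} \<longrightarrow>
        (\<exists>n. (punctured_image \<tau> ^^ n) U \<inter> V \<noteq> {}))"

definition generalized_orbit :: "(real \<Rightarrow> real) \<Rightarrow> real \<Rightarrow> real set" where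
  "generalized_orbit \<tau> x =
     \<Inter>{A. A \<subseteq> {0..1} \<and> x \<in> A \<and> hat_image \<tau> A \<subseteq> A \<and> hat_preimage \<tau> A \<subseteq> A}"

definition I1 :: "(real \<Rightarrow> real) \<Rightarrow> real set" where
  "I1 \<tau> = (\<Union>a\<in>set (assoc_partition \<tau>). generalized_orbit \<tau> a)"

definition I0 :: "(real \<Rightarrow> real) \<Rightarrow> real set" where
  "I0 \<tau> = {0..1} - I1 \<tau>"

text \<open>A doubled point \<open>x\<close> is represented by \<open>x\<^sup>- = (x, False)\<close> and \<open>x\<^sup>+ = (x, True)\<close>, every other
  point \<open>x\<close> by \<open>(x, False)\<close>. The order is lexicographic with \<open>False < True\<close>, and the collapse map
  is \<open>fst\<close>.\<close>

type_synonym split_point = "real \<times> bool"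

definition split_less :: "split_point \<Rightarrow> split_point \<Rightarrow> bool" where
  "split_less p q \<longleftrightarrow> fst p < fst q \<or> (fst p = fst q \<and> snd p < snd q)"

definition X_set :: "(real \<Rightarrow> real) \<Rightarrow> split_point set" where
  "X_set \<tau> = {0..1} \<times> {False} \<union> (I1 \<tau> - {0, 1}) \<times> {True}"

definition order_topology_on :: "'a set \<Rightarrow> ('a \<Rightarrow> 'a \<Rightarrow> bool) \<Rightarrow> 'a topology" where
  "order_topology_on S r = topology_generated_by
     ({S} \<union> {{y \<in> S. r x y} | x. x \<in> S} \<union> {{y \<in> S. r y x} | x. x \<in> S})"

definition X_top :: "(real \<Rightarrow> real) \<Rightarrow> split_point topology" where
  "X_top \<tau> = order_topology_on (X_set \<tau>) split_less"

definition X0_set :: "(real \<Rightarrow> real) \<Rightarrow> split_point set" where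
  "X0_set \<tau> = {p \<in> X_set \<tau>. fst p \<in> I0 \<tau>}"

definition local_homeo :: "(real \<Rightarrow> real) \<Rightarrow> split_point \<Rightarrow> split_point" where
  "local_homeo \<tau> = (THE \<sigma>. \<sigma> \<in> extensional (X_set \<tau>) \<and> continuous_map (X_top \<tau>) (X_top \<tau>) \<sigma> \<and>
     (\<forall>p\<in>X0_set \<tau>. fst (\<sigma> p) = \<tau> (fst p)))"

text \<open>\<open>C(X, \<int>)\<close>; functions on \<open>X\<close> are \<open>undefined\<close> off \<open>X\<close>, so that equality of functions is
  equality on \<open>X\<close>.\<close>

definition CXZ :: "(real \<Rightarrow> real) \<Rightarrow> (split_point \<Rightarrow> int) set" where
  "CXZ \<tau> = {f \<in> extensional (X_set \<tau>). continuous_map (X_top \<tau>) (discrete_topology UNIV) f}"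

definition transfer_op :: "(real \<Rightarrow> real) \<Rightarrow> (split_point \<Rightarrow> int) \<Rightarrow> split_point \<Rightarrow> int" where
  "transfer_op \<tau> f = (\<lambda>x\<in>X_set \<tau>. \<Sum>y\<in>{y \<in> X_set \<tau>. local_homeo \<tau> y = x}. f y)"

definition DG_rel :: "(real \<Rightarrow> real) \<Rightarrow> ((split_point \<Rightarrow> int) \<times> (split_point \<Rightarrow> int)) set" where
  "DG_rel \<tau> = {(f, g). f \<in> CXZ \<tau> \<and> g \<in> CXZ \<tau> \<and>
     (\<exists>n. (transfer_op \<tau> ^^ n) f = (transfer_op \<tau> ^^ n) g)}"

definition DG_class :: "(real \<Rightarrow> real) \<Rightarrow> (split_point \<Rightarrow> int) \<Rightarrow> (split_point \<Rightarrow> int) set" where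
  "DG_class \<tau> f = DG_rel \<tau> `` {f}"

text \<open>The unions over representatives below are the usual lifting of operations to equivalence
  classes.\<close>

definition DG :: "(real \<Rightarrow> real) \<Rightarrow> (split_point \<Rightarrow> int) set monoid" where
  "DG \<tau> = \<lparr> carrier = CXZ \<tau> // DG_rel \<tau>,
            monoid.mult = (\<lambda>A B. \<Union>f\<in>A. \<Union>g\<in>B. DG_class \<tau> (\<lambda>x\<in>X_set \<tau>. f x + g x)),
            one = DG_class \<tau> (\<lambda>x\<in>X_set \<tau>. 0) \<rparr>"

definition DG_pos :: "(real \<Rightarrow> real) \<Rightarrow> (split_point \<Rightarrow> int) set set" where
  "DG_pos \<tau> = {DG_class \<tau> f | f. f \<in> CXZ \<tau> \<and> (\<exists>n. \<forall>x\<in>X_set \<tau>. 0 \<le> (transfer_op \<tau> ^^ n) f x)}"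

definition transfer_op_star ::
  "(real \<Rightarrow> real) \<Rightarrow> (split_point \<Rightarrow> int) set \<Rightarrow> (split_point \<Rightarrow> int) set" where
  "transfer_op_star \<tau> A = (\<Union>f\<in>A. DG_class \<tau> (transfer_op \<tau> f))"

type_synonym 'a triple = "'a monoid \<times> 'a set \<times> ('a \<Rightarrow> 'a)"

definition dimension_triple :: "(real \<Rightarrow> real) \<Rightarrow> (split_point \<Rightarrow> int) set triple" where
  "dimension_triple \<tau> = (DG \<tau>, DG_pos \<tau>, transfer_op_star \<tau>)"

definition triple_isomorphic :: "'a triple \<Rightarrow> 'b triple \<Rightarrow> bool" where
  "triple_isomorphic S T \<longleftrightarrow> (case S of (G, Gpos, L) \<Rightarrow> case T of (H, Hpos, M) \<Rightarrow>
     \<exists>\<phi>\<in>iso G H. \<phi> ` Gpos = Hpos \<and> (\<forall>a\<in>carrier G. \<phi> (L a) = M (\<phi> a)))"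

text \<open>Topological entropy of a continuous self-map of a compact space, in the open cover form of
  Adler, Konheim and McAndrew. \<open>iterated_cover T f \<U> n\<close> is the common refinement of
  the preimages of \<open>\<U>\<close> under \<open>f ^^ i\<close> for \<open>i < n\<close>. The limit defining the entropy of a cover exists by
  subadditivity, so that it equals the upper limit.\<close>

definition open_covers :: "'a topology \<Rightarrow> 'a set set set" where
  "open_covers T = {\<U>. (\<forall>U\<in>\<U>. openin T U) \<and> \<Union>\<U> = topspace T}"

definition cover_number :: "'a topology \<Rightarrow> 'a set set \<Rightarrow> nat" where
  "cover_number T \<U> = Inf {card \<V> | \<V>. \<V> \<subseteq> \<U> \<and> finite \<V> \<and> \<Union>\<V> = topspace T}"

definition iterated_cover ::
  "'a topology \<Rightarrow> ('a \<Rightarrow> 'a) \<Rightarrow> 'a set set \<Rightarrow> nat \<Rightarrow> 'a set set" where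
  "iterated_cover T f \<U> n =
     {{x \<in> topspace T. \<forall>i<n. (f ^^ i) x \<in> u i} | u. \<forall>i<n. u i \<in> \<U>}"

definition topological_entropy :: "'a topology \<Rightarrow> ('a \<Rightarrow> 'a) \<Rightarrow> ereal" where
  "topological_entropy T f = (SUP \<U>\<in>open_covers T.
     limsup (\<lambda>n. ereal (ln (real (cover_number T (iterated_cover T f \<U> n))) / real n)))"

definition itineraries :: "(real \<Rightarrow> real) \<Rightarrow> (nat \<Rightarrow> nat) set" where
  "itineraries \<tau> = {s. (\<forall>i. s i \<in> pieces \<tau>) \<and>
     (\<forall>k. \<exists>x\<in>{0..1}. \<forall>i\<le>k. (\<tau> ^^ i) x \<in> open_piece \<tau> (s i))}"

definition itinerary_top :: "(real \<Rightarrow> real) \<Rightarrow> (nat \<Rightarrow> nat) topology" where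
  "itinerary_top \<tau> =
     subtopology (product_topology (\<lambda>_. discrete_topology (pieces \<tau>)) UNIV) (itineraries \<tau>)"

definition entropy :: "(real \<Rightarrow> real) \<Rightarrow> ereal" where
  "entropy \<tau> =
     (if continuous_on {0..1} \<tau> then topological_entropy (top_of_set {0..1}) \<tau>
      else topological_entropy (itinerary_top \<tau>) (\<lambda>s i. s (Suc i)))"

end

theory Submission
  imports Defs
begin

text \<open>The entropy of \<open>\<tau>\<close> is the exponential growth rate of the number \<open>l\<^sub>n\<close> of words of length
  \<open>n\<close> realised by itineraries. Let \<open>\<tau>\<close> act on the germs (one-sided neighbourhoods) of points of \<open>[0,1]\<close>.
  The value of the \<open>n\<close>-th power of the transfer operator at the constant function \<open>1\<close> counts the
  \<open>n\<close>-fold germ preimages. It is at most \<open>l\<^sub>n\<close>, since a germ is determined by its word and its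
  \<open>n\<close>-th image; and its maximum is at least \<open>l\<^sub>n / (c n)\<close>, since the leftmost germ with a given word
  meets the finitely many germs at partition points in the first \<open>n\<close> steps. If \<open>f\<close> represents the
  image of \<open>[1]\<close> under an isomorphism of dimension triples, then the inequality \<open>L\<^sup>n 1 \<le> l\<^sub>n\<close> for the
  first map carries over to \<open>L\<^sup>n f \<le> l\<^sub>n f\<close>, eventually, for the second, and iterating bounds the
  growth rate of the second map by \<open>ln l\<^sub>n / n\<close>, for every \<open>n\<close>.\<close>

section \<open>Germs and strictly monotone homeomorphisms\<close>

text \<open>At a cut the map has two one-sided values, and \<open>X\<close> separates the two sides
  of a point only along \<open>I1\<close>. Doubling every point gives a space of germs on which the
  map is single valued: each germ lies in exactly one piece, and twins, the two sides of a point,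
  move together until they meet a cut. \<open>X\<close> is recovered by identifying twins off
  \<open>I1\<close>; the projection maps the preimages of a germ bijectively onto those of its
  class, so preimages in \<open>X\<close> can be counted on germs. Since \<open>I1\<close> is
  countable, a germ can be perturbed to a point whose orbit avoids all cuts. Passing between words
  and preimages loses a factor linear in the length, which disappears in the growth rate. The word
  "eventually" in the order of the dimension group costs a fixed delay \<open>m\<close>, so counts
  are compared along the lengths \<open>m + j * n\<close>. That the growth rate is the entropy is
  shown separately for the shift, where words are cylinders, and for continuous maps. There a fine
  grid adds only a linear factor to the number of words, while the doubling of words at cuts is
  charged once in \<open>k\<close> steps and costs at most \<open>ln 2 / k\<close>.\<close>

definition mono_dir :: "bool \<Rightarrow> (real \<Rightarrow> real) \<Rightarrow> real set \<Rightarrow> bool" where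
  "mono_dir up f A \<longleftrightarrow>
     (\<forall>x\<in>A. \<forall>y\<in>A. x < y \<longrightarrow> (if up then f x < f y else f y < f x))"

lemma cont_strict_monotonic_on_iff:
  "cont_strict_monotonic_on J f \<longleftrightarrow> continuous_on J f \<and> (\<exists>up. mono_dir up f J)"
  unfolding cont_strict_monotonic_on_def mono_dir_def monotone_on_def
  by (auto simp: ex_bool_eq)

lemma mono_dir_inj_on: "mono_dir up f A \<Longrightarrow> inj_on f A"
  unfolding mono_dir_def inj_on_def by (metis less_irrefl linorder_neqE_linordered_idom)

lemma mono_dir_subset: "mono_dir up f A \<Longrightarrow> B \<subseteq> A \<Longrightarrow> mono_dir up f B"
  unfolding mono_dir_def by blast

lemma mono_dir_less_iff:
  assumes "mono_dir up f A" "x \<in> A" "y \<in> A"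
  shows "f x < f y \<longleftrightarrow> (if up then x < y else y < x)"
  using assms unfolding mono_dir_def
  by (cases x y rule: linorder_cases) (force split: if_splits)+

lemma mono_dir_unique:
  assumes "mono_dir up f {a<..<b}" "mono_dir dn f {c<..<d}" "max a c < min b d"
  shows "up = dn"
proof -
  obtain x where x: "max a c < x" "x < min b d" using dense[OF assms(3)] by blast
  obtain y where y: "x < y" "y < min b d" using dense[OF x(2)] by blast
  have "f x < f y \<longleftrightarrow> up" "f x < f y \<longleftrightarrow> dn"
    using mono_dir_less_iff[OF assms(1), of x y] mono_dir_less_iff[OF assms(2), of x y] x y by (auto split: if_splits)
  then show ?thesis by blast
qed

text \<open>A bounded increasing function has one-sided limits at the end points, namely the infimum
  and the supremum of its values. Neither is a value on the open interval, since a point closer to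
  the end gives a smaller or larger value; hence the extension is still strictly monotone.\<close>

lemma increasing_extension:
  fixes f :: "real \<Rightarrow> real"
  assumes ab: "a < b" and cont: "continuous_on {a<..<b} f" and mono: "mono_dir True f {a<..<b}"
    and bd: "f ` {a<..<b} \<subseteq> {0..1}"
  shows "\<exists>F. continuous_on {a..b} F \<and> mono_dir True F {a..b} \<and> (\<forall>x\<in>{a<..<b}. F x = f x)"
proof -
  let ?J = "{a<..<b}"
  define F where "F x = (if x \<le> a then Inf (f ` ?J) else if b \<le> x then Sup (f ` ?J) else f x)" for x
  have bb: "bdd_below (f ` ?J)" and ba: "bdd_above (f ` ?J)"
    using bd by (meson bdd_below_mono bdd_above_mono bdd_below_Icc bdd_above_Icc)+
  have ne: "f ` ?J \<noteq> {}" using ab by simp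
  have m: "f x < f y" if "a < x" "x < y" "y < b" for x y
    using mono that unfolding mono_dir_def by simp
  have lo: "Inf (f ` ?J) < f x" if "a < x" "x < b" for x
  proof -
    obtain y where "a < y" "y < x" using dense \<open>a < x\<close> by blast
    then show ?thesis using cInf_lower[OF _ bb, of "f y"] m[of y x] that by force
  qed
  have hi: "f x < Sup (f ` ?J)" if "a < x" "x < b" for x
  proof -
    obtain y where "x < y" "y < b" using dense \<open>x < b\<close> by blast
    then show ?thesis using cSup_upper[OF _ ba, of "f y"] m[of x y] that by force
  qed
  have "continuous_on {a..b} F"
  proof (rule continuous_on_IccI)
    show "(F \<longlongrightarrow> F a) (at_right a)"
    proof (rule order_tendstoI)
      fix l assume "l < F a"
      then have "l < Inf (f ` ?J)" by (simp add: F_def)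
      then show "\<forall>\<^sub>F x in at_right a. l < F x"
        unfolding eventually_at_right[OF ab]
        using lo ab by (intro exI[of _ b]) (auto simp: F_def intro: less_trans)
    next
      fix u assume "F a < u"
      then obtain y where y: "y \<in> ?J" "f y < u" using cInf_lessD[OF ne, of u] by (auto simp: F_def)
      have "f x < u" if "a < x" "x < y" for x using m[of x y] that y by auto
      then show "\<forall>\<^sub>F x in at_right a. F x < u"
        unfolding eventually_at_right[OF ab] using y by (intro exI[of _ y]) (auto simp: F_def)
    qed
    show "(F \<longlongrightarrow> F b) (at_left b)"
    proof (rule order_tendstoI)
      fix l assume "F b < l"
      then have "Sup (f ` ?J) < l" using ab by (simp add: F_def)
      then show "\<forall>\<^sub>F x in at_left b. F x < l"
        unfolding eventually_at_left[OF ab]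
        using hi ab by (intro exI[of _ a]) (auto simp: F_def intro: less_trans)
    next
      fix u assume "u < F b"
      then obtain y where y: "y \<in> ?J" "u < f y" using less_cSupD[OF ne, of u] ab by (auto simp: F_def)
      have "u < f x" if "y < x" "x < b" for x using m[of y x] that y by auto
      then show "\<forall>\<^sub>F x in at_left b. u < F x"
        unfolding eventually_at_left[OF ab] using y by (intro exI[of _ y]) (auto simp: F_def)
    qed
    fix x assume x: "a < x" "x < b"
    then have "isCont f x"
      using cont by (simp add: continuous_on_eq_continuous_at)
    then have "(f \<longlongrightarrow> f x) (at x)" by (simp add: isCont_def)
    moreover have "\<forall>\<^sub>F y in at x. f y = F y"
    proof -
      have "\<forall>\<^sub>F y in at x. y \<in> ?J" using x by (intro eventually_at_in_open') auto
      then show ?thesis by eventually_elim (auto simp: F_def)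
    qed
    ultimately show "F \<midarrow>x\<rightarrow> F x"
      using x Lim_transform_eventually[of f "f x" "at x" F] by (simp add: F_def[of x])
  qed (rule ab)
  moreover have "mono_dir True F {a..b}"
    unfolding mono_dir_def
  proof (intro ballI impI)
    fix x y assume xy: "x \<in> {a..b}" "y \<in> {a..b}" "x < y"
    obtain z where "a < z" "z < b" using dense[OF ab] by blast
    then have "Inf (f ` ?J) < Sup (f ` ?J)" using lo hi less_trans by blast
    then show "if True then F x < F y else F y < F x"
      using xy lo[of y] hi[of x] m[of x y] by (auto simp: F_def)
  qed
  ultimately show ?thesis by (intro exI[of _ F]) (auto simp: F_def)
qed

text \<open>Reflecting the values by \<open>1 - f x\<close> exchanges the two directions and keeps
  the range in the unit interval, so the decreasing case reduces to the increasing one.\<close>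

lemma strictly_monotone_extension:
  fixes f :: "real \<Rightarrow> real"
  assumes "a < b" and "continuous_on {a<..<b} f" and "mono_dir up f {a<..<b}"
    and "f ` {a<..<b} \<subseteq> {0..1}"
  shows "\<exists>F. continuous_on {a..b} F \<and> mono_dir up F {a..b} \<and> (\<forall>x\<in>{a<..<b}. F x = f x)"
proof (cases up)
  case True
  then show ?thesis using increasing_extension assms by simp
next
  case False
  have "\<exists>F. continuous_on {a..b} F \<and> mono_dir True F {a..b} \<and> (\<forall>x\<in>{a<..<b}. F x = 1 - f x)"
    using assms False by (intro increasing_extension) (auto intro!: continuous_intros simp: mono_dir_def image_subset_iff)
  then obtain F where "continuous_on {a..b} F" "mono_dir True F {a..b}" "\<forall>x\<in>{a<..<b}. F x = 1 - f x"
    by blast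
  then show ?thesis using False
    by (intro exI[of _ "\<lambda>x. 1 - F x"]) (auto intro!: continuous_intros simp: mono_dir_def)
qed

text \<open>Identifies the limit that defines \<open>branch\<close> with a continuous extension.
  Every point of the closed interval, end points included, is a limit point of the open interval,
  which makes the limit unique.\<close>

lemma Lim_within_interval_extension:
  fixes f F :: "real \<Rightarrow> real"
  assumes "a < b" "continuous_on {a..b} F" "\<And>x. x \<in> {a<..<b} \<Longrightarrow> F x = f x" "x \<in> {a..b}"
  shows "Lim (at x within {a<..<b}) f = F x"
proof -
  have "(F \<longlongrightarrow> F x) (at x within {a..b})" using assms by (simp add: continuous_on_def)
  then have "(F \<longlongrightarrow> F x) (at x within {a<..<b})"
    by (rule tendsto_within_subset) auto
  moreover have "\<forall>\<^sub>F y in at x within {a<..<b}. F y = f y"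
    using assms(3) by (auto simp: eventually_at_filter)
  ultimately have "(f \<longlongrightarrow> F x) (at x within {a<..<b})" by (rule Lim_transform_eventually)
  moreover have "at x within {a<..<b} \<noteq> bot"
  proof (cases "x < b")
    case True
    then have "x islimpt {x<..<b}" by (rule islimpt_greaterThanLessThan1)
    then show ?thesis using assms(4) trivial_limit_within islimpt_subset[of x "{x<..<b}" "{a<..<b}"] by force
  next
    case False
    then have "x islimpt {a<..<x}" using assms(1,4) by (intro islimpt_greaterThanLessThan2) auto
    then show ?thesis using assms(4) trivial_limit_within islimpt_subset[of x "{a<..<x}" "{a<..<b}"] by force
  qed
  ultimately show ?thesis by (simp add: tendsto_Lim)
qed

section \<open>Germs and their one-sided neighbourhoods\<close>

type_synonym germ = "real \<times> bool"

text \<open>The germ \<open>(x, True)\<close> is the right hand side of the point \<open>x\<close>, the germ \<open>(x, False)\<close>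
  the left hand side. The germs of an interval are those pointing into it.\<close>

definition germs :: "real \<Rightarrow> real \<Rightarrow> germ set" where
  "germs c d = {(x, s). c \<le> x \<and> x \<le> d \<and> (s \<longrightarrow> x < d) \<and> (\<not> s \<longrightarrow> c < x)}"

text \<open>The neighbourhood contains both germs of every nearby point on the side of
  \<open>g\<close>, but neither the twin of \<open>g\<close> nor anything on the other side.\<close>

definition near_germ :: "germ \<Rightarrow> real \<Rightarrow> germ set" where
  "near_germ g e = insert g {h. (if snd g then fst g < fst h \<and> fst h < fst g + e
     else fst g - e < fst h \<and> fst h < fst g)}"

text \<open>A filter in place of a topology: open conditions become \<open>eventually\<close>,
  continuity becomes \<open>filterlim\<close>, and local constancy of a function is a single
  eventual equation.\<close>

definition germ_nhds :: "germ \<Rightarrow> germ filter" where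
  "germ_nhds g = (INF e\<in>{0<..}. principal (near_germ g e \<inter> germs 0 1))"

lemma eventually_germ_nhds:
  "eventually Q (germ_nhds g) \<longleftrightarrow> (\<exists>e>0. \<forall>h\<in>near_germ g e \<inter> germs 0 1. Q h)"
proof -
  have "\<exists>x\<in>{0<..}. near_germ g x \<inter> germs 0 1 \<subseteq> near_germ g a \<inter> (near_germ g b \<inter> germs 0 1)"
    if "a > 0" "b > 0" for a b
    using that by (intro bexI[of _ "min a b"]) (auto simp: near_germ_def split: if_splits)
  then show ?thesis
    unfolding germ_nhds_def
    by (subst eventually_INF_base) (auto simp: eventually_principal Bex_def)
qed

lemma eventually_germ_nhds_self:
  "g \<in> germs 0 1 \<Longrightarrow> eventually Q (germ_nhds g) \<Longrightarrow> Q g"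
  unfolding eventually_germ_nhds by (auto simp: near_germ_def)

lemma eventually_germ_nhds_domain: "eventually (\<lambda>h. h \<in> germs 0 1) (germ_nhds g)"
  unfolding eventually_germ_nhds by (rule exI[of _ 1]) simp

lemma eventually_germ_nhds_right:
  "eventually Q (germ_nhds (x, True)) \<longleftrightarrow>
     (\<exists>e>0. ((x, True) \<in> germs 0 1 \<longrightarrow> Q (x, True)) \<and>
        (\<forall>y s. x < y \<and> y < x + e \<and> (y, s) \<in> germs 0 1 \<longrightarrow> Q (y, s)))"
  unfolding eventually_germ_nhds by (auto simp: near_germ_def)

lemma eventually_germ_nhds_left:
  "eventually Q (germ_nhds (x, False)) \<longleftrightarrow>
     (\<exists>e>0. ((x, False) \<in> germs 0 1 \<longrightarrow> Q (x, False)) \<and>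
        (\<forall>y s. x - e < y \<and> y < x \<and> (y, s) \<in> germs 0 1 \<longrightarrow> Q (y, s)))"
  unfolding eventually_germ_nhds by (auto simp: near_germ_def)

text \<open>The germs of an interval form a set that is both open and closed, because an end point
  of the interval separates its own two sides. This is why piece labels and conditions on image
  intervals are locally constant.\<close>

lemma eventually_germs_iff:
  "\<forall>\<^sub>F h in germ_nhds g. h \<in> germs c d \<longleftrightarrow> g \<in> germs c d"
proof (cases g)
  case (Pair x s)
  \<comment> \<open>An end point that coincides with \<open>x\<close> is avoided by every one-sided
    neighbourhood, which contains no other germ at \<open>x\<close>; then any positive bound
    does.\<close>
  define e where "e = min (if x = c then 1 else \<bar>x - c\<bar>) (if x = d then 1 else \<bar>x - d\<bar>)"
  have e: "e > 0" "x \<noteq> c \<Longrightarrow> e \<le> \<bar>x - c\<bar>" "x \<noteq> d \<Longrightarrow> e \<le> \<bar>x - d\<bar>"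
    unfolding e_def by auto
  have "(y, t) \<in> germs c d \<longleftrightarrow> (x, s) \<in> germs c d" if "(y, t) \<in> near_germ (x, s) e" for y t
  proof (cases "y = x \<and> t = s")
    case False
    then have y: "if s then x < y \<and> y < x + e else x - e < y \<and> y < x"
      using that by (auto simp: near_germ_def)
    show ?thesis
    proof (cases s)
      case True
      then have "x < c \<longleftrightarrow> y < c" "x < d \<longleftrightarrow> y < d" "y \<noteq> c" "y \<noteq> d"
        using e y by (smt (verit))+
      then show ?thesis using True y by (cases t) (auto simp: germs_def)
    next
      case False
      then have "c < x \<longleftrightarrow> c < y" "d < x \<longleftrightarrow> d < y" "y \<noteq> c" "y \<noteq> d"
        using e y by (smt (verit))+
      then show ?thesis using False y by (cases t) (auto simp: germs_def)
    qed
  qed simp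
  then show ?thesis
    unfolding eventually_germ_nhds Pair using e(1) by force
qed

section \<open>Homeomorphisms of intervals acting on germs\<close>

definition germ_map :: "(real \<Rightarrow> real) \<Rightarrow> bool \<Rightarrow> germ \<Rightarrow> germ" where
  "germ_map f up g = (f (fst g), snd g = up)"

text \<open>The inverse is part of the data, which makes the notion symmetric: facts proved for a
  branch hold for its inverse by \<open>interval_homeo_sym\<close>.\<close>

definition interval_homeo ::
  "bool \<Rightarrow> (real \<Rightarrow> real) \<Rightarrow> real \<Rightarrow> real \<Rightarrow> (real \<Rightarrow> real) \<Rightarrow> real \<Rightarrow> real \<Rightarrow> bool" where
  "interval_homeo up f a b f' c d \<longleftrightarrow> a < b \<and> c < d \<and>
     continuous_on {a..b} f \<and> continuous_on {c..d} f' \<and>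
     mono_dir up f {a..b} \<and> mono_dir up f' {c..d} \<and>
     f ` {a..b} = {c..d} \<and> f' ` {c..d} = {a..b} \<and>
     (\<forall>x\<in>{a..b}. f' (f x) = x) \<and> (\<forall>y\<in>{c..d}. f (f' y) = y)"

lemma interval_homeo_sym: "interval_homeo up f a b f' c d \<Longrightarrow> interval_homeo up f' c d f a b"
  unfolding interval_homeo_def by blast

lemma interval_homeo_exists:
  assumes "a < b" "continuous_on {a..b} f" "mono_dir up f {a..b}"
  shows "\<exists>f' c d. interval_homeo up f a b f' c d"
proof -
  have inj: "inj_on f {a..b}" using assms(3) by (rule mono_dir_inj_on)
  obtain c d where cd: "f ` {a..b} = {c..d}" "c \<le> d"
    using continuous_image_closed_interval[OF _ assms(2)] assms(1) by auto
  have "f a \<noteq> f b" using inj_onD[OF inj, of a b] assms(1) by auto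
  moreover have "f a \<in> {c..d}" "f b \<in> {c..d}" using cd(1) assms(1) by auto
  ultimately have "c < d" by auto
  define f' where "f' = the_inv_into {a..b} f"
  have inv: "\<forall>x\<in>{a..b}. f' (f x) = x" "\<forall>y\<in>{c..d}. f (f' y) = y" "f' ` {c..d} = {a..b}"
    unfolding f'_def using the_inv_into_f_f[OF inj] f_the_inv_into_f[OF inj] the_inv_into_onto[OF inj]
    unfolding cd(1) by blast+
  have "continuous_on {c..d} f'"
    using continuous_on_inv[OF assms(2) compact_Icc, of f'] inv(1) cd(1) by simp
  moreover have "mono_dir up f' {c..d}"
    unfolding mono_dir_def
  proof (intro ballI impI)
    fix x y assume xy: "x \<in> {c..d}" "y \<in> {c..d}" "x < y"
    then have "f' x \<in> {a..b}" "f' y \<in> {a..b}" using inv(3) by blast+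
    then show "if up then f' x < f' y else f' y < f' x"
      using mono_dir_less_iff[OF assms(3), of "f' x" "f' y"] inv(2) xy by (auto split: if_splits)
  qed
  ultimately show ?thesis
    unfolding interval_homeo_def using assms \<open>c < d\<close> cd(1) inv by blast
qed

lemma interval_homeo_less_iff:
  assumes "interval_homeo up f a b f' c d" "x \<in> {a..b}" "y \<in> {a..b}"
  shows "f x < f y \<longleftrightarrow> (if up then x < y else y < x)"
  using assms mono_dir_less_iff unfolding interval_homeo_def by blast

lemma interval_homeo_endpoints:
  assumes h: "interval_homeo up f a b f' c d"
  shows "f a = (if up then c else d)" "f b = (if up then d else c)"
proof -
  have *: "f a \<in> {c..d}" "f b \<in> {c..d}" "f' c \<in> {a..b}" "f' d \<in> {a..b}" "f (f' c) = c" "f (f' d) = d"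
     "a < b" "c < d"
  proof -
    have m: "f ` {a..b} = {c..d}" "f' ` {c..d} = {a..b}" "a < b" "c < d"
      "\<And>y. y \<in> {c..d} \<Longrightarrow> f (f' y) = y"
      using h unfolding interval_homeo_def by blast+
    show "a < b" "c < d" by (fact m)+
    then have e: "a \<in> {a..b}" "b \<in> {a..b}" "c \<in> {c..d}" "d \<in> {c..d}" by auto
    show "f a \<in> {c..d}" "f b \<in> {c..d}" "f' c \<in> {a..b}" "f' d \<in> {a..b}"
      using imageI[OF e(1), of f] imageI[OF e(2), of f] imageI[OF e(3), of f'] imageI[OF e(4), of f']
      unfolding m by blast+
    show "f (f' c) = c" "f (f' d) = d" using e m(5) by blast+
  qed
  note L = interval_homeo_less_iff[OF h]
  show "f a = (if up then c else d)"
    using * L[of a "f' c"] L[of a "f' d"] L[of "f' c" a] L[of "f' d" a] by (cases up) (simp; linarith)+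
  show "f b = (if up then d else c)"
    using * L[of b "f' c"] L[of b "f' d"] L[of "f' c" b] L[of "f' d" b] by (cases up) (simp; linarith)+
qed

text \<open>A decreasing map exchanges the two sides of a point and also the end points of the
  interval; the two effects match, so germs pointing inwards keep pointing inwards.\<close>

lemma germ_map_in:
  assumes h: "interval_homeo up f a b f' c d" and g: "g \<in> germs a b"
  shows "germ_map f up g \<in> germs c d"
proof -
  obtain x s where gx: "g = (x, s)" "x \<in> {a..b}" "s \<longrightarrow> x < b" "\<not> s \<longrightarrow> a < x"
    using g by (auto simp: germs_def)
  have "f x \<in> {c..d}" using h gx(2) unfolding interval_homeo_def by blast
  moreover have "a \<in> {a..b}" "b \<in> {a..b}" using h unfolding interval_homeo_def by auto
  ultimately show ?thesis
    using gx interval_homeo_endpoints[OF h] interval_homeo_less_iff[OF h, of x b] interval_homeo_less_iff[OF h, of b x]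
      interval_homeo_less_iff[OF h, of a x] interval_homeo_less_iff[OF h, of x a]
    by (cases up; cases s) (auto simp: germs_def germ_map_def)
qed

lemma germ_map_inverse:
  assumes "interval_homeo up f a b f' c d" "g \<in> germs a b"
  shows "germ_map f' up (germ_map f up g) = g"
  using assms by (auto simp: germs_def germ_map_def interval_homeo_def)

text \<open>Continuity bounds the distance of the image points and strict monotonicity decides on
  which side they lie; a neighbourhood of a germ requires both.\<close>

lemma filterlim_germ_map:
  assumes h: "interval_homeo up f a b f' c d" and g: "g \<in> germs a b"
    and "0 \<le> a" "b \<le> 1" "0 \<le> c" "d \<le> 1"
  shows "filterlim (germ_map f up) (germ_nhds (germ_map f up g)) (germ_nhds g)"
  unfolding filterlim_iff
proof (intro allI impI)
  fix Q assume "eventually Q (germ_nhds (germ_map f up g))"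
  then obtain e where e: "e > 0" "\<And>k. k \<in> near_germ (germ_map f up g) e \<Longrightarrow> k \<in> germs 0 1 \<Longrightarrow> Q k"
    unfolding eventually_germ_nhds by blast
  obtain x s where gx: "g = (x, s)" "x \<in> {a..b}" using g by (auto simp: germs_def)
  have "continuous_on {a..b} f" using h unfolding interval_homeo_def by blast
  then obtain r where r: "r > 0" "\<And>y. y \<in> {a..b} \<Longrightarrow> dist y x < r \<Longrightarrow> dist (f y) (f x) < e"
    using gx(2) \<open>e > 0\<close> unfolding continuous_on_iff by blast
  have sub: "germs c d \<subseteq> germs 0 1" using assms by (auto simp: germs_def)
  have "\<forall>\<^sub>F k in germ_nhds g. k \<in> near_germ g r"
    unfolding eventually_germ_nhds using r(1) by blast
  moreover have "\<forall>\<^sub>F k in germ_nhds g. k \<in> germs a b"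
    using eventually_germs_iff[of a b g] g by simp
  ultimately show "\<forall>\<^sub>F k in germ_nhds g. Q (germ_map f up k)"
  proof eventually_elim
    case (elim k)
    obtain y t where k: "k = (y, t)" "y \<in> {a..b}" using elim(2) by (auto simp: germs_def)
    have "germ_map f up k \<in> near_germ (germ_map f up g) e"
      using elim(1) gx k r(2)[of y] interval_homeo_less_iff[OF h, of x y] interval_homeo_less_iff[OF h, of y x]
      by (cases up; cases s) (auto simp: near_germ_def germ_map_def dist_real_def)
    moreover have "germ_map f up k \<in> germs 0 1" using germ_map_in[OF h elim(2)] sub by blast
    ultimately show ?case by (rule e(2))
  qed
qed

section \<open>The maximal partition\<close>

text \<open>Partitions are handled as finite sets, where points can be removed and partitions
  compared without indices; a piece is then a pair of adjacent points.\<close>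

definition consecutive_in :: "real set \<Rightarrow> real \<Rightarrow> real \<Rightarrow> bool" where
  "consecutive_in S x y \<longleftrightarrow> x \<in> S \<and> y \<in> S \<and> x < y \<and> {x<..<y} \<inter> S = {}"

definition partition_set :: "(real \<Rightarrow> real) \<Rightarrow> real set \<Rightarrow> bool" where
  "partition_set f S \<longleftrightarrow> finite S \<and> 0 \<in> S \<and> 1 \<in> S \<and> S \<subseteq> {0..1} \<and>
     (\<forall>x y. consecutive_in S x y \<longrightarrow> cont_strict_monotonic_on {x<..<y} f)"

definition maximal_partition_set :: "(real \<Rightarrow> real) \<Rightarrow> real set \<Rightarrow> bool" where
  "maximal_partition_set f S \<longleftrightarrow> partition_set f S \<and>
     (\<forall>x y. consecutive_in S x y \<longrightarrow> \<not> (\<exists>c d. 0 \<le> c \<and> d \<le> 1 \<and>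
        {x<..<y} \<subset> {c<..<d} \<and> cont_strict_monotonic_on {c<..<d} f))"

lemma consecutive_in_set_iff:
  assumes "sorted_wrt (<) P"
  shows "consecutive_in (set P) x y \<longleftrightarrow> (\<exists>i\<in>{1..<length P}. x = P ! (i - 1) \<and> y = P ! i)"
proof
  assume c: "consecutive_in (set P) x y"
  then obtain i j where ij: "i < length P" "j < length P" "x = P ! i" "y = P ! j"
    by (auto simp: consecutive_in_def in_set_conv_nth)
  have "i < j"
  proof (rule ccontr)
    assume "\<not> i < j"
    then have "y \<le> x" using ij sorted_wrt_nth_less[OF assms, of j i] by (cases "i = j") auto
    then show False using c by (auto simp: consecutive_in_def)
  qed
  moreover have "\<not> Suc i < j"
  proof
    assume "Suc i < j"
    then have "P ! Suc i \<in> {x<..<y}" "P ! Suc i \<in> set P"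
      using ij sorted_wrt_nth_less[OF assms, of i "Suc i"] sorted_wrt_nth_less[OF assms, of "Suc i" j] by auto
    then show False using c unfolding consecutive_in_def by blast
  qed
  ultimately have "j = Suc i" by simp
  then show "\<exists>i\<in>{1..<length P}. x = P ! (i - 1) \<and> y = P ! i"
    using ij by (intro bexI[of _ j]) auto
next
  assume "\<exists>i\<in>{1..<length P}. x = P ! (i - 1) \<and> y = P ! i"
  then obtain i where i: "1 \<le> i" "i < length P" "x = P ! (i - 1)" "y = P ! i" by auto
  have "P ! j \<notin> {x<..<y}" if "j < length P" for j
  proof (cases "j < i")
    case True
    then have "P ! j \<le> x"
      using i sorted_wrt_nth_less[OF assms, of j "i - 1"] by (cases "j < i - 1") (auto intro: less_imp_le simp: le_less not_less dest: le_antisym)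
    then show ?thesis by auto
  next
    case False
    then have "y \<le> P ! j"
      using i that sorted_wrt_nth_less[OF assms, of i j] by (cases "j = i") auto
    then show ?thesis by auto
  qed
  then have "{x<..<y} \<inter> set P = {}" by (fastforce simp: in_set_conv_nth)
  moreover have "x < y" using i sorted_wrt_nth_less[OF assms, of "i - 1" i] by simp
  ultimately show "consecutive_in (set P) x y" using i by (auto simp: consecutive_in_def)
qed

lemma hd_last_iff:
  fixes P :: "real list"
  assumes "sorted_wrt (<) P"
  shows "P \<noteq> [] \<and> hd P = 0 \<and> last P = 1 \<longleftrightarrow> 0 \<in> set P \<and> 1 \<in> set P \<and> set P \<subseteq> {0..1}"
proof
  assume h: "P \<noteq> [] \<and> hd P = 0 \<and> last P = 1"
  have "0 \<le> P ! i \<and> P ! i \<le> 1" if "i < length P" for i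
  proof -
    have "P ! 0 = 0" "P ! (length P - 1) = 1" using h by (auto simp: hd_conv_nth last_conv_nth)
    moreover have "i = 0 \<or> P ! 0 < P ! i" using sorted_wrt_nth_less[OF assms, of 0 i] that by auto
    moreover have "i = length P - 1 \<or> P ! i < P ! (length P - 1)"
      using sorted_wrt_nth_less[OF assms, of i "length P - 1"] that by linarith
    ultimately show ?thesis by auto
  qed
  then show "0 \<in> set P \<and> 1 \<in> set P \<and> set P \<subseteq> {0..1}"
    using h hd_in_set[of P] last_in_set[of P] by (auto simp: in_set_conv_nth subset_iff)
next
  assume h: "0 \<in> set P \<and> 1 \<in> set P \<and> set P \<subseteq> {0..1}"
  then have ne: "P \<noteq> []" by auto
  then have m: "hd P \<in> set P" "last P \<in> set P" by auto
  obtain i j where ij: "i < length P" "P ! i = 0" "j < length P" "P ! j = 1"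
    using h by (auto simp: in_set_conv_nth)
  have hd: "hd P \<le> 0"
    using ij ne sorted_wrt_nth_less[OF assms, of 0 i] by (cases "i = 0") (auto simp: hd_conv_nth)
  have "j < length P - 1 \<or> j = length P - 1" using ij by linarith
  then have "1 \<le> last P"
    using ij ne sorted_wrt_nth_less[OF assms, of j "length P - 1"] by (auto simp: last_conv_nth)
  then have "hd P = 0" "last P = 1" using m h hd by (meson atLeastAtMost_iff order_antisym subsetD)+
  then show "P \<noteq> [] \<and> hd P = 0 \<and> last P = 1" using ne by blast
qed

lemma monotonicity_partition_iff:
  "monotonicity_partition f P \<longleftrightarrow> sorted_wrt (<) P \<and> partition_set f (set P)"
proof (cases "sorted_wrt (<) P")
  case True
  have "(\<forall>i\<in>{1..<length P}. cont_strict_monotonic_on {P ! (i - 1)<..<P ! i} f) \<longleftrightarrow>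
    (\<forall>x y. consecutive_in (set P) x y \<longrightarrow> cont_strict_monotonic_on {x<..<y} f)"
    unfolding consecutive_in_set_iff[OF True] by blast
  then show ?thesis
    unfolding monotonicity_partition_def partition_set_def using hd_last_iff[OF True] True by auto
qed (simp add: monotonicity_partition_def)

lemma maximal_partition_iff:
  "maximal_partition f P \<longleftrightarrow> sorted_wrt (<) P \<and> maximal_partition_set f (set P)"
proof (cases "sorted_wrt (<) P")
  case True
  then show ?thesis
    unfolding maximal_partition_def maximal_partition_set_def monotonicity_partition_iff
      consecutive_in_set_iff[OF True] by blast
qed (simp add: maximal_partition_def monotonicity_partition_def)

section \<open>Existence and uniqueness of the maximal partition\<close>

lemma cont_strict_monotonic_on_subset:
  "cont_strict_monotonic_on A f \<Longrightarrow> B \<subseteq> A \<Longrightarrow> cont_strict_monotonic_on B f"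
  unfolding cont_strict_monotonic_on_iff
  using continuous_on_subset[of A f B] mono_dir_subset[of _ f A B] by blast

text \<open>The overlap contains two points, so the two directions agree. Points on different sides
  of the overlap are compared through a third point inside it.\<close>

lemma cont_strict_monotonic_on_glue:
  assumes "cont_strict_monotonic_on {a<..<b} f" "cont_strict_monotonic_on {c<..<d} f"
    and "a \<le> c" "c < b" "b \<le> d"
  shows "cont_strict_monotonic_on {a<..<d} f"
proof -
  obtain up dn where m: "mono_dir up f {a<..<b}" "mono_dir dn f {c<..<d}"
    and cont: "continuous_on {a<..<b} f" "continuous_on {c<..<d} f"
    using assms(1,2) unfolding cont_strict_monotonic_on_iff by blast
  have "dn = up" using mono_dir_unique[OF m] assms by auto
  have "{a<..<d} = {a<..<b} \<union> {c<..<d}" using assms by auto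
  then have "continuous_on {a<..<d} f"
    using cont by (metis continuous_on_open_Un open_greaterThanLessThan)
  moreover have "mono_dir up f {a<..<d}"
    unfolding mono_dir_def
  proof (intro ballI impI)
    fix x y assume xy: "x \<in> {a<..<d}" "y \<in> {a<..<d}" "x < y"
    note 1 = m(1)[unfolded mono_dir_def, rule_format]
      and 2 = m(2)[unfolded mono_dir_def \<open>dn = up\<close>, rule_format]
    consider "y < b" | "c < x" | "x \<le> c" "b \<le> y" by linarith
    then show "if up then f x < f y else f y < f x"
    proof cases
      case 3
      obtain z where z: "c < z" "z < b" using dense assms(4) by blast
      show ?thesis using 1[of x z] 2[of z y] xy 3 z assms by (cases up) auto
    qed (use 1[of x y] 2[of x y] xy in auto)
  qed
  ultimately show ?thesis unfolding cont_strict_monotonic_on_iff by blast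
qed

lemma consecutive_in_below:
  assumes "finite S" "0 \<in> S" "0 < x" "x \<in> S"
  obtains l where "consecutive_in S l x"
proof -
  let ?A = "{s \<in> S. s < x}"
  have fin: "finite ?A" and ne: "?A \<noteq> {}" using assms by auto
  have "Max ?A \<in> ?A" using Max_in[OF fin ne] .
  moreover have "s \<le> Max ?A" if "s \<in> S" "s < x" for s using that fin by simp
  ultimately have "consecutive_in S (Max ?A) x"
    using assms(4) unfolding consecutive_in_def by force
  then show ?thesis by (rule that)
qed

lemma consecutive_in_above:
  assumes "finite S" "1 \<in> S" "x < 1" "x \<in> S"
  obtains r where "consecutive_in S x r"
proof -
  let ?A = "{s \<in> S. x < s}"
  have fin: "finite ?A" and ne: "?A \<noteq> {}" using assms by auto
  have "Min ?A \<in> ?A" using Min_in[OF fin ne] .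
  moreover have "Min ?A \<le> s" if "s \<in> S" "x < s" for s using that fin by simp
  ultimately have "consecutive_in S x (Min ?A)"
    using assms(4) unfolding consecutive_in_def by force
  then show ?thesis by (rule that)
qed

lemma consecutive_in_around:
  assumes "finite S" "0 \<in> S" "1 \<in> S" "0 < x" "x < 1" "x \<notin> S"
  obtains l r where "consecutive_in S l r" "l < x" "x < r"
proof -
  let ?A = "{s \<in> S. s < x}"
  have fin: "finite ?A" and ne: "?A \<noteq> {}" using assms by auto
  have l: "Max ?A \<in> ?A" using Max_in[OF fin ne] .
  have m: "s \<le> Max ?A" if "s \<in> S" "s < x" for s using that fin by simp
  obtain r where r: "consecutive_in S (Max ?A) r"
    using consecutive_in_above[of S "Max ?A"] assms l by auto
  have "x < r"
    using r m[of r] assms(6) unfolding consecutive_in_def by (cases r x rule: linorder_cases) auto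
  then show ?thesis using that r l by blast
qed

text \<open>The right hand side does not mention \<open>S\<close>, which gives uniqueness. If a
  point of \<open>S\<close> had such a neighbourhood, the piece to its left could be glued to it,
  against maximality.\<close>

lemma maximal_partition_set_interior:
  assumes S: "maximal_partition_set f S" and x: "0 < x" "x < 1"
  shows "x \<in> S \<longleftrightarrow> \<not> (\<exists>c d. c < x \<and> x < d \<and> cont_strict_monotonic_on {c<..<d} f)"
proof
  have P: "finite S" "0 \<in> S" "1 \<in> S"
      "\<And>x y. consecutive_in S x y \<Longrightarrow> cont_strict_monotonic_on {x<..<y} f"
    using S unfolding maximal_partition_set_def partition_set_def by blast+
  show "\<not> (\<exists>c d. c < x \<and> x < d \<and> cont_strict_monotonic_on {c<..<d} f)" if "x \<in> S"
  proof (intro notI, elim exE conjE)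
    fix c d assume cd: "c < x" "x < d" "cont_strict_monotonic_on {c<..<d} f"
    obtain l where l: "consecutive_in S l x" using consecutive_in_below[OF P(1,2) x(1) \<open>x \<in> S\<close>] .
    then have lx: "l < x" "0 \<le> l"
      using S by (auto simp: consecutive_in_def maximal_partition_set_def partition_set_def)
    \<comment> \<open>The bound by 1 keeps the enlarged interval inside the unit interval, since
      maximality only speaks about such intervals.\<close>
    have "cont_strict_monotonic_on {max l c<..<min d 1} f"
      by (rule cont_strict_monotonic_on_subset[OF cd(3)]) auto
    then have "cont_strict_monotonic_on {l<..<min d 1} f"
      using cont_strict_monotonic_on_glue[of l x f "max l c" "min d 1"] P(4)[OF l] lx cd x by auto
    moreover have "x \<in> {l<..<min d 1}" using lx cd x by auto
    then have "{l<..<x} \<subset> {l<..<min d 1}" using cd x by fastforce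
    ultimately show False
      using S l lx unfolding maximal_partition_set_def by (metis min.cobounded2)
  qed
  show "x \<in> S" if no: "\<not> (\<exists>c d. c < x \<and> x < d \<and> cont_strict_monotonic_on {c<..<d} f)"
  proof (rule ccontr)
    assume "x \<notin> S"
    then show False using consecutive_in_around[OF P(1,2,3) x] P(4) no by blast
  qed
qed

lemma maximal_partition_set_unique:
  assumes "maximal_partition_set f S" "maximal_partition_set f S'"
  shows "S = S'"
proof -
  have "S \<subseteq> {0..1}" "S' \<subseteq> {0..1}" "{0, 1} \<subseteq> S" "{0, 1} \<subseteq> S'"
    using assms unfolding maximal_partition_set_def partition_set_def by auto
  moreover have "x \<in> S \<longleftrightarrow> x \<in> S'" if "0 < x" "x < 1" for x
    using maximal_partition_set_interior[OF assms(1) that]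
      maximal_partition_set_interior[OF assms(2) that] by simp
  ultimately have "x \<in> S \<longleftrightarrow> x \<in> S'" for x
    by (cases "x = 0 \<or> x = 1"; cases "0 < x \<and> x < 1") force+
  then show ?thesis by blast
qed

text \<open>Only the pair around \<open>x\<close> becomes newly adjacent, and it is the pair
  \<open>l\<close>, \<open>r\<close>; every other adjacent pair was adjacent before.\<close>

lemma partition_set_remove:
  assumes S: "partition_set f S" and x: "0 < x" "x < 1" "x \<in> S"
    and lr: "consecutive_in S l x" "consecutive_in S x r" "cont_strict_monotonic_on {l<..<r} f"
  shows "partition_set f (S - {x})"
  unfolding partition_set_def
proof (intro conjI allI impI)
  fix u v assume uv: "consecutive_in (S - {x}) u v"
  show "cont_strict_monotonic_on {u<..<v} f"
  proof (cases "u < x \<and> x < v")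
    case True
    have "u \<le> l" "r \<le> v" "\<not> u < l" "\<not> r < v"
      using True uv lr(1,2) unfolding consecutive_in_def
      by (metis Diff_iff disjoint_iff greaterThanLessThan_iff less_le_not_le linorder_not_le order_less_trans singletonD)+
    then have "u = l" "v = r" by auto
    then show ?thesis using lr(3) by simp
  next
    case False
    then have "consecutive_in S u v" using uv unfolding consecutive_in_def by fastforce
    then show ?thesis using S unfolding partition_set_def by blast
  qed
qed (use S x in \<open>auto simp: partition_set_def\<close>)

lemma maximal_partition_set_exists:
  assumes "partition_set f S"
  shows "\<exists>S'. maximal_partition_set f S'"
  using assms
proof (induction "card S" arbitrary: S rule: less_induct)
  case less
  show ?case
  proof (cases "maximal_partition_set f S")
    case False
    note S = less.prems[unfolded partition_set_def]
    obtain x y c d where xy: "consecutive_in S x y" "0 \<le> c" "d \<le> 1" "{x<..<y} \<subset> {c<..<d}"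
        "cont_strict_monotonic_on {c<..<d} f"
      using False less.prems unfolding maximal_partition_set_def by blast
    have "x < y" using xy(1) by (simp add: consecutive_in_def)
    then have cd: "c \<le> x" "y \<le> d" "c < x \<or> y < d"
      using xy(4) by (auto simp: psubset_eq greaterThanLessThan_subseteq_greaterThanLessThan)
    have "\<exists>z\<in>S. partition_set f (S - {z})"
    proof (cases "c < x")
      case True
      then have x: "0 < x" "x < 1" "x \<in> S" using xy cd \<open>x < y\<close> by (auto simp: consecutive_in_def)
      obtain l where l: "consecutive_in S l x" using consecutive_in_below[of S x] S x by auto
      have "cont_strict_monotonic_on {max l c<..<y} f"
        using cd by (intro cont_strict_monotonic_on_subset[OF xy(5)]) auto
      then have "cont_strict_monotonic_on {l<..<y} f"
        using cont_strict_monotonic_on_glue[of l x f "max l c" y] S l True \<open>x < y\<close>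
        by (auto simp: consecutive_in_def)
      then show ?thesis using partition_set_remove[OF less.prems x l xy(1)] x by blast
    next
      case False
      then have y: "0 < y" "y < 1" "y \<in> S" using xy cd \<open>x < y\<close> by (auto simp: consecutive_in_def)
      obtain r where r: "consecutive_in S y r" using consecutive_in_above[of S y] S y by auto
      have "cont_strict_monotonic_on {x<..<min r d} f"
        using cd by (intro cont_strict_monotonic_on_subset[OF xy(5)]) auto
      then have "cont_strict_monotonic_on {x<..<r} f"
        using cont_strict_monotonic_on_glue[of x "min r d" f y r] S r False cd \<open>x < y\<close>
        by (auto simp: consecutive_in_def)
      then show ?thesis using partition_set_remove[OF less.prems y xy(1) r] y by blast
    qed
    then obtain z where z: "z \<in> S" "partition_set f (S - {z})" by blast
    then show ?thesis using less.hyps[of "S - {z}"] S card_Diff1_less[of S z] by blast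
  qed blast
qed

lemma maximal_partition_assoc_partition:
  assumes "piecewise_monotonic f"
  shows "maximal_partition f (assoc_partition f)"
  unfolding assoc_partition_def
proof (rule theI')
  obtain S where S: "maximal_partition_set f S"
    using assms maximal_partition_set_exists
    unfolding piecewise_monotonic_def monotonicity_partition_iff by blast
  then have "finite S" by (simp add: maximal_partition_set_def partition_set_def)
  then have "maximal_partition f (sorted_list_of_set S)"
    using S unfolding maximal_partition_iff by (simp add: strict_sorted_list_of_set)
  moreover have "P = Q" if "maximal_partition f P" "maximal_partition f Q" for P Q
  proof -
    have "set P = set Q" using that maximal_partition_set_unique unfolding maximal_partition_iff by blast
    then show ?thesis using that strict_sorted_equal unfolding maximal_partition_iff by blast
  qed
  ultimately show "\<exists>!P. maximal_partition f P" by blast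
qed

section \<open>The action on germs\<close>

lemma germs_subset: "0 \<le> c \<Longrightarrow> d \<le> 1 \<Longrightarrow> germs c d \<subseteq> germs 0 1"
  by (auto simp: germs_def)

abbreviation all_germs :: "germ set" where
  "all_germs \<equiv> germs 0 1"

definition twin :: "germ \<Rightarrow> germ" where
  "twin g = (fst g, \<not> snd g)"

lemma fst_twin [simp]: "fst (twin g) = fst g" and snd_twin [simp]: "snd (twin g) = (\<not> snd g)"
  by (simp_all add: twin_def)

locale piecewise_monotonic_map =
  fixes \<tau> :: "real \<Rightarrow> real"
  assumes pm: "piecewise_monotonic \<tau>"
begin

abbreviation cuts :: "real set" where
  "cuts \<equiv> set (assoc_partition \<tau>)"

definition lo :: "nat \<Rightarrow> real" where "lo i = assoc_partition \<tau> ! (i - 1)"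
definition hi :: "nat \<Rightarrow> real" where "hi i = assoc_partition \<tau> ! i"

lemma open_piece_eq: "open_piece \<tau> i = {lo i<..<hi i}"
  and closed_piece_eq: "closed_piece \<tau> i = {lo i..hi i}"
  by (simp_all add: open_piece_def closed_piece_def lo_def hi_def)

lemma sorted_partition: "sorted_wrt (<) (assoc_partition \<tau>)"
  and partition_set_cuts: "partition_set \<tau> cuts"
  using maximal_partition_assoc_partition[OF pm]
  unfolding maximal_partition_iff maximal_partition_set_def by auto

lemma cuts_facts: "finite cuts" "0 \<in> cuts" "1 \<in> cuts" "cuts \<subseteq> {0..1}"
  using partition_set_cuts by (auto simp: partition_set_def)

lemma consecutive_iff: "consecutive_in cuts x y \<longleftrightarrow> (\<exists>i\<in>pieces \<tau>. x = lo i \<and> y = hi i)"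
  unfolding consecutive_in_set_iff[OF sorted_partition] pieces_def lo_def hi_def by blast

lemma finite_pieces: "finite (pieces \<tau>)"
  by (simp add: pieces_def)

lemma piece_bounds:
  assumes "i \<in> pieces \<tau>"
  shows "0 \<le> lo i" "lo i < hi i" "hi i \<le> 1" "lo i \<in> cuts" "hi i \<in> cuts"
proof -
  have "consecutive_in cuts (lo i) (hi i)" using assms consecutive_iff by blast
  then show "0 \<le> lo i" "lo i < hi i" "hi i \<le> 1" "lo i \<in> cuts" "hi i \<in> cuts"
    using cuts_facts(4) unfolding consecutive_in_def by auto
qed

lemma germs_piece_subset: "i \<in> pieces \<tau> \<Longrightarrow> germs (lo i) (hi i) \<subseteq> germs 0 1"
  by (intro germs_subset piece_bounds)

lemma pieces_ordered:
  assumes "i \<in> pieces \<tau>" "j \<in> pieces \<tau>" "i < j"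
  shows "hi i \<le> lo j"
proof (cases "i = j - 1")
  case False
  then show ?thesis
    using assms sorted_wrt_nth_less[OF sorted_partition, of i "j - 1"]
    by (force simp: pieces_def hi_def lo_def)
qed (simp add: hi_def lo_def)

text \<open>Adjacent closed pieces share an end point, but a germ there points into only one of
  them. Hence \<open>piece_of\<close> is well defined and the action is single valued also at the
  cuts.\<close>

lemma germ_pieces_disjoint:
  assumes "i \<in> pieces \<tau>" "j \<in> pieces \<tau>" "g \<in> germs (lo i) (hi i)" "g \<in> germs (lo j) (hi j)"
  shows "i = j"
  using pieces_ordered[of i j] pieces_ordered[of j i] assms
  by (cases i j rule: linorder_cases; cases "snd g") (auto simp: germs_def)

lemma germ_piece_exists:
  assumes "g \<in> all_germs"
  shows "\<exists>i\<in>pieces \<tau>. g \<in> germs (lo i) (hi i)"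
proof -
  obtain x s where g: "g = (x, s)" "0 \<le> x" "x \<le> 1" "s \<longrightarrow> x < 1" "\<not> s \<longrightarrow> 0 < x"
    using assms by (auto simp: germs_def)
  have "\<exists>l r. consecutive_in cuts l r \<and> g \<in> germs l r"
  proof (cases "x \<in> cuts")
    case True
    show ?thesis
    proof (cases s)
      case s: True
      obtain r where r: "consecutive_in cuts x r"
        using consecutive_in_above[of cuts x] cuts_facts True g s by blast
      then have "g \<in> germs x r" using g s by (auto simp: germs_def consecutive_in_def)
      then show ?thesis using r by blast
    next
      case s: False
      obtain l where l: "consecutive_in cuts l x"
        using consecutive_in_below[of cuts x] cuts_facts True g s by blast
      then have "g \<in> germs l x" using g s by (auto simp: germs_def consecutive_in_def)
      then show ?thesis using l by blast
    qed
  next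
    case False
    then have "0 < x" "x < 1" using g cuts_facts by (force simp: less_le)+
    then obtain l r where lr: "consecutive_in cuts l r" "l < x" "x < r"
      using consecutive_in_around[of cuts x] cuts_facts False by blast
    then have "g \<in> germs l r" using g by (auto simp: germs_def)
    then show ?thesis using lr by blast
  qed
  then show ?thesis unfolding consecutive_iff by blast
qed

section \<open>Branches as homeomorphisms between closed intervals\<close>

lemma tau_range: "x \<in> {0..1} \<Longrightarrow> \<tau> x \<in> {0..1}"
  using pm by (auto simp: piecewise_monotonic_def Pi_iff)

lemma branch_homeo_exists:
  assumes i: "i \<in> pieces \<tau>"
  shows "\<exists>up f' c d. interval_homeo up (branch \<tau> i) (lo i) (hi i) f' c d \<and> 0 \<le> c \<and> d \<le> 1 \<and>
    (\<forall>x\<in>open_piece \<tau> i. branch \<tau> i x = \<tau> x)"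
proof -
  note b = piece_bounds[OF i]
  have "cont_strict_monotonic_on {lo i<..<hi i} \<tau>"
    using partition_set_cuts i consecutive_iff unfolding partition_set_def by blast
  then obtain up where up: "continuous_on {lo i<..<hi i} \<tau>" "mono_dir up \<tau> {lo i<..<hi i}"
    unfolding cont_strict_monotonic_on_iff by blast
  have "\<tau> ` {lo i<..<hi i} \<subseteq> {0..1}" using tau_range b by fastforce
  then obtain F where F: "continuous_on {lo i..hi i} F" "mono_dir up F {lo i..hi i}"
      "\<forall>x\<in>{lo i<..<hi i}. F x = \<tau> x"
    using strictly_monotone_extension[OF b(2) up] by blast
  have br: "branch \<tau> i x = F x" if "x \<in> {lo i..hi i}" for x
    unfolding branch_def open_piece_eq
    using Lim_within_interval_extension[OF b(2) F(1), of \<tau> x] F(3) that by blast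
  have "continuous_on {lo i..hi i} (branch \<tau> i)"
    by (rule continuous_on_eq[OF F(1)]) (simp add: br)
  moreover have "mono_dir up (branch \<tau> i) {lo i..hi i}"
    using F(2) br by (simp add: mono_dir_def)
  ultimately obtain f' c d where h: "interval_homeo up (branch \<tau> i) (lo i) (hi i) f' c d"
    using interval_homeo_exists b(2) by blast
  have "F ` {lo i..hi i} = branch \<tau> i ` {lo i..hi i}"
    using br by (intro image_cong) auto
  then have "F ` {lo i..hi i} = {c..d}" "c < d"
    using h unfolding interval_homeo_def by simp_all
  moreover have "F ` {lo i..hi i} \<subseteq> {0..1}"
  proof -
    have "F ` {lo i<..<hi i} = \<tau> ` {lo i<..<hi i}"
      using F(3) by (intro image_cong) auto
    \<comment> \<open>The values at the end points are limits of values on the open piece, so the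
      image interval stays in the closed unit interval.\<close>
    moreover have "F ` closure {lo i<..<hi i} \<subseteq> closure (F ` {lo i<..<hi i})"
      using F(1) b(2) by (intro image_closure_subset closed_closure closure_subset) simp
    ultimately show ?thesis
      using closure_minimal[OF \<open>\<tau> ` {lo i<..<hi i} \<subseteq> {0..1}\<close>] b(2) by auto
  qed
  ultimately have "{c..d} \<subseteq> {0..1}" "c < d" by auto
  then have "0 \<le> c" "d \<le> 1" by auto
  moreover have "\<forall>x\<in>open_piece \<tau> i. branch \<tau> i x = \<tau> x"
    using br F(3) by (simp add: open_piece_eq)
  ultimately show ?thesis using h by blast
qed

text \<open>Direction, inverse and image interval of a branch are picked by choice; the direction
  comes first because \<open>branch_data\<close> refers to it.\<close>

definition upward :: "nat \<Rightarrow> bool" where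
  "upward i = (SOME up. \<exists>f' c d. interval_homeo up (branch \<tau> i) (lo i) (hi i) f' c d \<and> 0 \<le> c \<and> d \<le> 1)"

definition branch_data :: "nat \<Rightarrow> (real \<Rightarrow> real) \<times> real \<times> real" where
  "branch_data i = (SOME (f', c, d). interval_homeo (upward i) (branch \<tau> i) (lo i) (hi i) f' c d
     \<and> 0 \<le> c \<and> d \<le> 1)"

definition inverse_branch :: "nat \<Rightarrow> real \<Rightarrow> real" where "inverse_branch i = fst (branch_data i)"
definition im_lo :: "nat \<Rightarrow> real" where "im_lo i = fst (snd (branch_data i))"
definition im_hi :: "nat \<Rightarrow> real" where "im_hi i = snd (snd (branch_data i))"

lemma branch_homeo:
  assumes i: "i \<in> pieces \<tau>"
  shows "interval_homeo (upward i) (branch \<tau> i) (lo i) (hi i) (inverse_branch i) (im_lo i) (im_hi i)"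
    and "0 \<le> im_lo i" "im_hi i \<le> 1"
proof -
  have "\<exists>f' c d. interval_homeo (upward i) (branch \<tau> i) (lo i) (hi i) f' c d \<and> 0 \<le> c \<and> d \<le> 1"
    unfolding upward_def by (rule someI_ex) (use branch_homeo_exists[OF i] in blast)
  then have "\<exists>p. case p of (f', c, d) \<Rightarrow>
      interval_homeo (upward i) (branch \<tau> i) (lo i) (hi i) f' c d \<and> 0 \<le> c \<and> d \<le> 1"
    by auto
  then have "case branch_data i of (f', c, d) \<Rightarrow>
      interval_homeo (upward i) (branch \<tau> i) (lo i) (hi i) f' c d \<and> 0 \<le> c \<and> d \<le> 1"
    unfolding branch_data_def by (rule someI_ex)
  then show "interval_homeo (upward i) (branch \<tau> i) (lo i) (hi i) (inverse_branch i) (im_lo i) (im_hi i)"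
    and "0 \<le> im_lo i" "im_hi i \<le> 1"
    by (auto simp: inverse_branch_def im_lo_def im_hi_def split: prod.splits)
qed

lemma branch_open_piece: "i \<in> pieces \<tau> \<Longrightarrow> x \<in> open_piece \<tau> i \<Longrightarrow> branch \<tau> i x = \<tau> x"
  using branch_homeo_exists[of i] by auto

lemma branch_in: "i \<in> pieces \<tau> \<Longrightarrow> x \<in> closed_piece \<tau> i \<Longrightarrow> branch \<tau> i x \<in> {0..1}"
proof -
  assume i: "i \<in> pieces \<tau>" and x: "x \<in> closed_piece \<tau> i"
  have "branch \<tau> i ` {lo i..hi i} = {im_lo i..im_hi i}"
    using branch_homeo(1)[OF i] unfolding interval_homeo_def by blast
  then have "branch \<tau> i x \<in> {im_lo i..im_hi i}" using x unfolding closed_piece_eq by blast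
  then show ?thesis using branch_homeo(2,3)[OF i] by auto
qed

lemma branch_inj_on: "i \<in> pieces \<tau> \<Longrightarrow> inj_on (branch \<tau> i) (closed_piece \<tau> i)"
  using branch_homeo(1)[of i] mono_dir_inj_on[of "upward i" "branch \<tau> i" "{lo i..hi i}"]
  by (simp add: interval_homeo_def closed_piece_eq)

section \<open>The map induced on germs, its inverse branches, and twins\<close>

definition piece_of :: "germ \<Rightarrow> nat" where
  "piece_of g = (THE i. i \<in> pieces \<tau> \<and> g \<in> germs (lo i) (hi i))"

lemma piece_of:
  assumes "g \<in> all_germs"
  shows "piece_of g \<in> pieces \<tau>" "g \<in> germs (lo (piece_of g)) (hi (piece_of g))"
proof -
  have "\<exists>!i. i \<in> pieces \<tau> \<and> g \<in> germs (lo i) (hi i)"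
    using germ_piece_exists[OF assms] germ_pieces_disjoint[of _ _ g] by blast
  from theI'[OF this]
  show "piece_of g \<in> pieces \<tau>" "g \<in> germs (lo (piece_of g)) (hi (piece_of g))"
    unfolding piece_of_def by auto
qed

lemma piece_of_eqI:
  assumes "i \<in> pieces \<tau>" "g \<in> germs (lo i) (hi i)"
  shows "piece_of g = i"
proof -
  have "g \<in> all_germs"
    using assms(2) germs_piece_subset[OF assms(1)] by blast
  from germ_pieces_disjoint[OF piece_of(1)[OF this] assms(1) piece_of(2)[OF this] assms(2)]
  show ?thesis .
qed

definition germ_step :: "germ \<Rightarrow> germ" where
  "germ_step g = germ_map (branch \<tau> (piece_of g)) (upward (piece_of g)) g"

definition inverse_step :: "nat \<Rightarrow> germ \<Rightarrow> germ" where
  "inverse_step i = germ_map (inverse_branch i) (upward i)"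

lemma germ_step_image:
  assumes "g \<in> all_germs"
  shows "germ_step g \<in> germs (im_lo (piece_of g)) (im_hi (piece_of g))"
  unfolding germ_step_def
  by (rule germ_map_in[OF branch_homeo(1)[OF piece_of(1)[OF assms]] piece_of(2)[OF assms]])

lemma germ_step_in: "g \<in> all_germs \<Longrightarrow> germ_step g \<in> all_germs"
  by (rule subsetD[OF germs_subset germ_step_image]) (simp_all add: branch_homeo(2,3) piece_of(1))

lemma fst_germ_step: "fst (germ_step g) = branch \<tau> (piece_of g) (fst g)"
  by (simp add: germ_step_def germ_map_def)

lemma piece_of_locally_constant:
  assumes "g \<in> all_germs"
  shows "\<forall>\<^sub>F h in germ_nhds g. piece_of h = piece_of g"
  using eventually_germs_iff[of "lo (piece_of g)" "hi (piece_of g)" g]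
  by eventually_elim (rule piece_of_eqI[OF piece_of(1)[OF assms]], simp add: piece_of(2)[OF assms])

lemma filterlim_germ_step:
  assumes g: "g \<in> all_germs"
  shows "filterlim germ_step (germ_nhds (germ_step g)) (germ_nhds g)"
proof -
  let ?i = "piece_of g"
  have "filterlim (germ_map (branch \<tau> ?i) (upward ?i)) (germ_nhds (germ_step g)) (germ_nhds g)"
    unfolding germ_step_def
    using filterlim_germ_map[OF branch_homeo(1)[OF piece_of(1)[OF g]] piece_of(2)[OF g]]
      branch_homeo(2,3)[OF piece_of(1)[OF g]] piece_bounds[OF piece_of(1)[OF g]] by blast
  moreover have "\<forall>\<^sub>F h in germ_nhds g. germ_map (branch \<tau> ?i) (upward ?i) h = germ_step h"
    using piece_of_locally_constant[OF g] by eventually_elim (simp add: germ_step_def)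
  ultimately show ?thesis by (rule filterlim_mono_eventually[OF _ order_refl order_refl])
qed

lemma inverse_step:
  assumes "i \<in> pieces \<tau>" "g \<in> germs (im_lo i) (im_hi i)"
  shows "inverse_step i g \<in> all_germs" "piece_of (inverse_step i g) = i"
    "germ_step (inverse_step i g) = g"
proof -
  have h: "inverse_step i g \<in> germs (lo i) (hi i)"
    unfolding inverse_step_def
    using germ_map_in[OF interval_homeo_sym[OF branch_homeo(1)[OF assms(1)]] assms(2)] .
  then show "inverse_step i g \<in> all_germs"
    using germs_piece_subset[OF assms(1)] by blast
  show p: "piece_of (inverse_step i g) = i" using piece_of_eqI assms(1) h by blast
  show "germ_step (inverse_step i g) = g"
    unfolding germ_step_def p unfolding inverse_step_def
    using germ_map_inverse[OF interval_homeo_sym[OF branch_homeo(1)[OF assms(1)]] assms(2)] .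
qed

lemma inverse_step_germ_step: "g \<in> all_germs \<Longrightarrow> inverse_step (piece_of g) (germ_step g) = g"
  unfolding inverse_step_def germ_step_def
  by (rule germ_map_inverse[OF branch_homeo(1)[OF piece_of(1)] piece_of(2)])

lemma filterlim_inverse_step:
  assumes "i \<in> pieces \<tau>" "g \<in> germs (im_lo i) (im_hi i)"
  shows "filterlim (inverse_step i) (germ_nhds (inverse_step i g)) (germ_nhds g)"
  unfolding inverse_step_def
proof (rule filterlim_germ_map)
  show "interval_homeo (upward i) (inverse_branch i) (im_lo i) (im_hi i) (branch \<tau> i) (lo i) (hi i)"
    by (rule interval_homeo_sym[OF branch_homeo(1)[OF assms(1)]])
qed (simp_all add: assms branch_homeo(2,3) piece_bounds)

lemma germ_step_inj:
  assumes "g \<in> all_germs" "h \<in> all_germs" "piece_of g = piece_of h" "germ_step g = germ_step h"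
  shows "g = h"
proof -
  have "g = inverse_step (piece_of h) (germ_step h)"
    unfolding assms(3,4)[symmetric] by (rule inverse_step_germ_step[OF assms(1), symmetric])
  then show ?thesis using inverse_step_germ_step[OF assms(2)] by (rule trans)
qed

definition step_preimages :: "germ \<Rightarrow> germ set" where
  "step_preimages g = {h \<in> all_germs. germ_step h = g}"

lemma step_preimages_eq:
  "step_preimages g = (\<lambda>i. inverse_step i g) ` {i \<in> pieces \<tau>. g \<in> germs (im_lo i) (im_hi i)}"
proof (intro equalityI subsetI)
  fix h assume "h \<in> step_preimages g"
  then have "h \<in> all_germs" "germ_step h = g" by (auto simp: step_preimages_def)
  then show "h \<in> (\<lambda>i. inverse_step i g) ` {i \<in> pieces \<tau>. g \<in> germs (im_lo i) (im_hi i)}"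
    using piece_of(1)[of h] germ_step_image[of h] inverse_step_germ_step[of h]
    by (intro image_eqI[of _ _ "piece_of h"]) auto
qed (auto simp: step_preimages_def inverse_step)

lemma finite_step_preimages: "finite (step_preimages g)"
  unfolding step_preimages_eq using finite_pieces by simp

text \<open>Indexing by pieces separates the condition for a preimage to exist from the value at it.
  Both can be controlled near \<open>g\<close>, which gives continuity of the transfer
  operator.\<close>

lemma sum_step_preimages:
  "(\<Sum>h\<in>step_preimages g. F h) =
     (\<Sum>i\<in>{i \<in> pieces \<tau>. g \<in> germs (im_lo i) (im_hi i)}. F (inverse_step i g))"
proof -
  have "inj_on (\<lambda>i. inverse_step i g) {i \<in> pieces \<tau>. g \<in> germs (im_lo i) (im_hi i)}"
    using inverse_step(2) by (intro inj_onI) (metis (mono_tags, lifting) mem_Collect_eq)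
  then show ?thesis unfolding step_preimages_eq by (simp add: sum.reindex)
qed

text \<open>At a point that is not a cut both sides belong to the same piece and are moved by the
  same branch, so twins stay twins until their orbit reaches a cut.\<close>

lemma twin_step:
  assumes "g \<in> all_germs" "fst g \<notin> cuts"
  shows "twin g \<in> all_germs" "piece_of (twin g) = piece_of g" "germ_step (twin g) = twin (germ_step g)"
proof -
  have "fst g \<noteq> 0" "fst g \<noteq> 1" using assms cuts_facts by auto
  then show t: "twin g \<in> all_germs" using assms(1) by (auto simp: germs_def twin_def)
  have "fst g \<noteq> lo (piece_of g)" "fst g \<noteq> hi (piece_of g)"
    using assms piece_bounds(4,5) piece_of(1) by metis+
  then have "twin g \<in> germs (lo (piece_of g)) (hi (piece_of g))"
    using piece_of(2)[OF assms(1)] by (auto simp: germs_def twin_def)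
  then show p: "piece_of (twin g) = piece_of g" using piece_of_eqI piece_of(1) assms(1) by blast
  show "germ_step (twin g) = twin (germ_step g)"
    unfolding germ_step_def p by (auto simp: germ_map_def twin_def)
qed

definition boundary_germs :: "germ set" where
  "boundary_germs = {g \<in> all_germs. fst g \<in> cuts}"

lemma finite_boundary_germs: "finite boundary_germs"
  by (rule finite_subset[of _ "cuts \<times> UNIV"]) (auto simp: boundary_germs_def cuts_facts(1))

lemma iterate_in: "g \<in> all_germs \<Longrightarrow> (germ_step ^^ n) g \<in> all_germs"
  by (induction n) (auto simp: germ_step_in)

lemma filterlim_iterate:
  "g \<in> all_germs \<Longrightarrow> filterlim (germ_step ^^ n) (germ_nhds ((germ_step ^^ n) g)) (germ_nhds g)"
proof (induction n)
  case 0
  then show ?case by (simp add: filterlim_ident id_def)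
next
  case (Suc n)
  then show ?case
    using filterlim_compose[OF filterlim_germ_step[OF iterate_in[OF Suc.prems, of n]] Suc.IH]
    by (simp add: comp_def)
qed

end

section \<open>Counting words\<close>

context piecewise_monotonic_map
begin

text \<open>The labelling is arbitrary: \<open>piece_of\<close> yields the words of itineraries, and
  a labelling by cells of a grid yields covers of the interval.\<close>

definition label_word :: "(germ \<Rightarrow> 'a) \<Rightarrow> nat \<Rightarrow> germ \<Rightarrow> 'a list" where
  "label_word lab n g = map (\<lambda>j. lab ((germ_step ^^ j) g)) [0..<n]"

definition words :: "nat \<Rightarrow> nat list set" where
  "words n = label_word piece_of n ` all_germs"

definition word_count :: "nat \<Rightarrow> nat" where
  "word_count n = card (words n)"

definition iterate_preimages :: "nat \<Rightarrow> germ \<Rightarrow> germ set" where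
  "iterate_preimages n g = {h \<in> all_germs. (germ_step ^^ n) h = g}"

lemma length_label_word [simp]: "length (label_word lab n g) = n"
  by (simp add: label_word_def)

lemma nth_label_word: "j < n \<Longrightarrow> label_word lab n g ! j = lab ((germ_step ^^ j) g)"
  by (simp add: label_word_def)

lemma label_word_eq_iff:
  "label_word lab n g = label_word lab n h \<longleftrightarrow>
     (\<forall>j<n. lab ((germ_step ^^ j) g) = lab ((germ_step ^^ j) h))"
  by (auto simp: label_word_def)

lemma label_word_add:
  "label_word lab (m + n) g = label_word lab m g @ label_word lab n ((germ_step ^^ m) g)"
  by (rule nth_equalityI)
    (auto simp: nth_append nth_label_word funpow_add[symmetric, THEN fun_cong, simplified comp_apply])

lemma words_subset: "words n \<subseteq> {xs. set xs \<subseteq> pieces \<tau> \<and> length xs = n}"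
  unfolding words_def label_word_def by (auto intro!: piece_of(1) iterate_in)

lemma finite_words: "finite (words n)"
  using finite_lists_length_eq[OF finite_pieces] words_subset finite_subset by blast

lemma all_germs_nonempty: "(0, True) \<in> all_germs"
  by (simp add: germs_def)

lemma word_count_pos: "0 < word_count n"
  unfolding word_count_def using finite_words all_germs_nonempty
  by (auto simp: card_gt_0_iff words_def)

text \<open>Cutting a word after \<open>m\<close> letters leaves the word of the \<open>m\<close>-th
  image, and the two parts determine the whole.\<close>

lemma word_count_add_le: "word_count (m + n) \<le> word_count m * word_count n"
proof -
  have "words (m + n) \<subseteq> (\<lambda>(u, v). u @ v) ` (words m \<times> words n)"
    unfolding words_def label_word_add using iterate_in by fastforce
  then have "word_count (m + n) \<le> card (words m \<times> words n)"
    unfolding word_count_def using finite_words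
    by (meson card_image_le card_mono finite_SigmaI finite_imageI le_trans)
  then show ?thesis by (simp add: word_count_def card_cartesian_product)
qed

lemma word_count_add_ge: "word_count m \<le> word_count (m + n)"
proof -
  have "words m \<subseteq> take m ` words (m + n)"
  proof
    fix w assume "w \<in> words m"
    then obtain g where "g \<in> all_germs" "w = label_word piece_of m g" by (auto simp: words_def)
    then show "w \<in> take m ` words (m + n)"
      by (intro image_eqI[of _ _ "label_word piece_of (m + n) g"])
        (auto simp: words_def label_word_add)
  qed
  then show ?thesis unfolding word_count_def using finite_words
    by (meson card_image_le card_mono finite_imageI le_trans)
qed

lemma word_count_mono: "m \<le> n \<Longrightarrow> word_count m \<le> word_count n"
  using word_count_add_ge[of m "n - m"] by simp

lemma label_word_step: "g \<in> all_germs \<Longrightarrow>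
    label_word lab (Suc n) g = lab g # label_word lab n (germ_step g)"
  using label_word_add[of lab 1 n g] by (simp add: label_word_def)

lemma iterate_inj:
  assumes "g \<in> all_germs" "h \<in> all_germs" "label_word piece_of n g = label_word piece_of n h"
    and "(germ_step ^^ n) g = (germ_step ^^ n) h"
  shows "g = h"
  using assms
proof (induction n arbitrary: g h)
  case (Suc n)
  note w = Suc.prems(3)[unfolded label_word_step[OF Suc.prems(1)] label_word_step[OF Suc.prems(2)] list.inject]
  have "(germ_step ^^ n) (germ_step g) = (germ_step ^^ n) (germ_step h)"
    using Suc.prems(4) by (simp only: funpow_Suc_right comp_apply)
  then have "germ_step g = germ_step h"
    using Suc.IH[OF germ_step_in[OF Suc.prems(1)] germ_step_in[OF Suc.prems(2)]] w by blast
  then show ?case using germ_step_inj[OF Suc.prems(1,2)] w by blast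
qed simp

lemma inj_on_word_iterate_preimages: "inj_on (label_word piece_of n) (iterate_preimages n g)"
  using iterate_inj by (intro inj_onI) (auto simp: iterate_preimages_def)

lemma iterate_preimages_words: "label_word piece_of n ` iterate_preimages n g \<subseteq> words n"
  by (auto simp: iterate_preimages_def words_def)

lemma finite_iterate_preimages: "finite (iterate_preimages n g)"
  using inj_on_finite[OF inj_on_word_iterate_preimages iterate_preimages_words finite_words] .

lemma card_iterate_preimages_le: "card (iterate_preimages n g) \<le> word_count n"
  unfolding word_count_def
  using card_inj_on_le[OF inj_on_word_iterate_preimages iterate_preimages_words finite_words] .

lemma label_word_locally_constant:
  assumes lab: "\<And>g. g \<in> all_germs \<Longrightarrow> \<forall>\<^sub>F h in germ_nhds g. lab h = lab g"
    and g: "g \<in> all_germs"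
  shows "\<forall>\<^sub>F h in germ_nhds g. label_word lab n h = label_word lab n g"
proof -
  have "\<forall>\<^sub>F h in germ_nhds g. lab ((germ_step ^^ j) h) = lab ((germ_step ^^ j) g)" for j
    using filterlim_iterate[OF g, of j] lab[OF iterate_in[OF g, of j]] unfolding filterlim_iff by blast
  then have "\<forall>\<^sub>F h in germ_nhds g. \<forall>j\<in>{..<n}. lab ((germ_step ^^ j) h) = lab ((germ_step ^^ j) g)"
    by (intro eventually_ball_finite) auto
  then show ?thesis by eventually_elim (auto simp: label_word_eq_iff)
qed

lemma twin_iterate:
  assumes "g \<in> all_germs" "\<And>j. j < n \<Longrightarrow> (germ_step ^^ j) g \<notin> boundary_germs" "j \<le> n"
  shows "(germ_step ^^ j) (twin g) = twin ((germ_step ^^ j) g)"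
  using assms(3)
proof (induction j)
  case (Suc j)
  have "fst ((germ_step ^^ j) g) \<notin> cuts"
    using assms(2)[of j] Suc.prems iterate_in[OF assms(1), of j] by (auto simp: boundary_germs_def)
  then show ?case using Suc twin_step(3)[OF iterate_in[OF assms(1)]] by simp
qed simp

text \<open>The leftmost germ with a given label word points to the right, and its iterates must meet
  the exceptional set, since otherwise its twin would have the same word.\<close>

lemma label_word_exceptional_germ:
  assumes lab: "\<And>g. g \<in> all_germs \<Longrightarrow> \<forall>\<^sub>F h in germ_nhds g. lab h = lab g"
    and tw: "\<And>g. g \<in> all_germs \<Longrightarrow> g \<notin> B \<Longrightarrow> lab (twin g) = lab g"
    and B: "boundary_germs \<subseteq> B" and n: "0 < n" and w: "w \<in> label_word lab n ` all_germs"
  shows "\<exists>b\<in>all_germs. label_word lab n b = w \<and> (\<exists>j<n. (germ_step ^^ j) b \<in> B)"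
proof -
  define A where "A = {g \<in> all_germs. label_word lab n g = w}"
  define c where "c = Inf (fst ` A)"
  have "A \<noteq> {}" using w by (auto simp: A_def)
  have bdd: "bdd_below (fst ` A)" by (rule bdd_belowI[of _ 0]) (auto simp: A_def germs_def)
  have c_le: "c \<le> fst g" if "g \<in> A" for g
    unfolding c_def by (rule cInf_lower[OF _ bdd]) (use that in simp)
  have c_approx: "\<exists>g\<in>A. fst g < c + e" if "e > 0" for e
    using cInf_lessD[of "fst ` A" "c + e"] that \<open>A \<noteq> {}\<close> by (auto simp: c_def)
  \<comment> \<open>If the left germ at \<open>c\<close> had the word, so would all germs slightly
    to its left, contradicting the choice of \<open>c\<close>.\<close>
  have no_left: "(c, False) \<notin> A"
  proof
    assume a: "(c, False) \<in> A"
    then have "(c, False) \<in> all_germs" and w: "label_word lab n (c, False) = w" by (auto simp: A_def)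
    then have c: "0 < c" "c \<le> 1" by (auto simp: germs_def)
    obtain e where e: "e > 0" "\<And>y s. c - e < y \<Longrightarrow> y < c \<Longrightarrow> (y, s) \<in> all_germs \<Longrightarrow>
        label_word lab n (y, s) = label_word lab n (c, False)"
      using label_word_locally_constant[OF lab \<open>(c, False) \<in> all_germs\<close>, of n]
      unfolding eventually_germ_nhds_left by blast
    obtain y where y: "max 0 (c - e) < y" "y < c" using dense[of "max 0 (c - e)" c] c e(1) by auto
    have "(y, True) \<in> all_germs" using y c by (auto simp: germs_def)
    then have "(y, True) \<in> A" using e(2)[of y True] w y by (auto simp: A_def)
    then show False using c_le[of "(y, True)"] y by simp
  qed
  \<comment> \<open>The infimum is attained at a right germ: if no germ of \<open>A\<close> sits at
    \<open>c\<close>, germs of \<open>A\<close> approach \<open>c\<close> from the right and local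
    constancy carries the word over to \<open>(c, True)\<close>.\<close>
  have right: "(c, True) \<in> A"
  proof (cases "\<exists>g\<in>A. fst g = c")
    case True
    then obtain s where "(c, s) \<in> A" by auto
    then show ?thesis using no_left by (cases s) auto
  next
    case False
    then have gt: "c < fst g" if "g \<in> A" for g using c_le[OF that] that by force
    obtain g0 where "g0 \<in> A" using \<open>A \<noteq> {}\<close> by blast
    then have "c < 1" using gt[of g0] by (auto simp: A_def germs_def)
    moreover have "0 \<le> c" unfolding c_def
      using \<open>A \<noteq> {}\<close> by (intro cInf_greatest) (auto simp: A_def germs_def)
    ultimately have c: "(c, True) \<in> all_germs" by (auto simp: germs_def)
    obtain e where e: "e > 0" "\<And>y s. c < y \<Longrightarrow> y < c + e \<Longrightarrow> (y, s) \<in> all_germs \<Longrightarrow>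
        label_word lab n (y, s) = label_word lab n (c, True)"
      using label_word_locally_constant[OF lab c, of n] unfolding eventually_germ_nhds_right by blast
    obtain g where g: "g \<in> A" "fst g < c + e" using c_approx[OF e(1)] by blast
    then have "label_word lab n (c, True) = w"
      using e(2)[of "fst g" "snd g"] gt[OF g(1)] by (simp add: A_def)
    then show ?thesis using c by (simp add: A_def)
  qed
  then have b: "(c, True) \<in> all_germs" "label_word lab n (c, True) = w" by (auto simp: A_def)
  have "\<exists>j<n. (germ_step ^^ j) (c, True) \<in> B"
  proof (rule ccontr)
    assume no: "\<not> (\<exists>j<n. (germ_step ^^ j) (c, True) \<in> B)"
    have nb: "(germ_step ^^ j) (c, True) \<notin> boundary_germs" if "j < n" for j using no that B by blast
    have "fst (c, True) \<notin> cuts" using nb[of 0] n b(1) by (auto simp: boundary_germs_def)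
    then have t: "twin (c, True) \<in> all_germs" using twin_step(1)[OF b(1)] by blast
    have "lab ((germ_step ^^ j) (twin (c, True))) = lab ((germ_step ^^ j) (c, True))" if "j < n" for j
      using twin_iterate[OF b(1) nb, of n j] tw[OF iterate_in[OF b(1), of j]] no that by simp
    then have "label_word lab n (twin (c, True)) = w" using b(2) label_word_eq_iff by metis
    then have "twin (c, True) \<in> A" using t by (simp add: A_def)
    then show False using no_left by (simp add: twin_def)
  qed
  then show ?thesis using b by blast
qed

text \<open>Every word has a germ that meets \<open>B\<close> within the first \<open>n\<close>
  steps, and a germ that meets \<open>b\<close> at time \<open>j\<close> is one of at most
  \<open>word_count j\<close> preimages. Up to a linear factor, a labelling with finitely many
  exceptional germs thus has no more words than \<open>piece_of\<close>.\<close>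

lemma card_label_words_le:
  assumes lab: "\<And>g. g \<in> all_germs \<Longrightarrow> \<forall>\<^sub>F h in germ_nhds g. lab h = lab g"
    and tw: "\<And>g. g \<in> all_germs \<Longrightarrow> g \<notin> B \<Longrightarrow> lab (twin g) = lab g"
    and B: "boundary_germs \<subseteq> B" "finite B" and n: "0 < n"
  shows "finite (label_word lab n ` all_germs)"
    and "card (label_word lab n ` all_germs) \<le> n * card B * word_count n"
proof -
  let ?E = "\<Union>(j, b)\<in>{..<n} \<times> B. iterate_preimages j b"
  have fin: "finite ?E" using B(2) finite_iterate_preimages by auto
  have sub: "label_word lab n ` all_germs \<subseteq> label_word lab n ` ?E"
  proof
    fix w assume "w \<in> label_word lab n ` all_germs"
    then obtain b j where "b \<in> all_germs" "label_word lab n b = w" "j < n" "(germ_step ^^ j) b \<in> B"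
      using label_word_exceptional_germ[OF lab tw B(1) n] by blast
    then show "w \<in> label_word lab n ` ?E"
      by (intro image_eqI[of _ _ b]) (auto simp: iterate_preimages_def)
  qed
  show "finite (label_word lab n ` all_germs)" using sub fin finite_subset by blast
  have "card (label_word lab n ` all_germs) \<le> card ?E"
    using sub fin by (meson card_image_le card_mono finite_imageI le_trans)
  also have "\<dots> \<le> (\<Sum>(j, b)\<in>{..<n} \<times> B. card (iterate_preimages j b))"
    unfolding split_def using B(2) by (intro card_UN_le) auto
  also have "\<dots> \<le> (\<Sum>(j, b)\<in>{..<n} \<times> B. word_count n)"
    unfolding split_def
    by (intro sum_mono le_trans[OF card_iterate_preimages_le word_count_mono]) auto
  also have "\<dots> = n * card B * word_count n" by (simp add: split_def card_cartesian_product)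
  finally show "card (label_word lab n ` all_germs) \<le> n * card B * word_count n" .
qed

lemma twin_piece_of:
  assumes "g \<in> all_germs" "g \<notin> boundary_germs"
  shows "piece_of (twin g) = piece_of g"
  using twin_step(2)[OF assms(1)] assms by (auto simp: boundary_germs_def)

text \<open>Every word belongs to a germ whose \<open>n\<close>-th image lies in a set of at most
  \<open>n * card boundary_germs\<close> germs, so some germ has many preimages.\<close>

lemma exists_many_preimages:
  assumes n: "0 < n"
  shows "\<exists>g\<in>all_germs. word_count n \<le> n * card boundary_germs * card (iterate_preimages n g)"
proof -
  define M where "M = (MAX g\<in>all_germs. card (iterate_preimages n g))"
  let ?C = "(\<lambda>g. card (iterate_preimages n g)) ` all_germs"
  have fin: "finite ?C"
    by (rule finite_subset[of _ "{..word_count n}"]) (use card_iterate_preimages_le in auto)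
  have "M \<in> ?C" unfolding M_def by (rule Max_in[OF fin]) (use all_germs_nonempty in auto)
  then obtain g where g: "g \<in> all_germs" "M = card (iterate_preimages n g)" by auto
  have M: "card (iterate_preimages n h) \<le> M" if "h \<in> all_germs" for h
    unfolding M_def using fin that by (intro Max_ge) auto
  let ?E = "\<Union>(j, b)\<in>{..<n} \<times> boundary_germs. iterate_preimages n ((germ_step ^^ (n - j)) b)"
  have finE: "finite ?E" using finite_boundary_germs finite_iterate_preimages by auto
  have "words n \<subseteq> label_word piece_of n ` ?E"
  proof
    fix w assume "w \<in> words n"
    then obtain b j where b: "b \<in> all_germs" "label_word piece_of n b = w" "j < n"
        "(germ_step ^^ j) b \<in> boundary_germs"
      unfolding words_def
      using label_word_exceptional_germ[OF piece_of_locally_constant twin_piece_of order_refl n] by blast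
    have "(germ_step ^^ n) b = (germ_step ^^ (n - j)) ((germ_step ^^ j) b)"
      using b(3) funpow_add[of "n - j" j germ_step] by simp
    then show "w \<in> label_word piece_of n ` ?E"
      using b by (intro image_eqI[of _ _ b]) (auto simp: iterate_preimages_def)
  qed
  then have "word_count n \<le> card ?E"
    unfolding word_count_def using finE by (meson card_image_le card_mono finite_imageI le_trans)
  also have "\<dots> \<le> (\<Sum>(j, b)\<in>{..<n} \<times> boundary_germs. card (iterate_preimages n ((germ_step ^^ (n - j)) b)))"
    unfolding split_def using finite_boundary_germs by (intro card_UN_le) auto
  also have "\<dots> \<le> (\<Sum>(j, b)\<in>{..<n} \<times> boundary_germs. M)"
    unfolding split_def by (intro sum_mono M iterate_in) (auto simp: boundary_germs_def)
  also have "\<dots> = n * card boundary_germs * M" by (simp add: split_def card_cartesian_product)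
  finally show ?thesis using g by blast
qed

end

section \<open>The split interval as a quotient of the space of germs\<close>

text \<open>Neighbourhoods of the two germs at \<open>x\<close> join to an ordinary neighbourhood of
  \<open>x\<close>; in this form eventual statements become accessible to compactness of the
  interval.\<close>

lemma eventually_germs_ball:
  assumes "\<And>s. (x, s) \<in> all_germs \<Longrightarrow> eventually Q (germ_nhds (x, s))" and x: "x \<in> {0..1}"
  shows "\<exists>e>0. \<forall>g\<in>all_germs. \<bar>fst g - x\<bar> < e \<longrightarrow> Q g"
proof -
  have "\<exists>e>0. \<forall>y s. x < y \<and> y < x + e \<and> (y, s) \<in> all_germs \<longrightarrow> Q (y, s)"
  proof (cases "x < 1")
    case True
    then have "eventually Q (germ_nhds (x, True))" using assms by (auto simp: germs_def)
    then show ?thesis unfolding eventually_germ_nhds_right by blast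
  qed (auto simp: germs_def intro!: exI[of _ 1])
  then obtain e where e: "e > 0" "\<And>y s. x < y \<Longrightarrow> y < x + e \<Longrightarrow> (y, s) \<in> all_germs \<Longrightarrow> Q (y, s)"
    by blast
  have "\<exists>e>0. \<forall>y s. x - e < y \<and> y < x \<and> (y, s) \<in> all_germs \<longrightarrow> Q (y, s)"
  proof (cases "0 < x")
    case True
    then have "eventually Q (germ_nhds (x, False))" using assms by (auto simp: germs_def)
    then show ?thesis unfolding eventually_germ_nhds_left by blast
  qed (auto simp: germs_def intro!: exI[of _ 1])
  then obtain d where d: "d > 0" "\<And>y s. x - d < y \<Longrightarrow> y < x \<Longrightarrow> (y, s) \<in> all_germs \<Longrightarrow> Q (y, s)"
    by blast
  have "Q (y, s)" if "(y, s) \<in> all_germs" "\<bar>y - x\<bar> < min e d" for y s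
  proof (cases "y = x")
    case True
    then show ?thesis using assms(1)[of s] that eventually_germ_nhds_self by simp
  next
    case False
    then have "x < y \<and> y < x + e \<or> x - d < y \<and> y < x" using that(2) by linarith
    then show ?thesis using e(2) d(2) that(1) by blast
  qed
  then show ?thesis using e(1) d(1) by (intro exI[of _ "min e d"]) auto
qed

context piecewise_monotonic_map
begin

section \<open>Generalized orbits and the set of doubled points\<close>

lemma hat_image_mono: "A \<subseteq> B \<Longrightarrow> hat_image \<tau> A \<subseteq> hat_image \<tau> B"
  and hat_preimage_mono: "A \<subseteq> B \<Longrightarrow> hat_preimage \<tau> A \<subseteq> hat_preimage \<tau> B"
  unfolding hat_image_def hat_preimage_def by blast+

lemma hat_image_UN: "hat_image \<tau> (\<Union>x\<in>S. A x) = (\<Union>x\<in>S. hat_image \<tau> (A x))"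
  and hat_preimage_UN: "hat_preimage \<tau> (\<Union>x\<in>S. A x) = (\<Union>x\<in>S. hat_preimage \<tau> (A x))"
  unfolding hat_image_def hat_preimage_def by blast+

lemma hat_image_subset: "hat_image \<tau> A \<subseteq> {0..1}"
  unfolding hat_image_def using branch_in by blast

lemma hat_preimage_subset: "hat_preimage \<tau> A \<subseteq> {0..1}"
  unfolding hat_preimage_def closed_piece_eq using piece_bounds(1,3) by force

lemma generalized_orbit:
  assumes "x \<in> {0..1}"
  shows "x \<in> generalized_orbit \<tau> x" "generalized_orbit \<tau> x \<subseteq> {0..1}"
    "hat_image \<tau> (generalized_orbit \<tau> x) \<subseteq> generalized_orbit \<tau> x"
    "hat_preimage \<tau> (generalized_orbit \<tau> x) \<subseteq> generalized_orbit \<tau> x"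
proof -
  let ?F = "{A. A \<subseteq> {0..1} \<and> x \<in> A \<and> hat_image \<tau> A \<subseteq> A \<and> hat_preimage \<tau> A \<subseteq> A}"
  have "{0..1} \<in> ?F" using assms hat_image_subset hat_preimage_subset by auto
  then show "generalized_orbit \<tau> x \<subseteq> {0..1}" unfolding generalized_orbit_def by (rule Inter_lower)
  show "x \<in> generalized_orbit \<tau> x" unfolding generalized_orbit_def by simp
  show "hat_image \<tau> (generalized_orbit \<tau> x) \<subseteq> generalized_orbit \<tau> x"
    unfolding generalized_orbit_def
  proof (rule Inter_greatest)
    fix A assume A: "A \<in> ?F"
    then have "hat_image \<tau> (\<Inter>?F) \<subseteq> hat_image \<tau> A" by (intro hat_image_mono Inter_lower)
    moreover have "hat_image \<tau> A \<subseteq> A" using A by simp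
    ultimately show "hat_image \<tau> (\<Inter>?F) \<subseteq> A" by (rule subset_trans)
  qed
  show "hat_preimage \<tau> (generalized_orbit \<tau> x) \<subseteq> generalized_orbit \<tau> x"
    unfolding generalized_orbit_def
  proof (rule Inter_greatest)
    fix A assume A: "A \<in> ?F"
    then have "hat_preimage \<tau> (\<Inter>?F) \<subseteq> hat_preimage \<tau> A" by (intro hat_preimage_mono Inter_lower)
    moreover have "hat_preimage \<tau> A \<subseteq> A" using A by simp
    ultimately show "hat_preimage \<tau> (\<Inter>?F) \<subseteq> A" by (rule subset_trans)
  qed
qed

lemma cuts_subset_I1: "cuts \<subseteq> I1 \<tau>"
  unfolding I1_def using generalized_orbit(1) cuts_facts(4) by blast

lemma I1_subset: "I1 \<tau> \<subseteq> {0..1}"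
  unfolding I1_def using generalized_orbit(2) cuts_facts(4) by blast

text \<open>Forward invariance gives one direction and backward invariance the other. The
  equivalence makes the identification of twins off \<open>I1\<close> compatible with the
  action.\<close>

lemma branch_in_I1_iff:
  assumes i: "i \<in> pieces \<tau>" and x: "x \<in> closed_piece \<tau> i"
  shows "branch \<tau> i x \<in> I1 \<tau> \<longleftrightarrow> x \<in> I1 \<tau>"
proof
  have "hat_preimage \<tau> (I1 \<tau>) \<subseteq> I1 \<tau>"
    unfolding I1_def hat_preimage_UN using generalized_orbit(4) cuts_facts(4) by blast
  then show "branch \<tau> i x \<in> I1 \<tau> \<Longrightarrow> x \<in> I1 \<tau>"
    using i x unfolding hat_preimage_def by blast
  have "hat_image \<tau> (I1 \<tau>) \<subseteq> I1 \<tau>"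
    unfolding I1_def hat_image_UN using generalized_orbit(3) cuts_facts(4) by blast
  then show "x \<in> I1 \<tau> \<Longrightarrow> branch \<tau> i x \<in> I1 \<tau>"
    using i x unfolding hat_image_def by blast
qed

text \<open>The orbit is exhausted by stages, each of which adds the images and preimages of the
  previous one under finitely many injective branches. Countability makes the complement of
  \<open>I1\<close> dense.\<close>

lemma countable_generalized_orbit:
  assumes "x \<in> {0..1}"
  shows "countable (generalized_orbit \<tau> x)"
proof -
  define A where "A n = ((\<lambda>B. B \<union> hat_image \<tau> B \<union> hat_preimage \<tau> B) ^^ n) {x}" for n
  have A_Suc: "A (Suc n) = A n \<union> hat_image \<tau> (A n) \<union> hat_preimage \<tau> (A n)" for n
    by (simp add: A_def)
  have "countable (A n)" for n
  proof (induction n)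
    case (Suc n)
    have "countable {y \<in> closed_piece \<tau> i. branch \<tau> i y \<in> A n}" if "i \<in> pieces \<tau>" for i
    proof (rule countable_image_inj_on)
      show "countable (branch \<tau> i ` {y \<in> closed_piece \<tau> i. branch \<tau> i y \<in> A n})"
        by (rule countable_subset[OF _ Suc.IH]) auto
      show "inj_on (branch \<tau> i) {y \<in> closed_piece \<tau> i. branch \<tau> i y \<in> A n}"
        using branch_inj_on[OF that] by (rule inj_on_subset) auto
    qed
    then have "countable (hat_preimage \<tau> (A n))"
      unfolding hat_preimage_def
      by (intro countable_UN[OF countable_finite[OF finite_pieces]])
    moreover have "countable (hat_image \<tau> (A n))"
      unfolding hat_image_def using Suc.IH
      by (intro countable_UN[OF countable_finite[OF finite_pieces]] countable_image countable_Int1)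
    ultimately show ?case using Suc.IH by (simp add: A_Suc)
  qed (simp add: A_def)
  then have "countable (\<Union>n. A n)" by simp
  moreover have "generalized_orbit \<tau> x \<subseteq> (\<Union>n. A n)"
  proof -
    have "A n \<subseteq> {0..1}" for n
    proof (induction n)
      case 0
      then show ?case using assms by (simp add: A_def)
    next
      case (Suc n)
      show ?case unfolding A_Suc by (intro Un_least Suc.IH hat_image_subset hat_preimage_subset)
    qed
    moreover have "x \<in> A 0" by (simp add: A_def)
    moreover have "hat_image \<tau> (\<Union>n. A n) \<subseteq> (\<Union>n. A n)"
      unfolding hat_image_UN using A_Suc by blast
    moreover have "hat_preimage \<tau> (\<Union>n. A n) \<subseteq> (\<Union>n. A n)"
      unfolding hat_preimage_UN using A_Suc by blast
    ultimately show ?thesis unfolding generalized_orbit_def by (intro Inter_lower) blast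
  qed
  ultimately show ?thesis using countable_subset by blast
qed

lemma countable_I1: "countable (I1 \<tau>)"
  unfolding I1_def
  using countable_generalized_orbit cuts_facts(4)
  by (intro countable_UN[OF countable_finite[OF cuts_facts(1)]]) auto

section \<open>The projection from germs to the split interval\<close>

lemma fst_germ_closed_piece: "g \<in> all_germs \<Longrightarrow> fst g \<in> closed_piece \<tau> (piece_of g)"
  using piece_of(2)[of g] by (auto simp: germs_def closed_piece_eq)

lemma germ_step_in_I1_iff: "g \<in> all_germs \<Longrightarrow> fst (germ_step g) \<in> I1 \<tau> \<longleftrightarrow> fst g \<in> I1 \<tau>"
  unfolding fst_germ_step by (intro branch_in_I1_iff piece_of(1) fst_germ_closed_piece)

text \<open>At a point that is not doubled both sides go to the single code
  \<open>(x, False)\<close>. The points 0 and 1 lie in \<open>I1\<close> but are not doubled, and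
  only one side of each is in \<open>all_germs\<close>.\<close>

definition quot :: "germ \<Rightarrow> split_point" where
  "quot g = (fst g, snd g \<and> fst g \<in> I1 \<tau> - {0, 1})"

lemma fst_quot [simp]: "fst (quot g) = fst g"
  by (simp add: quot_def)

lemma endpoints_in_I1: "0 \<in> I1 \<tau>" "1 \<in> I1 \<tau>"
  using cuts_subset_I1 cuts_facts by auto

lemma X_set_eq: "X_set \<tau> = quot ` all_germs"
proof (intro equalityI subsetI)
  fix p assume p: "p \<in> X_set \<tau>"
  obtain x t where pt: "p = (x, t)" by (cases p)
  show "p \<in> quot ` all_germs"
  proof (cases "x = 0 \<or> t")
    case True
    have "x = 0 \<or> t \<and> x \<in> I1 \<tau> - {0, 1}" "0 \<le> x \<and> x < 1"
      using True p I1_subset unfolding pt X_set_def by (auto simp: less_le)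
    then show ?thesis
      using p unfolding pt X_set_def
      by (intro image_eqI[of _ _ "(x, True)"]) (auto simp: quot_def germs_def)
  next
    case False
    then have "(x, False) \<in> all_germs" using p unfolding pt X_set_def by (auto simp: germs_def)
    then show ?thesis using False unfolding pt by (intro image_eqI[of _ _ "(x, False)"]) (auto simp: quot_def)
  qed
qed (auto simp: X_set_def quot_def germs_def)

lemma quot_in: "g \<in> all_germs \<Longrightarrow> quot g \<in> X_set \<tau>"
  by (simp add: X_set_eq)

lemma quot_eq_iff:
  assumes "g \<in> all_germs" "h \<in> all_germs"
  shows "quot g = quot h \<longleftrightarrow> g = h \<or> (h = twin g \<and> fst g \<notin> I1 \<tau>)"
  using assms endpoints_in_I1 by (cases g; cases h) (auto simp: quot_def germs_def twin_def)

text \<open>Twins that are identified lie off \<open>I1\<close>, hence off the cuts, so their images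
  are twins; the images lie off \<open>I1\<close> again by invariance and are identified as
  well.\<close>

lemma quot_germ_step_cong:
  assumes "g \<in> all_germs" "h \<in> all_germs" "quot g = quot h"
  shows "quot (germ_step g) = quot (germ_step h)"
proof (cases "g = h")
  case False
  then have h: "h = twin g" "fst g \<notin> I1 \<tau>" using quot_eq_iff assms by auto
  then have "fst g \<notin> cuts" using cuts_subset_I1 by blast
  then have "germ_step h = twin (germ_step g)" using twin_step(3)[OF assms(1)] h by simp
  moreover have "fst (germ_step g) \<notin> I1 \<tau>" using germ_step_in_I1_iff assms(1) h by simp
  ultimately show ?thesis using quot_eq_iff[OF germ_step_in[OF assms(1)] germ_step_in[OF assms(2)]] by simp
qed simp

text \<open>The order topology on the split interval is the quotient topology of the one-sided
  neighbourhoods of germs.\<close>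

lemma ray_germ_open:
  assumes x: "x \<in> X_set \<tau>" and g: "g \<in> all_germs"
  shows "split_less x (quot g) \<Longrightarrow> \<forall>\<^sub>F h in germ_nhds g. split_less x (quot h)"
    and "split_less (quot g) x \<Longrightarrow> \<forall>\<^sub>F h in germ_nhds g. split_less (quot h) x"
proof -
  obtain a b where xa: "x = (a, b)" by (cases x)
  obtain c s where gc: "g = (c, s)" by (cases g)
  \<comment> \<open>For \<open>a = c\<close> the neighbourhood, apart from \<open>g\<close>, lies on
    one side of \<open>c\<close>, so any radius serves; otherwise nearby points stay on the same
    side of \<open>a\<close>.\<close>
  define e where "e = (if a = c then 1 else \<bar>c - a\<bar>)"
  have e: "e > 0" by (auto simp: e_def)
  have near: "h = g \<or> (if s then c < fst h \<and> fst h < c + e else c - e < fst h \<and> fst h < c)"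
    if "h \<in> near_germ g e" for h
    using that by (auto simp: near_germ_def gc split: if_splits)
  show "\<forall>\<^sub>F h in germ_nhds g. split_less x (quot h)" if less: "split_less x (quot g)"
    unfolding eventually_germ_nhds
  proof (intro exI conjI ballI)
    fix h assume "h \<in> near_germ g e \<inter> all_germs"
    then show "split_less x (quot h)"
      using near[of h] less by (cases s; cases "a = c") (auto simp: split_less_def xa gc quot_def e_def)
  qed (rule e)
  show "\<forall>\<^sub>F h in germ_nhds g. split_less (quot h) x" if less: "split_less (quot g) x"
    unfolding eventually_germ_nhds
  proof (intro exI conjI ballI)
    fix h assume "h \<in> near_germ g e \<inter> all_germs"
    then show "split_less (quot h) x"
      using near[of h] less x
      by (cases s; cases "a = c") (auto simp: split_less_def xa gc quot_def e_def X_set_def)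
  qed (rule e)
qed

lemma topspace_X_top: "topspace (X_top \<tau>) = X_set \<tau>"
  unfolding X_top_def order_topology_on_def topology_generated_by_topspace by auto

lemma openin_upper_ray: "x \<in> X_set \<tau> \<Longrightarrow> openin (X_top \<tau>) {y \<in> X_set \<tau>. split_less x y}"
  and openin_lower_ray: "x \<in> X_set \<tau> \<Longrightarrow> openin (X_top \<tau>) {y \<in> X_set \<tau>. split_less y x}"
  unfolding X_top_def order_topology_on_def by (intro topology_generated_by_Basis; blast)+

lemma germ_open_of_openin:
  assumes "openin (X_top \<tau>) U" "g \<in> all_germs" "quot g \<in> U"
  shows "\<forall>\<^sub>F h in germ_nhds g. quot h \<in> U"
proof -
  have "generate_topology_on ({X_set \<tau>} \<union> {{y \<in> X_set \<tau>. split_less x y} |x. x \<in> X_set \<tau>} \<union>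
      {{y \<in> X_set \<tau>. split_less y x} |x. x \<in> X_set \<tau>}) U"
    using assms(1) unfolding X_top_def order_topology_on_def openin_topology_generated_by_iff .
  then have "\<forall>g\<in>all_germs. quot g \<in> U \<longrightarrow> (\<forall>\<^sub>F h in germ_nhds g. quot h \<in> U)"
  proof induction
    case (Int a b)
    then show ?case by (auto intro: eventually_conj)
  next
    case (UN K)
    show ?case
    proof (intro ballI impI)
      fix g assume g: "g \<in> all_germs" "quot g \<in> \<Union>K"
      then obtain k where k: "k \<in> K" "quot g \<in> k" by blast
      then have "\<forall>\<^sub>F h in germ_nhds g. quot h \<in> k" using UN g by blast
      then show "\<forall>\<^sub>F h in germ_nhds g. quot h \<in> \<Union>K"
        by eventually_elim (use k in blast)
    qed
  next
    case (Basis s)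
    have dom: "\<forall>\<^sub>F h in germ_nhds g. quot h \<in> X_set \<tau>" for g
      using eventually_germ_nhds_domain by eventually_elim (rule quot_in)
    from Basis consider "s = X_set \<tau>"
      | x where "x \<in> X_set \<tau>" "s = {y \<in> X_set \<tau>. split_less x y}"
      | x where "x \<in> X_set \<tau>" "s = {y \<in> X_set \<tau>. split_less y x}" by blast
    then show ?case
    proof cases
      case 1
      then show ?thesis using dom by simp
    next
      case (2 x)
      then show ?thesis using dom ray_germ_open(1)[OF 2(1)] by (simp add: eventually_conj_iff)
    next
      case (3 x)
      then show ?thesis using dom ray_germ_open(2)[OF 3(1)] by (simp add: eventually_conj_iff)
    qed
  qed simp
  then show ?thesis using assms(2,3) by blast
qed

lemma germs_at_point_in:
  assumes "(d, s) \<in> X_set \<tau>" "d \<noteq> 0" "d \<noteq> 1" "\<And>t. (d, t) \<in> all_germs \<Longrightarrow> quot (d, t) \<in> U"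
  shows "(d, s) \<in> U"
proof -
  have "(d, s) \<in> all_germs" using assms(1-3) I1_subset by (auto simp: X_set_def germs_def)
  then have "quot (d, s) \<in> U" by (rule assms(4))
  moreover have "quot (d, s) = (d, s)" using assms(1) by (auto simp: X_set_def quot_def)
  ultimately show ?thesis by simp
qed

text \<open>Around \<open>p\<close> it suffices to have an open \<open>L\<close> whose points below
  \<open>p\<close> lie in \<open>U\<close> and an open \<open>R\<close> with the same property above
  \<open>p\<close>, since the order is total. If the left germ at \<open>c\<close> projects to
  \<open>p\<close>, \<open>L\<close> is a ray starting slightly to the left of \<open>c\<close>;
  otherwise \<open>L\<close> can be chosen with no points below \<open>p\<close> at all. The same
  dichotomy gives \<open>R\<close>.\<close>

lemma openin_of_germ_open:
  assumes U: "U \<subseteq> X_set \<tau>"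
    and ev: "\<And>g. g \<in> all_germs \<Longrightarrow> quot g \<in> U \<Longrightarrow> \<forall>\<^sub>F h in germ_nhds g. quot h \<in> U"
  shows "openin (X_top \<tau>) U"
proof (subst openin_subopen, rule ballI)
  fix p assume "p \<in> U"
  obtain c t where p: "p = (c, t)" by (cases p)
  have pX: "p \<in> X_set \<tau>" using U \<open>p \<in> U\<close> by blast
  then have "c \<in> {0..1}" and t: "t \<Longrightarrow> c \<in> I1 \<tau> - {0, 1}"
    using I1_subset unfolding p X_set_def by auto
  then have c: "0 \<le> c" "c \<le> 1" by auto
  have cX: "(d, False) \<in> X_set \<tau>" if "0 \<le> d" "d \<le> 1" for d using that by (auto simp: X_set_def)
  have "\<exists>L. openin (X_top \<tau>) L \<and> p \<in> L \<and> (\<forall>y\<in>L. split_less y p \<longrightarrow> y \<in> U)"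
  proof (cases "t \<or> c = 0")
    case True
    show ?thesis
    proof (cases t)
      case True
      show ?thesis
        by (rule exI[of _ "{y \<in> X_set \<tau>. split_less (c, False) y}"])
          (use openin_upper_ray[OF cX[OF c]] pX True in \<open>auto simp: p split_less_def\<close>)
    next
      case False
      then have "c = 0" using \<open>t \<or> c = 0\<close> by blast
      show ?thesis
      proof (intro exI[of _ "X_set \<tau>"] conjI ballI impI)
        show "openin (X_top \<tau>) (X_set \<tau>)" using openin_topspace[of "X_top \<tau>"] by (simp add: topspace_X_top)
        fix y assume "y \<in> X_set \<tau>" "split_less y p"
        then show "y \<in> U" using False \<open>c = 0\<close> I1_subset by (auto simp: p split_less_def X_set_def)
      qed (rule pX)
    qed
  next
    case False
    then have g: "(c, False) \<in> all_germs" and q: "quot (c, False) = p"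
      using c by (auto simp: germs_def quot_def p)
    obtain e where e: "e > 0" "\<And>y s. c - e < y \<Longrightarrow> y < c \<Longrightarrow> (y, s) \<in> all_germs \<Longrightarrow> quot (y, s) \<in> U"
      using ev[OF g] \<open>p \<in> U\<close> unfolding eventually_germ_nhds_left q by blast
    obtain c' where c': "max 0 (c - e) < c'" "c' < c" using dense[of "max 0 (c - e)" c] c e(1) False by auto
    show ?thesis
    proof (intro exI[of _ "{y \<in> X_set \<tau>. split_less (c', False) y}"] conjI ballI impI)
      show "openin (X_top \<tau>) {y \<in> X_set \<tau>. split_less (c', False) y}"
        using c' c by (intro openin_upper_ray cX) auto
      show "p \<in> {y \<in> X_set \<tau>. split_less (c', False) y}" using pX c' by (auto simp: p split_less_def)
      fix y assume y: "y \<in> {y \<in> X_set \<tau>. split_less (c', False) y}" "split_less y p"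
      obtain d s where ds: "y = (d, s)" by (cases y)
      have "c' \<le> d" "d < c" using y False by (auto simp: ds split_less_def p)
      then have "quot (d, t) \<in> U" if "(d, t) \<in> all_germs" for t
        using e(2)[of d t] that c' by linarith
      moreover have "(d, s) \<in> X_set \<tau>" "d \<noteq> 0" "d \<noteq> 1" using y(1) \<open>c' \<le> d\<close> \<open>d < c\<close> c' c by (auto simp: ds)
      ultimately show "y \<in> U" unfolding ds by (metis germs_at_point_in)
    qed
  qed
  then obtain L where L: "openin (X_top \<tau>) L" "p \<in> L" "\<And>y. y \<in> L \<Longrightarrow> split_less y p \<Longrightarrow> y \<in> U"
    by blast
  have "\<exists>R. openin (X_top \<tau>) R \<and> p \<in> R \<and> (\<forall>y\<in>R. split_less p y \<longrightarrow> y \<in> U)"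
  proof (cases "(\<not> t \<and> c \<in> I1 \<tau> - {0, 1}) \<or> c = 1")
    case True
    show ?thesis
    proof (cases "c = 1")
      case True
      then have "\<not> t" using t by blast
      show ?thesis
      proof (intro exI[of _ "X_set \<tau>"] conjI ballI impI)
        show "openin (X_top \<tau>) (X_set \<tau>)" using openin_topspace[of "X_top \<tau>"] by (simp add: topspace_X_top)
        fix y assume "y \<in> X_set \<tau>" "split_less p y"
        then show "y \<in> U" using True \<open>\<not> t\<close> I1_subset by (auto simp: p split_less_def X_set_def)
      qed (rule pX)
    next
      case False
      then have tc: "\<not> t" "c \<in> I1 \<tau> - {0, 1}" using True by auto
      then have "(c, True) \<in> X_set \<tau>" by (auto simp: X_set_def)
      from openin_lower_ray[OF this] show ?thesis
        by (intro exI[of _ "{y \<in> X_set \<tau>. split_less y (c, True)}"])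
          (use pX tc in \<open>auto simp: p split_less_def\<close>)
    qed
  next
    case False
    then have g: "(c, True) \<in> all_germs" and q: "quot (c, True) = p"
      using c t by (auto simp: germs_def quot_def p)
    obtain e where e: "e > 0" "\<And>y s. c < y \<Longrightarrow> y < c + e \<Longrightarrow> (y, s) \<in> all_germs \<Longrightarrow> quot (y, s) \<in> U"
      using ev[OF g] \<open>p \<in> U\<close> unfolding eventually_germ_nhds_right q by blast
    obtain c' where c': "c < c'" "c' < min 1 (c + e)" using dense[of c "min 1 (c + e)"] c e(1) False by auto
    show ?thesis
    proof (intro exI[of _ "{y \<in> X_set \<tau>. split_less y (c', False)}"] conjI ballI impI)
      show "openin (X_top \<tau>) {y \<in> X_set \<tau>. split_less y (c', False)}"
        using c' c by (intro openin_lower_ray cX) auto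
      show "p \<in> {y \<in> X_set \<tau>. split_less y (c', False)}" using pX c' by (auto simp: p split_less_def)
      fix y assume y: "y \<in> {y \<in> X_set \<tau>. split_less y (c', False)}" "split_less p y"
      obtain d s where ds: "y = (d, s)" by (cases y)
      have "d < c'" using y(1) by (auto simp: ds split_less_def)
      moreover have "c < d"
        using y False by (auto simp: ds split_less_def p X_set_def)
      ultimately have "quot (d, t) \<in> U" if "(d, t) \<in> all_germs" for t
        using e(2)[of d t] that c' by linarith
      moreover have "(d, s) \<in> X_set \<tau>" "d \<noteq> 0" "d \<noteq> 1" using y(1) \<open>c < d\<close> \<open>d < c'\<close> c' c by (auto simp: ds)
      ultimately show "y \<in> U" unfolding ds by (metis germs_at_point_in)
    qed
  qed
  then obtain R where R: "openin (X_top \<tau>) R" "p \<in> R" "\<And>y. y \<in> R \<Longrightarrow> split_less p y \<Longrightarrow> y \<in> U"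
    by blast
  have tot: "y = p \<or> split_less y p \<or> split_less p y" for y
    by (cases y) (auto simp: split_less_def p)
  show "\<exists>T. openin (X_top \<tau>) T \<and> p \<in> T \<and> T \<subseteq> U"
  proof (intro exI[of _ "L \<inter> R"] conjI subsetI)
    fix y assume "y \<in> L \<inter> R"
    then show "y \<in> U" using L(3)[of y] R(3)[of y] tot[of y] \<open>p \<in> U\<close> by blast
  qed (use L R in auto)
qed

text \<open>Continuity into a discrete space is local constancy, which can be read off on germs;
  membership in \<open>CXZ\<close> is proved in this form below.\<close>

lemma CXZ_iff:
  "f \<in> CXZ \<tau> \<longleftrightarrow> f \<in> extensional (X_set \<tau>) \<and>
     (\<forall>g\<in>all_germs. \<forall>\<^sub>F h in germ_nhds g. f (quot h) = f (quot g))"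
proof -
  have "continuous_map (X_top \<tau>) (discrete_topology UNIV) f \<longleftrightarrow>
    (\<forall>U. openin (X_top \<tau>) {x \<in> X_set \<tau>. f x \<in> U})"
    unfolding continuous_map_def topspace_X_top by simp
  also have "\<dots> \<longleftrightarrow> (\<forall>g\<in>all_germs. \<forall>\<^sub>F h in germ_nhds g. f (quot h) = f (quot g))" (is "?A \<longleftrightarrow> ?B")
  proof
    assume a: ?A
    show ?B
    proof
      fix g assume g: "g \<in> all_germs"
      have "\<forall>\<^sub>F h in germ_nhds g. quot h \<in> {x \<in> X_set \<tau>. f x \<in> {f (quot g)}}"
        using germ_open_of_openin[OF spec[OF a, of "{f (quot g)}"] g] quot_in[OF g] by simp
      then show "\<forall>\<^sub>F h in germ_nhds g. f (quot h) = f (quot g)" by eventually_elim simp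
    qed
  next
    assume b: ?B
    show ?A
    proof (intro allI openin_of_germ_open)
      fix U g assume g: "g \<in> all_germs" "quot g \<in> {x \<in> X_set \<tau>. f x \<in> U}"
      from bspec[OF b g(1)] eventually_germ_nhds_domain
      show "\<forall>\<^sub>F h in germ_nhds g. quot h \<in> {x \<in> X_set \<tau>. f x \<in> U}"
        by eventually_elim (use g quot_in in auto)
    qed auto
  qed
  finally show ?thesis unfolding CXZ_def by blast
qed

end

section \<open>The local homeomorphism and the transfer operator\<close>

context piecewise_monotonic_map
begin

definition quot_step :: "split_point \<Rightarrow> split_point" where
  "quot_step = (\<lambda>p\<in>X_set \<tau>. quot (germ_step (SOME g. g \<in> all_germs \<and> quot g = p)))"

lemma quot_step_quot:
  assumes g: "g \<in> all_germs"
  shows "quot_step (quot g) = quot (germ_step g)"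
proof -
  define k where "k = (SOME h. h \<in> all_germs \<and> quot h = quot g)"
  have k: "k \<in> all_germs \<and> quot k = quot g"
    unfolding k_def by (rule someI_ex) (use g in blast)
  have "quot_step (quot g) = quot (germ_step k)"
    unfolding quot_step_def k_def using quot_in[OF g] by simp
  also have "\<dots> = quot (germ_step g)" using quot_germ_step_cong[of k g] g k by blast
  finally show ?thesis .
qed

lemma fst_germ_step_off_I1:
  assumes g: "g \<in> all_germs" and "fst g \<notin> I1 \<tau>"
  shows "fst (germ_step g) = \<tau> (fst g)"
proof -
  have "fst g \<notin> cuts" using assms cuts_subset_I1 by blast
  then have "fst g \<noteq> lo (piece_of g)" "fst g \<noteq> hi (piece_of g)"
    using piece_bounds(4,5)[OF piece_of(1)[OF g]] by auto
  then have "fst g \<in> open_piece \<tau> (piece_of g)"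
    using fst_germ_closed_piece[OF g] unfolding closed_piece_eq open_piece_eq by auto
  then show ?thesis unfolding fst_germ_step using branch_open_piece piece_of(1)[OF g] by blast
qed

lemma continuous_map_X_topI:
  assumes "\<And>p. p \<in> X_set \<tau> \<Longrightarrow> \<sigma> p \<in> X_set \<tau>"
    and "\<And>U. openin (X_top \<tau>) U \<Longrightarrow> openin (X_top \<tau>) {p \<in> X_set \<tau>. \<sigma> p \<in> U}"
  shows "continuous_map (X_top \<tau>) (X_top \<tau>) \<sigma>"
  unfolding continuous_map_def topspace_X_top using assms by auto

lemma continuous_quot_step: "continuous_map (X_top \<tau>) (X_top \<tau>) quot_step"
proof (rule continuous_map_X_topI)
  show in_X: "quot_step p \<in> X_set \<tau>" if "p \<in> X_set \<tau>" for p
    using that unfolding X_set_eq by (auto simp: quot_step_quot germ_step_in)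
  fix U assume U: "openin (X_top \<tau>) U"
  show "openin (X_top \<tau>) {p \<in> X_set \<tau>. quot_step p \<in> U}"
  proof (rule openin_of_germ_open)
    fix g assume g: "g \<in> all_germs" "quot g \<in> {p \<in> X_set \<tau>. quot_step p \<in> U}"
    then have "\<forall>\<^sub>F h in germ_nhds (germ_step g). quot h \<in> U"
      by (intro germ_open_of_openin[OF U] germ_step_in) (auto simp: quot_step_quot)
    then have "\<forall>\<^sub>F h in germ_nhds g. quot (germ_step h) \<in> U"
      using filterlim_germ_step[OF g(1)] unfolding filterlim_iff by blast
    then show "\<forall>\<^sub>F h in germ_nhds g. quot h \<in> {p \<in> X_set \<tau>. quot_step p \<in> U}"
      using eventually_germ_nhds_domain by eventually_elim (simp add: quot_in quot_step_quot)
  qed auto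
qed

text \<open>Every germ neighbourhood contains an open interval, which is uncountable, whereas
  \<open>I1\<close> is countable. A germ can thus be replaced by a point whose orbit never meets a
  cut.\<close>

lemma generic_germ_exists:
  assumes g: "g \<in> all_germs" and ev: "eventually Q (germ_nhds g)"
  shows "\<exists>y. y \<notin> I1 \<tau> \<and> 0 < y \<and> y < 1 \<and> Q (y, True)"
proof -
  obtain x s where gx: "g = (x, s)" by (cases g)
  have "\<exists>a b. a < b \<and> {a<..<b} \<subseteq> {0<..<1} \<and>
      (\<forall>y. y \<in> {a<..<b} \<longrightarrow> (y, True) \<in> all_germs \<longrightarrow> Q (y, True))"
  proof (cases s)
    case True
    then obtain e where "e > 0" "\<And>y t. x < y \<Longrightarrow> y < x + e \<Longrightarrow> (y, t) \<in> all_germs \<Longrightarrow> Q (y, t)"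
      using ev[unfolded gx] eventually_germ_nhds_right[of _ x] by auto
    then show ?thesis using g True unfolding gx
      by (intro exI[of _ x] exI[of _ "min 1 (x + e)"]) (auto simp: germs_def)
  next
    case False
    then obtain e where "e > 0" "\<And>y t. x - e < y \<Longrightarrow> y < x \<Longrightarrow> (y, t) \<in> all_germs \<Longrightarrow> Q (y, t)"
      using ev[unfolded gx] eventually_germ_nhds_left[of _ x] by auto
    then show ?thesis using g False unfolding gx
      by (intro exI[of _ "max 0 (x - e)"] exI[of _ x]) (auto simp: germs_def)
  qed
  then obtain a b where ab: "a < b" "{a<..<b} \<subseteq> {0<..<1}"
      "\<And>y. y \<in> {a<..<b} \<Longrightarrow> (y, True) \<in> all_germs \<Longrightarrow> Q (y, True)" by blast
  have "\<not> {a<..<b} \<subseteq> I1 \<tau>"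
    using uncountable_open_interval[of a b] countable_subset[OF _ countable_I1] ab(1) by blast
  then obtain y where y: "y \<in> {a<..<b}" "y \<notin> I1 \<tau>" by blast
  then have "0 < y" "y < 1" using ab(2) by auto
  moreover from this have "(y, True) \<in> all_germs" by (auto simp: germs_def)
  ultimately show ?thesis using ab(3)[OF y(1)] y(2) by blast
qed

lemma X0_dense:
  assumes U: "openin (X_top \<tau>) U" and "U \<noteq> {}"
  shows "\<exists>p\<in>U. p \<in> X0_set \<tau>"
proof -
  obtain p where p: "p \<in> U" using assms by blast
  then have "p \<in> X_set \<tau>" using openin_subset[OF U] topspace_X_top by auto
  then obtain g where g: "g \<in> all_germs" "quot g = p" by (auto simp: X_set_eq)
  obtain y where y: "y \<notin> I1 \<tau>" "0 < y" "y < 1" "quot (y, True) \<in> U"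
    using generic_germ_exists[OF g(1) germ_open_of_openin[OF U g(1)]] g(2) p by blast
  then have "quot (y, True) \<in> X_set \<tau>" by (intro quot_in) (auto simp: germs_def)
  then show ?thesis using y by (intro bexI[of _ "quot (y, True)"]) (auto simp: X0_set_def I0_def)
qed

text \<open>If a point lies strictly between, its two rays separate; otherwise the rays below
  \<open>v\<close> and above \<open>u\<close> are already disjoint.\<close>

lemma X_top_separated:
  assumes "u \<in> X_set \<tau>" "v \<in> X_set \<tau>" "split_less u v"
  shows "\<exists>U V. openin (X_top \<tau>) U \<and> openin (X_top \<tau>) V \<and> u \<in> U \<and> v \<in> V \<and> U \<inter> V = {}"
proof (cases "\<exists>z\<in>X_set \<tau>. split_less u z \<and> split_less z v")
  case True
  then obtain z where z: "z \<in> X_set \<tau>" "split_less u z" "split_less z v" by blast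
  show ?thesis
    by (intro exI[of _ "{y \<in> X_set \<tau>. split_less y z}"] exI[of _ "{y \<in> X_set \<tau>. split_less z y}"])
      (use z assms openin_upper_ray[OF z(1)] openin_lower_ray[OF z(1)] in
        \<open>auto simp del: split_paired_All simp: split_less_def\<close>)
next
  case False
  then have "{y \<in> X_set \<tau>. split_less y v} \<inter> {y \<in> X_set \<tau>. split_less u y} = {}" by blast
  then show ?thesis using assms openin_upper_ray[OF assms(1)] openin_lower_ray[OF assms(2)]
    by (intro exI[of _ "{y \<in> X_set \<tau>. split_less y v}"] exI[of _ "{y \<in> X_set \<tau>. split_less u y}"]) auto
qed

text \<open>On \<open>X0_set\<close> the first coordinate determines the value, since \<tau> maps
  the complement of \<open>I1\<close> in the unit interval to itself and points there are not
  doubled. Density of this set and separation of points do the rest.\<close>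

lemma extension_from_X0_unique:
  assumes s: "\<sigma> \<in> extensional (X_set \<tau>)" "continuous_map (X_top \<tau>) (X_top \<tau>) \<sigma>"
      "\<And>p. p \<in> X0_set \<tau> \<Longrightarrow> fst (\<sigma> p) = \<tau> (fst p)"
    and s': "\<sigma>' \<in> extensional (X_set \<tau>)" "continuous_map (X_top \<tau>) (X_top \<tau>) \<sigma>'"
      "\<And>p. p \<in> X0_set \<tau> \<Longrightarrow> fst (\<sigma>' p) = \<tau> (fst p)"
  shows "\<sigma> = \<sigma>'"
proof (rule extensionalityI[OF s(1) s'(1)], rule ccontr)
  fix p assume p: "p \<in> X_set \<tau>" and ne: "\<sigma> p \<noteq> \<sigma>' p"
  have in_X: "\<sigma> q \<in> X_set \<tau>" "\<sigma>' q \<in> X_set \<tau>" if "q \<in> X_set \<tau>" for q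
    using s(2) s'(2) that unfolding continuous_map_def topspace_X_top by auto
  have eq: "\<sigma> q = \<sigma>' q" if q: "q \<in> X0_set \<tau>" for q
  proof -
    have qX: "q \<in> X_set \<tau>" and "fst q \<in> I0 \<tau>" using q by (auto simp: X0_set_def)
    then obtain g where g: "g \<in> all_germs" "quot g = q" "fst g \<notin> I1 \<tau>"
      by (auto simp: X_set_eq I0_def)
    have "\<tau> (fst q) \<notin> I1 \<tau>"
      using germ_step_in_I1_iff[OF g(1)] fst_germ_step_off_I1[OF g(1,3)] g by auto
    then show ?thesis
      using s(3)[OF q] s'(3)[OF q] in_X[OF qX] by (auto simp: X_set_def prod_eq_iff)
  qed
  have "split_less (\<sigma> p) (\<sigma>' p) \<or> split_less (\<sigma>' p) (\<sigma> p)"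
    using ne by (auto simp: split_less_def prod_eq_iff)
  then obtain U V where UV: "openin (X_top \<tau>) U" "openin (X_top \<tau>) V" "\<sigma> p \<in> U" "\<sigma>' p \<in> V" "U \<inter> V = {}"
    using X_top_separated[OF in_X(1)[OF p] in_X(2)[OF p]] X_top_separated[OF in_X(2)[OF p] in_X(1)[OF p]]
    by (metis Int_commute)
  let ?W = "{q \<in> X_set \<tau>. \<sigma> q \<in> U} \<inter> {q \<in> X_set \<tau>. \<sigma>' q \<in> V}"
  have "openin (X_top \<tau>) ?W"
    using s(2) s'(2) UV(1,2) unfolding continuous_map_def topspace_X_top by (intro openin_Int) auto
  moreover have "p \<in> ?W" using p UV by blast
  ultimately obtain q where "q \<in> ?W" "q \<in> X0_set \<tau>" using X0_dense by blast
  then show False using eq UV(5) by auto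
qed

lemma local_homeo_eq: "local_homeo \<tau> = quot_step"
  unfolding local_homeo_def
proof (rule the_equality)
  have "fst (quot_step p) = \<tau> (fst p)" if "p \<in> X0_set \<tau>" for p
    using that fst_germ_step_off_I1 by (auto simp: X0_set_def I0_def X_set_eq quot_step_quot)
  then show q: "quot_step \<in> extensional (X_set \<tau>) \<and> continuous_map (X_top \<tau>) (X_top \<tau>) quot_step \<and>
      (\<forall>p\<in>X0_set \<tau>. fst (quot_step p) = \<tau> (fst p))"
    using continuous_quot_step by (auto simp: quot_step_def)
  fix \<sigma> assume "\<sigma> \<in> extensional (X_set \<tau>) \<and> continuous_map (X_top \<tau>) (X_top \<tau>) \<sigma> \<and>
      (\<forall>p\<in>X0_set \<tau>. fst (\<sigma> p) = \<tau> (fst p))"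
  then show "\<sigma> = quot_step" using q by (intro extension_from_X0_unique) auto
qed

text \<open>Two identified preimages would be twins with distinct images, so none are merged. If a
  representative maps to the twin of \<open>g\<close>, its own twin represents the same class and
  maps to \<open>g\<close>, so none are missed.\<close>

lemma bij_betw_quot_preimages:
  assumes g: "g \<in> all_germs"
  shows "bij_betw quot (step_preimages g) {y \<in> X_set \<tau>. local_homeo \<tau> y = quot g}"
  unfolding bij_betw_def
proof
  have twin_ne: "twin h \<noteq> h" for h by (auto simp: twin_def prod_eq_iff)
  have twin_case: "germ_step (twin h) = twin (germ_step h)" "twin h \<in> all_germs"
    if "h \<in> all_germs" "fst h \<notin> I1 \<tau>" for h
    using twin_step[of h] that cuts_subset_I1 by blast+
  show "inj_on quot (step_preimages g)"
  proof (rule inj_onI, rule ccontr)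
    fix h k assume h: "h \<in> step_preimages g" "k \<in> step_preimages g" "quot h = quot k" "h \<noteq> k"
    then have "h \<in> all_germs" "k \<in> all_germs" "germ_step h = g" "germ_step k = g"
      by (auto simp: step_preimages_def)
    moreover from this have "k = twin h" "fst h \<notin> I1 \<tau>" using quot_eq_iff h by blast+
    ultimately show False using twin_case(1) twin_ne by metis
  qed
  show "quot ` step_preimages g = {y \<in> X_set \<tau>. local_homeo \<tau> y = quot g}"
  proof (intro equalityI subsetI)
    fix y assume "y \<in> {y \<in> X_set \<tau>. local_homeo \<tau> y = quot g}"
    then obtain h where h: "h \<in> all_germs" "y = quot h" "quot (germ_step h) = quot g"
      by (auto simp: X_set_eq local_homeo_eq quot_step_quot)
    show "y \<in> quot ` step_preimages g"
    proof (cases "germ_step h = g")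
      case True
      then show ?thesis using h by (auto simp: step_preimages_def)
    next
      case False
      then have t: "g = twin (germ_step h)" "fst (germ_step h) \<notin> I1 \<tau>"
        using quot_eq_iff[OF germ_step_in[OF h(1)] g] h(3) by auto
      then have "fst h \<notin> I1 \<tau>" using germ_step_in_I1_iff h(1) by blast
      then have "twin h \<in> step_preimages g" "quot (twin h) = y"
        using twin_case[OF h(1)] t quot_eq_iff[OF h(1), of "twin h"] h(2) by (auto simp: step_preimages_def)
      then show ?thesis by blast
    qed
  qed (auto simp: step_preimages_def local_homeo_eq quot_step_quot quot_in)
qed

section \<open>The transfer operator as a sum over preimages of germs\<close>

lemma transfer_op_quot:
  assumes g: "g \<in> all_germs"
  shows "transfer_op \<tau> f (quot g) = (\<Sum>h\<in>step_preimages g. f (quot h))"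
  using sum.reindex_bij_betw[OF bij_betw_quot_preimages[OF g], of f] quot_in[OF g]
  by (simp add: transfer_op_def)

text \<open>Near \<open>g\<close> the set of contributing pieces does not change, because the germs
  of an image interval form an open and closed set, and each summand is constant, because inverse
  branches are continuous.\<close>

lemma transfer_op_CXZ:
  assumes f: "f \<in> CXZ \<tau>"
  shows "transfer_op \<tau> f \<in> CXZ \<tau>"
  unfolding CXZ_iff
proof (intro conjI ballI)
  show "transfer_op \<tau> f \<in> extensional (X_set \<tau>)" by (simp add: transfer_op_def)
  fix g assume g: "g \<in> all_germs"
  let ?in = "\<lambda>i h. h \<in> germs (im_lo i) (im_hi i)"
  have loc: "\<forall>\<^sub>F h in germ_nhds k. f (quot h) = f (quot k)" if "k \<in> all_germs" for k
    using f that unfolding CXZ_iff by blast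
  have "\<forall>\<^sub>F h in germ_nhds g. (?in i h \<longleftrightarrow> ?in i g) \<and>
      (?in i g \<longrightarrow> f (quot (inverse_step i h)) = f (quot (inverse_step i g)))" if i: "i \<in> pieces \<tau>" for i
  proof (cases "?in i g")
    case True
    have "\<forall>\<^sub>F h in germ_nhds g. f (quot (inverse_step i h)) = f (quot (inverse_step i g))"
      using filterlim_inverse_step[OF i True] loc[OF inverse_step(1)[OF i True]]
      unfolding filterlim_iff by blast
    then show ?thesis
      using eventually_germs_iff[of "im_lo i" "im_hi i" g] by eventually_elim simp
  next
    case False
    then show ?thesis using eventually_germs_iff[of "im_lo i" "im_hi i" g] by simp
  qed
  then have "\<forall>\<^sub>F h in germ_nhds g. \<forall>i\<in>pieces \<tau>. (?in i h \<longleftrightarrow> ?in i g) \<and>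
      (?in i g \<longrightarrow> f (quot (inverse_step i h)) = f (quot (inverse_step i g)))"
    by (intro eventually_ball_finite[OF finite_pieces]) blast
  then show "\<forall>\<^sub>F h in germ_nhds g. transfer_op \<tau> f (quot h) = transfer_op \<tau> f (quot g)"
    using eventually_germ_nhds_domain
  proof eventually_elim
    case (elim h)
    then show ?case
      unfolding transfer_op_quot[OF g] transfer_op_quot[OF elim(2)] sum_step_preimages
      by (intro sum.cong) auto
  qed
qed

lemma transfer_op_iterate_CXZ: "f \<in> CXZ \<tau> \<Longrightarrow> (transfer_op \<tau> ^^ n) f \<in> CXZ \<tau>"
  by (induction n) (auto intro: transfer_op_CXZ)

lemma transfer_op_iterate_quot:
  "g \<in> all_germs \<Longrightarrow> (transfer_op \<tau> ^^ n) f (quot g) = (\<Sum>h\<in>iterate_preimages n g. f (quot h))"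
proof (induction n arbitrary: g)
  case 0
  then have "iterate_preimages 0 g = {g}" by (auto simp: iterate_preimages_def)
  then show ?case by simp
next
  case (Suc n)
  have "iterate_preimages (Suc n) g = (\<Union>h\<in>step_preimages g. iterate_preimages n h)"
    using iterate_in by (auto simp: iterate_preimages_def step_preimages_def)
  moreover have "iterate_preimages n h \<inter> iterate_preimages n k = {}" if "h \<noteq> k" for h k
    using that by (auto simp: iterate_preimages_def)
  ultimately have "(\<Sum>h\<in>iterate_preimages (Suc n) g. f (quot h)) =
      (\<Sum>h\<in>step_preimages g. \<Sum>k\<in>iterate_preimages n h. f (quot k))"
    using finite_iterate_preimages finite_step_preimages by (simp add: sum.UNION_disjoint)
  moreover have "step_preimages g \<subseteq> all_germs" by (auto simp: step_preimages_def)
  ultimately show ?case using Suc by (auto simp: transfer_op_quot intro!: sum.cong)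
qed

text \<open>Near a point \<open>f\<close> takes only the values at its two germs. Compactness of the
  interval leaves finitely many points, and the sum of the local bounds serves as a global
  one.\<close>

lemma CXZ_bounded:
  assumes f: "f \<in> CXZ \<tau>"
  shows "\<exists>b>0. \<forall>p\<in>X_set \<tau>. \<bar>f p\<bar> \<le> b"
proof -
  have "\<exists>e>0. \<exists>b. \<forall>g\<in>all_germs. \<bar>fst g - x\<bar> < e \<longrightarrow> \<bar>f (quot g)\<bar> \<le> b" if x: "x \<in> {0..1}" for x
  proof -
    let ?b = "max \<bar>f (quot (x, True))\<bar> \<bar>f (quot (x, False))\<bar>"
    have "\<forall>\<^sub>F h in germ_nhds (x, s). \<bar>f (quot h)\<bar> \<le> ?b" if "(x, s) \<in> all_germs" for s
    proof -
      have "\<forall>\<^sub>F h in germ_nhds (x, s). f (quot h) = f (quot (x, s))"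
        using f that unfolding CXZ_iff by blast
      then show ?thesis by eventually_elim (cases s; simp)
    qed
    then show ?thesis using eventually_germs_ball[of x "\<lambda>h. \<bar>f (quot h)\<bar> \<le> ?b"] x by blast
  qed
  then obtain e b where eb: "\<And>x. x \<in> {0..1} \<Longrightarrow> e x > 0"
      "\<And>x g. x \<in> {0..1} \<Longrightarrow> g \<in> all_germs \<Longrightarrow> \<bar>fst g - x\<bar> < e x \<Longrightarrow> \<bar>f (quot g)\<bar> \<le> b x"
    by metis
  have "{0..1} \<subseteq> (\<Union>x\<in>{0..1}. ball x (e x))" using eb(1) by force
  then obtain C where C: "C \<subseteq> {0..1}" "finite C" "{0..1} \<subseteq> (\<Union>x\<in>C. ball x (e x))"
    using compactE_image[of "{0..1::real}" "{0..1}" "\<lambda>x. ball x (e x)"] by auto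
  define M where "M = (\<Sum>x\<in>C. \<bar>b x\<bar>) + 1"
  have "\<bar>f (quot g)\<bar> \<le> M" if g: "g \<in> all_germs" for g
  proof -
    have "fst g \<in> {0..1}" using g by (auto simp: germs_def)
    then obtain x where x: "x \<in> C" "\<bar>fst g - x\<bar> < e x"
      using C(3) by (force simp: dist_real_def abs_minus_commute)
    then have "\<bar>f (quot g)\<bar> \<le> \<bar>b x\<bar>" using eb(2)[of x g] C(1) g by force
    also have "\<bar>b x\<bar> \<le> (\<Sum>x\<in>C. \<bar>b x\<bar>)" using x(1) C(2) by (intro member_le_sum) auto
    finally show ?thesis by (simp add: M_def)
  qed
  moreover have "M > 0" unfolding M_def using sum_nonneg[of C "\<lambda>x. \<bar>b x\<bar>"] by simp
  ultimately show ?thesis unfolding X_set_eq by blast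
qed

end

section \<open>Dimension triples\<close>

definition pointwise_add :: "(real \<Rightarrow> real) \<Rightarrow> (split_point \<Rightarrow> int) \<Rightarrow> (split_point \<Rightarrow> int) \<Rightarrow> split_point \<Rightarrow> int" where
  "pointwise_add \<tau> f g = (\<lambda>x\<in>X_set \<tau>. f x + g x)"

definition pointwise_scale :: "(real \<Rightarrow> real) \<Rightarrow> int \<Rightarrow> (split_point \<Rightarrow> int) \<Rightarrow> split_point \<Rightarrow> int" where
  "pointwise_scale \<tau> k f = (\<lambda>x\<in>X_set \<tau>. k * f x)"

definition unit_function :: "(real \<Rightarrow> real) \<Rightarrow> split_point \<Rightarrow> int" where
  "unit_function \<tau> = (\<lambda>x\<in>X_set \<tau>. 1)"

definition eventually_equal :: "(real \<Rightarrow> real) \<Rightarrow> (split_point \<Rightarrow> int) \<Rightarrow> (split_point \<Rightarrow> int) \<Rightarrow> bool" where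
  "eventually_equal \<tau> f g \<longleftrightarrow> (\<exists>n. (transfer_op \<tau> ^^ n) f = (transfer_op \<tau> ^^ n) g)"

definition eventually_nonneg :: "(real \<Rightarrow> real) \<Rightarrow> (split_point \<Rightarrow> int) \<Rightarrow> bool" where
  "eventually_nonneg \<tau> f \<longleftrightarrow> (\<exists>n. \<forall>x\<in>X_set \<tau>. 0 \<le> (transfer_op \<tau> ^^ n) f x)"

text \<open>Required for all large exponents, so that several such relations hold from a common
  stage on.\<close>

definition eventually_le :: "(real \<Rightarrow> real) \<Rightarrow> (split_point \<Rightarrow> int) \<Rightarrow> (split_point \<Rightarrow> int) \<Rightarrow> bool" where
  "eventually_le \<tau> f g \<longleftrightarrow>
     (\<exists>n. \<forall>m\<ge>n. \<forall>x\<in>X_set \<tau>. (transfer_op \<tau> ^^ m) f x \<le> (transfer_op \<tau> ^^ m) g x)"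

context piecewise_monotonic_map
begin

lemma pointwise_add_CXZ:
  assumes "f \<in> CXZ \<tau>" "g \<in> CXZ \<tau>"
  shows "pointwise_add \<tau> f g \<in> CXZ \<tau>"
  unfolding CXZ_iff
proof (intro conjI ballI)
  fix k assume k: "k \<in> all_germs"
  have "\<forall>\<^sub>F h in germ_nhds k. f (quot h) = f (quot k)" "\<forall>\<^sub>F h in germ_nhds k. g (quot h) = g (quot k)"
    using assms k unfolding CXZ_iff by blast+
  then show "\<forall>\<^sub>F h in germ_nhds k. pointwise_add \<tau> f g (quot h) = pointwise_add \<tau> f g (quot k)"
    using eventually_germ_nhds_domain
    by eventually_elim (use k in \<open>simp add: pointwise_add_def quot_in\<close>)
qed (simp add: pointwise_add_def)

lemma pointwise_scale_CXZ:
  assumes "f \<in> CXZ \<tau>"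
  shows "pointwise_scale \<tau> k f \<in> CXZ \<tau>"
  unfolding CXZ_iff
proof (intro conjI ballI)
  fix g assume g: "g \<in> all_germs"
  have "\<forall>\<^sub>F h in germ_nhds g. f (quot h) = f (quot g)"
    using assms g unfolding CXZ_iff by blast
  then show "\<forall>\<^sub>F h in germ_nhds g. pointwise_scale \<tau> k f (quot h) = pointwise_scale \<tau> k f (quot g)"
    using eventually_germ_nhds_domain
    by eventually_elim (use g in \<open>simp add: pointwise_scale_def quot_in\<close>)
qed (simp add: pointwise_scale_def)

lemma unit_function_CXZ: "unit_function \<tau> \<in> CXZ \<tau>"
  unfolding CXZ_iff
proof (intro conjI ballI)
  fix g assume g: "g \<in> all_germs"
  show "\<forall>\<^sub>F h in germ_nhds g. unit_function \<tau> (quot h) = unit_function \<tau> (quot g)"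
    using eventually_germ_nhds_domain
    by eventually_elim (use g in \<open>simp add: unit_function_def quot_in\<close>)
qed (simp add: unit_function_def)

lemma transfer_iterate_add:
  assumes "x \<in> X_set \<tau>"
  shows "(transfer_op \<tau> ^^ n) (pointwise_add \<tau> f g) x = (transfer_op \<tau> ^^ n) f x + (transfer_op \<tau> ^^ n) g x"
proof -
  obtain k where k: "k \<in> all_germs" "x = quot k" using assms by (auto simp: X_set_eq)
  have "iterate_preimages n k \<subseteq> all_germs" by (auto simp: iterate_preimages_def)
  then have "(\<Sum>h\<in>iterate_preimages n k. pointwise_add \<tau> f g (quot h)) =
      (\<Sum>h\<in>iterate_preimages n k. f (quot h) + g (quot h))"
    by (intro sum.cong) (auto simp: pointwise_add_def quot_in)
  then show ?thesis unfolding k(2) transfer_op_iterate_quot[OF k(1)] by (simp add: sum.distrib)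
qed

lemma transfer_iterate_scale:
  assumes "x \<in> X_set \<tau>"
  shows "(transfer_op \<tau> ^^ n) (pointwise_scale \<tau> c f) x = c * (transfer_op \<tau> ^^ n) f x"
proof -
  obtain k where k: "k \<in> all_germs" "x = quot k" using assms by (auto simp: X_set_eq)
  have "iterate_preimages n k \<subseteq> all_germs" by (auto simp: iterate_preimages_def)
  then have "(\<Sum>h\<in>iterate_preimages n k. pointwise_scale \<tau> c f (quot h)) =
      (\<Sum>h\<in>iterate_preimages n k. c * f (quot h))"
    by (intro sum.cong) (auto simp: pointwise_scale_def quot_in)
  then show ?thesis unfolding k(2) transfer_op_iterate_quot[OF k(1)] by (simp add: sum_distrib_left)
qed

lemma transfer_iterate_unit:
  assumes "g \<in> all_germs"
  shows "(transfer_op \<tau> ^^ n) (unit_function \<tau>) (quot g) = int (card (iterate_preimages n g))"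
proof -
  have "iterate_preimages n g \<subseteq> all_germs" by (auto simp: iterate_preimages_def)
  then have "(\<Sum>h\<in>iterate_preimages n g. unit_function \<tau> (quot h)) = (\<Sum>h\<in>iterate_preimages n g. 1)"
    by (intro sum.cong) (auto simp: unit_function_def quot_in)
  then show ?thesis unfolding transfer_op_iterate_quot[OF assms] by simp
qed

lemma transfer_iterate_nonneg:
  assumes "\<And>x. x \<in> X_set \<tau> \<Longrightarrow> 0 \<le> f x" "x \<in> X_set \<tau>"
  shows "0 \<le> (transfer_op \<tau> ^^ n) f x"
proof -
  obtain k where k: "k \<in> all_germs" "x = quot k" using assms(2) by (auto simp: X_set_eq)
  have "iterate_preimages n k \<subseteq> all_germs" by (auto simp: iterate_preimages_def)
  then show ?thesis unfolding k(2) transfer_op_iterate_quot[OF k(1)]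
    by (intro sum_nonneg assms(1) quot_in) auto
qed

lemma eventually_nonneg_from:
  assumes "eventually_nonneg \<tau> f"
  shows "\<exists>n. \<forall>m\<ge>n. \<forall>x\<in>X_set \<tau>. 0 \<le> (transfer_op \<tau> ^^ m) f x"
proof -
  obtain n where n: "\<And>x. x \<in> X_set \<tau> \<Longrightarrow> 0 \<le> (transfer_op \<tau> ^^ n) f x"
    using assms unfolding eventually_nonneg_def by blast
  have "0 \<le> (transfer_op \<tau> ^^ m) f x" if "m \<ge> n" "x \<in> X_set \<tau>" for m x
    using transfer_iterate_nonneg[where f = "(transfer_op \<tau> ^^ n) f" and n = "m - n", OF n that(2)] that(1)
      funpow_add[of "m - n" n "transfer_op \<tau>"] by simp
  then show ?thesis by blast
qed

lemma eventually_equal_from: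
  assumes "(transfer_op \<tau> ^^ n) f = (transfer_op \<tau> ^^ n) g" "n \<le> m"
  shows "(transfer_op \<tau> ^^ m) f = (transfer_op \<tau> ^^ m) g"
  using assms funpow_add[of "m - n" n "transfer_op \<tau>"] by simp

section \<open>The quotient group, its positive cone and its endomorphism\<close>

lemma equiv_DG_rel: "equiv (CXZ \<tau>) (DG_rel \<tau>)"
proof (rule equivI)
  show "DG_rel \<tau> \<subseteq> CXZ \<tau> \<times> CXZ \<tau>" by (auto simp: DG_rel_def)
  show "refl_on (CXZ \<tau>) (DG_rel \<tau>)" by (auto simp: DG_rel_def refl_on_def)
  show "sym (DG_rel \<tau>)" by (auto simp: DG_rel_def sym_def) metis
  show "trans (DG_rel \<tau>)"
  proof (rule transI)
    fix f g h assume "(f, g) \<in> DG_rel \<tau>" "(g, h) \<in> DG_rel \<tau>"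
    then obtain n m where *: "f \<in> CXZ \<tau>" "h \<in> CXZ \<tau>"
      "(transfer_op \<tau> ^^ n) f = (transfer_op \<tau> ^^ n) g" "(transfer_op \<tau> ^^ m) g = (transfer_op \<tau> ^^ m) h"
      by (auto simp: DG_rel_def)
    have "(transfer_op \<tau> ^^ max n m) f = (transfer_op \<tau> ^^ max n m) h"
      using eventually_equal_from[OF *(3), of "max n m"] eventually_equal_from[OF *(4), of "max n m"] by simp
    then show "(f, h) \<in> DG_rel \<tau>" using * by (auto simp: DG_rel_def)
  qed
qed

lemma DG_class_eq_iff:
  assumes "f \<in> CXZ \<tau>" "g \<in> CXZ \<tau>"
  shows "DG_class \<tau> f = DG_class \<tau> g \<longleftrightarrow> eventually_equal \<tau> f g"
  using eq_equiv_class_iff[OF equiv_DG_rel assms] assms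
  by (simp add: DG_class_def DG_rel_def eventually_equal_def)

lemma mem_DG_class: "f \<in> DG_class \<tau> g \<longleftrightarrow> f \<in> CXZ \<tau> \<and> g \<in> CXZ \<tau> \<and> eventually_equal \<tau> g f"
  by (auto simp: DG_class_def DG_rel_def eventually_equal_def)

lemma DG_carrier: "carrier (DG \<tau>) = DG_class \<tau> ` CXZ \<tau>"
  by (auto simp: DG_def quotient_def DG_class_def)

lemma eventually_equal_add:
  assumes "eventually_equal \<tau> f f'" "eventually_equal \<tau> g g'"
  shows "eventually_equal \<tau> (pointwise_add \<tau> f g) (pointwise_add \<tau> f' g')"
proof -
  obtain n m where *: "(transfer_op \<tau> ^^ n) f = (transfer_op \<tau> ^^ n) f'"
      "(transfer_op \<tau> ^^ m) g = (transfer_op \<tau> ^^ m) g'"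
    using assms by (auto simp: eventually_equal_def)
  \<comment> \<open>The extra application makes both sides extensional, so that comparing them on
    \<open>X_set\<close> is enough.\<close>
  let ?k = "Suc (max n m)"
  have ext: "(transfer_op \<tau> ^^ ?k) h \<in> extensional (X_set \<tau>)" for h
    by (simp add: transfer_op_def)
  have "(transfer_op \<tau> ^^ ?k) (pointwise_add \<tau> f g) = (transfer_op \<tau> ^^ ?k) (pointwise_add \<tau> f' g')"
  proof (rule extensionalityI[OF ext ext])
    fix x assume x: "x \<in> X_set \<tau>"
    show "(transfer_op \<tau> ^^ ?k) (pointwise_add \<tau> f g) x = (transfer_op \<tau> ^^ ?k) (pointwise_add \<tau> f' g') x"
      unfolding transfer_iterate_add[OF x]
      using eventually_equal_from[OF *(1), of ?k] eventually_equal_from[OF *(2), of ?k] by simp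
  qed
  then show ?thesis unfolding eventually_equal_def by blast
qed

text \<open>All pairs of representatives yield the same class, so the union in the definition of the
  product collapses to it.\<close>

lemma DG_mult:
  assumes f: "f \<in> CXZ \<tau>" and g: "g \<in> CXZ \<tau>"
  shows "DG_class \<tau> f \<otimes>\<^bsub>DG \<tau>\<^esub> DG_class \<tau> g = DG_class \<tau> (pointwise_add \<tau> f g)"
proof -
  have "DG_class \<tau> (pointwise_add \<tau> f' g') = DG_class \<tau> (pointwise_add \<tau> f g)"
    if "f' \<in> DG_class \<tau> f" "g' \<in> DG_class \<tau> g" for f' g'
  proof -
    have "eventually_equal \<tau> (pointwise_add \<tau> f g) (pointwise_add \<tau> f' g')"
      using that by (intro eventually_equal_add) (auto simp: mem_DG_class)
    then show ?thesis using that f g by (subst eq_commute, subst DG_class_eq_iff) (auto simp: mem_DG_class intro: pointwise_add_CXZ)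
  qed
  moreover have "f \<in> DG_class \<tau> f" "g \<in> DG_class \<tau> g"
    using f g by (auto simp: mem_DG_class eventually_equal_def)
  ultimately have "(\<Union>f'\<in>DG_class \<tau> f. \<Union>g'\<in>DG_class \<tau> g. DG_class \<tau> (pointwise_add \<tau> f' g')) =
      DG_class \<tau> (pointwise_add \<tau> f g)"
    by blast
  then show ?thesis by (simp add: DG_def pointwise_add_def)
qed

lemma transfer_op_star_class:
  assumes f: "f \<in> CXZ \<tau>"
  shows "transfer_op_star \<tau> (DG_class \<tau> f) = DG_class \<tau> (transfer_op \<tau> f)"
proof -
  have "DG_class \<tau> (transfer_op \<tau> f') = DG_class \<tau> (transfer_op \<tau> f)" if f': "f' \<in> DG_class \<tau> f" for f'
  proof -
    obtain n where "(transfer_op \<tau> ^^ n) f = (transfer_op \<tau> ^^ n) f'"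
      using f' by (auto simp: mem_DG_class eventually_equal_def)
    then have "(transfer_op \<tau> ^^ n) (transfer_op \<tau> f') = (transfer_op \<tau> ^^ n) (transfer_op \<tau> f)"
      by (simp add: funpow_swap1[symmetric])
    then show ?thesis using f f' transfer_op_CXZ
      by (subst DG_class_eq_iff) (auto simp: mem_DG_class eventually_equal_def)
  qed
  moreover have "f \<in> DG_class \<tau> f" using f by (auto simp: mem_DG_class eventually_equal_def)
  ultimately show ?thesis unfolding transfer_op_star_def by blast
qed

lemma DG_class_pos_iff:
  assumes f: "f \<in> CXZ \<tau>"
  shows "DG_class \<tau> f \<in> DG_pos \<tau> \<longleftrightarrow> eventually_nonneg \<tau> f"
proof
  assume "DG_class \<tau> f \<in> DG_pos \<tau>"
  then obtain g where g: "DG_class \<tau> f = DG_class \<tau> g" "g \<in> CXZ \<tau>" "eventually_nonneg \<tau> g"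
    unfolding DG_pos_def eventually_nonneg_def by blast
  obtain n where n: "(transfer_op \<tau> ^^ n) f = (transfer_op \<tau> ^^ n) g"
    using g(1) DG_class_eq_iff[OF f g(2)] by (auto simp: eventually_equal_def)
  obtain m where "\<And>k. k \<ge> m \<Longrightarrow> \<forall>x\<in>X_set \<tau>. 0 \<le> (transfer_op \<tau> ^^ k) g x"
    using eventually_nonneg_from[OF g(3)] by blast
  then have "\<forall>x\<in>X_set \<tau>. 0 \<le> (transfer_op \<tau> ^^ max n m) f x"
    using eventually_equal_from[OF n, of "max n m"] by simp
  then show "eventually_nonneg \<tau> f" unfolding eventually_nonneg_def by blast
next
  assume "eventually_nonneg \<tau> f"
  then show "DG_class \<tau> f \<in> DG_pos \<tau>"
    using f unfolding DG_pos_def eventually_nonneg_def by blast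
qed

end

text \<open>An isomorphism of dimension triples, seen as a relation between representatives; negatives
  are avoided, so that only sums of functions have to be related.\<close>

locale dimension_relation =
  A: piecewise_monotonic_map \<tau>1 + B: piecewise_monotonic_map \<tau>2
  for \<tau>1 \<tau>2 :: "real \<Rightarrow> real" +
  fixes R :: "(split_point \<Rightarrow> int) \<Rightarrow> (split_point \<Rightarrow> int) \<Rightarrow> bool"
  assumes R_CXZ: "R f g \<Longrightarrow> f \<in> CXZ \<tau>1 \<and> g \<in> CXZ \<tau>2"
    and R_total: "f \<in> CXZ \<tau>1 \<Longrightarrow> \<exists>g. R f g"
    and R_surj: "g \<in> CXZ \<tau>2 \<Longrightarrow> \<exists>f. R f g"
    and R_add: "R f g \<Longrightarrow> R f' g' \<Longrightarrow> R (pointwise_add \<tau>1 f f') (pointwise_add \<tau>2 g g')"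
    and R_transfer: "R f g \<Longrightarrow> R (transfer_op \<tau>1 f) (transfer_op \<tau>2 g)"
    and R_nonneg: "R f g \<Longrightarrow> eventually_nonneg \<tau>1 f \<longleftrightarrow> eventually_nonneg \<tau>2 g"
    and R_equal: "R f g \<Longrightarrow> R f' g' \<Longrightarrow> eventually_equal \<tau>1 f f' \<longleftrightarrow> eventually_equal \<tau>2 g g'"
begin

text \<open>The axioms are symmetric in the two maps, so a bound for one growth rate also gives the
  opposite bound.\<close>

lemma converse: "dimension_relation \<tau>2 \<tau>1 (\<lambda>g f. R f g)"
proof
  fix f g f' g'
  show "f \<in> CXZ \<tau>2 \<and> g \<in> CXZ \<tau>1" if "R g f" using R_CXZ[OF that] by blast
  show "\<exists>g. R g f" if "f \<in> CXZ \<tau>2" using R_surj[OF that] .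
  show "\<exists>f. R g f" if "g \<in> CXZ \<tau>1" using R_total[OF that] .
  show "R (pointwise_add \<tau>1 g g') (pointwise_add \<tau>2 f f')" if "R g f" "R g' f'" using R_add[OF that] .
  show "R (transfer_op \<tau>1 g) (transfer_op \<tau>2 f)" if "R g f" using R_transfer[OF that] .
  show "eventually_nonneg \<tau>2 f \<longleftrightarrow> eventually_nonneg \<tau>1 g" if "R g f" using R_nonneg[OF that] by simp
  show "eventually_equal \<tau>2 f f' \<longleftrightarrow> eventually_equal \<tau>1 g g'" if "R g f" "R g' f'"
    using R_equal[OF that] by simp
qed

lemma R_transfer_iterate: "R f g \<Longrightarrow> R ((transfer_op \<tau>1 ^^ n) f) ((transfer_op \<tau>2 ^^ n) g)"
  by (induction n) (auto intro: R_transfer)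

text \<open>Multiples arise by repeated addition. Starting from one copy avoids relating the zero
  functions, about which the axioms say nothing directly.\<close>

lemma R_scale:
  assumes R: "R f g"
  shows "R (pointwise_scale \<tau>1 (int (Suc k)) f) (pointwise_scale \<tau>2 (int (Suc k)) g)"
proof (induction k)
  case 0
  have "pointwise_scale \<tau>1 (int (Suc 0)) f = f" "pointwise_scale \<tau>2 (int (Suc 0)) g = g"
    using R_CXZ[OF R] unfolding CXZ_def pointwise_scale_def
    by (auto simp: extensional_restrict)
  then show ?case using R by simp
next
  case (Suc k)
  have *: "pointwise_add \<tau> h (pointwise_scale \<tau> (int (Suc k)) h) = pointwise_scale \<tau> (int (Suc (Suc k))) h" for \<tau> h
    unfolding pointwise_add_def pointwise_scale_def by (auto simp: algebra_simps)
  show ?case using R_add[OF R Suc.IH] unfolding * .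
qed

text \<open>The difference \<open>d\<close> is formed on the first side, where it is a nonnegative
  function; its partner is eventually nonnegative, and adding it to \<open>f'\<close> gives
  \<open>g'\<close> up to eventual equality.\<close>

lemma R_mono:
  assumes R: "R f f'" "R g g'" and le: "\<And>x. x \<in> X_set \<tau>1 \<Longrightarrow> f x \<le> g x"
  shows "eventually_le \<tau>2 f' g'"
proof -
  define d where "d = pointwise_add \<tau>1 g (pointwise_scale \<tau>1 (- 1) f)"
  have d: "d \<in> CXZ \<tau>1" unfolding d_def
    using R_CXZ[OF R(1)] R_CXZ[OF R(2)] by (intro A.pointwise_add_CXZ A.pointwise_scale_CXZ) auto
  then obtain d' where d': "R d d'" using R_total by blast
  have "pointwise_add \<tau>1 f d = g"
    using R_CXZ[OF R(2)]
    by (intro extensionalityI[of _ "X_set \<tau>1"]) (auto simp: pointwise_add_def pointwise_scale_def d_def CXZ_def)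
  then have "R g (pointwise_add \<tau>2 f' d')" using R_add[OF R(1) d'] by simp
  moreover have "eventually_equal \<tau>1 g g" by (simp add: eventually_equal_def)
  ultimately have "eventually_equal \<tau>2 g' (pointwise_add \<tau>2 f' d')" using R_equal[OF R(2)] by blast
  then obtain n where n: "(transfer_op \<tau>2 ^^ n) g' = (transfer_op \<tau>2 ^^ n) (pointwise_add \<tau>2 f' d')"
    by (auto simp: eventually_equal_def)
  have "eventually_nonneg \<tau>1 d"
    unfolding eventually_nonneg_def using le
    by (intro exI[of _ 0]) (auto simp: d_def pointwise_add_def pointwise_scale_def)
  then have "eventually_nonneg \<tau>2 d'" using R_nonneg[OF d'] by blast
  then obtain m where m: "\<And>k x. k \<ge> m \<Longrightarrow> x \<in> X_set \<tau>2 \<Longrightarrow> 0 \<le> (transfer_op \<tau>2 ^^ k) d' x"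
    using B.eventually_nonneg_from by blast
  have "(transfer_op \<tau>2 ^^ k) f' x \<le> (transfer_op \<tau>2 ^^ k) g' x" if "k \<ge> max n m" "x \<in> X_set \<tau>2" for k x
  proof -
    have "(transfer_op \<tau>2 ^^ k) g' = (transfer_op \<tau>2 ^^ k) (pointwise_add \<tau>2 f' d')"
      using B.eventually_equal_from[OF n, of k] that(1) by simp
    then show ?thesis using B.transfer_iterate_add[OF that(2), of k f' d'] m[of k x] that by simp
  qed
  then show ?thesis unfolding eventually_le_def by blast
qed

text \<open>If \<open>f\<close> represents the image of the unit, then the \<open>n\<close>-th power of the second transfer
  operator multiplies \<open>f\<close> by at most the word count of the first map, and \<open>f\<close> dominates the unit.\<close>

lemma card_iterate_preimages_growth:
  "\<exists>C>0. \<exists>m. \<forall>j. \<forall>g\<in>all_germs.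
     card (B.iterate_preimages (m + j * n) g) \<le> C * A.word_count n ^ j"
proof -
  define K where "K = int (A.word_count n)"
  have K: "K > 0" using A.word_count_pos by (simp add: K_def)
  let ?L = "transfer_op \<tau>2"
  obtain f where f: "R (unit_function \<tau>1) f" using R_total A.unit_function_CXZ by blast
  have fC: "f \<in> CXZ \<tau>2" using R_CXZ[OF f] by blast
  \<comment> \<open>\<open>R_scale\<close> provides positive multiples only.\<close>
  have "\<exists>k. K = int (Suc k)" using K by (metis gr0_implies_Suc K_def of_nat_0_less_iff)
  then have "R (pointwise_scale \<tau>1 K (unit_function \<tau>1)) (pointwise_scale \<tau>2 K f)"
    using R_scale[OF f] by auto
  moreover have "(transfer_op \<tau>1 ^^ n) (unit_function \<tau>1) x \<le> pointwise_scale \<tau>1 K (unit_function \<tau>1) x"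
    if "x \<in> X_set \<tau>1" for x
    using that A.transfer_iterate_unit A.card_iterate_preimages_le
    by (auto simp: A.X_set_eq pointwise_scale_def unit_function_def K_def)
  ultimately have "eventually_le \<tau>2 ((?L ^^ n) f) (pointwise_scale \<tau>2 K f)"
    using R_mono[OF R_transfer_iterate[OF f]] by blast
  then obtain m1 where m1: "\<And>m x. m \<ge> m1 \<Longrightarrow> x \<in> X_set \<tau>2 \<Longrightarrow>
      (?L ^^ m) ((?L ^^ n) f) x \<le> (?L ^^ m) (pointwise_scale \<tau>2 K f) x"
    unfolding eventually_le_def by blast
  \<comment> \<open>Multiplication by \<open>K\<close> commutes with the operator, so
    \<open>n\<close> further applications cost a factor \<open>K\<close> at every stage past the
    threshold.\<close>
  have step: "(?L ^^ (m + n)) f x \<le> K * (?L ^^ m) f x" if "m \<ge> m1" "x \<in> X_set \<tau>2" for m x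
    using m1[OF that] B.transfer_iterate_scale[OF that(2), of m K f] by (simp add: funpow_add)
  \<comment> \<open>The units of the two maps need not correspond. A partner \<open>g\<close> of the
    second unit is bounded by a constant \<open>c\<close>, hence lies below \<open>c\<close> times
    the first unit, and so \<open>c\<close> times \<open>f\<close> eventually dominates the second
    unit.\<close>
  obtain g where g: "R g (unit_function \<tau>2)" using R_surj B.unit_function_CXZ by blast
  then obtain c where c: "c > 0" "\<And>x. x \<in> X_set \<tau>1 \<Longrightarrow> \<bar>g x\<bar> \<le> c"
    using A.CXZ_bounded R_CXZ by blast
  have "\<exists>k. c = int (Suc k)" using c(1) by (metis gr0_implies_Suc pos_int_cases)
  then have "R (pointwise_scale \<tau>1 c (unit_function \<tau>1)) (pointwise_scale \<tau>2 c f)"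
    using R_scale[OF f] by auto
  moreover have "g x \<le> pointwise_scale \<tau>1 c (unit_function \<tau>1) x" if "x \<in> X_set \<tau>1" for x
    using c(2)[OF that] that by (simp add: pointwise_scale_def unit_function_def)
  ultimately have "eventually_le \<tau>2 (unit_function \<tau>2) (pointwise_scale \<tau>2 c f)"
    using R_mono[OF g] by blast
  then obtain m2 where m2: "\<And>m x. m \<ge> m2 \<Longrightarrow> x \<in> X_set \<tau>2 \<Longrightarrow>
      (?L ^^ m) (unit_function \<tau>2) x \<le> (?L ^^ m) (pointwise_scale \<tau>2 c f) x"
    unfolding eventually_le_def by blast
  \<comment> \<open>From stage \<open>m\<close> on both inequalities hold. The bound
    \<open>b\<close> on the function at this stage starts the iteration, and \<open>c * b\<close>
    becomes the constant \<open>C\<close>.\<close>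
  define m where "m = max m1 m2"
  obtain b where b: "b > 0" "\<And>x. x \<in> X_set \<tau>2 \<Longrightarrow> \<bar>(?L ^^ m) f x\<bar> \<le> b"
    using B.CXZ_bounded[OF B.transfer_op_iterate_CXZ[OF fC]] by blast
  have growth: "(?L ^^ (m + j * n)) f x \<le> K ^ j * b" if x: "x \<in> X_set \<tau>2" for j x
  proof (induction j)
    case 0
    then show ?case using b(2)[OF x] by simp
  next
    case (Suc j)
    have "(?L ^^ (m + Suc j * n)) f x \<le> K * (?L ^^ (m + j * n)) f x"
      using step[of "m + j * n" x] x by (simp add: m_def ac_simps)
    also have "\<dots> \<le> K * (K ^ j * b)" using Suc K by (intro mult_left_mono) auto
    finally show ?case by (simp add: ac_simps)
  qed
  have "card (B.iterate_preimages (m + j * n) g) \<le> nat (c * b) * A.word_count n ^ j"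
    if g: "g \<in> all_germs" for j g
  proof -
    have x: "B.quot g \<in> X_set \<tau>2" using B.quot_in[OF g] .
    have "int (card (B.iterate_preimages (m + j * n) g)) \<le> c * (?L ^^ (m + j * n)) f (B.quot g)"
      using m2[of "m + j * n", OF _ x] B.transfer_iterate_unit[OF g, of "m + j * n"]
        B.transfer_iterate_scale[OF x, of "m + j * n" c f] by (simp add: m_def)
    also have "\<dots> \<le> c * (K ^ j * b)" using growth[OF x] c(1) by (intro mult_left_mono) auto
    also have "\<dots> = int (nat (c * b) * A.word_count n ^ j)" using c(1) b(1) by (simp add: K_def)
    finally show ?thesis by linarith
  qed
  moreover have "nat (c * b) > 0" using c(1) b(1) by simp
  ultimately show ?thesis by blast
qed

end

section \<open>Growth rates\<close>

lemma dimension_relation_of_isomorphic: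
  assumes pm: "piecewise_monotonic \<tau>1" "piecewise_monotonic \<tau>2"
    and iso: "triple_isomorphic (dimension_triple \<tau>1) (dimension_triple \<tau>2)"
  shows "\<exists>R. dimension_relation \<tau>1 \<tau>2 R"
proof -
  interpret A: piecewise_monotonic_map \<tau>1 by unfold_locales (rule pm)
  interpret B: piecewise_monotonic_map \<tau>2 by unfold_locales (rule pm)
  obtain \<phi> where \<phi>: "\<phi> \<in> iso (DG \<tau>1) (DG \<tau>2)" "\<phi> ` DG_pos \<tau>1 = DG_pos \<tau>2"
      "\<And>a. a \<in> carrier (DG \<tau>1) \<Longrightarrow> \<phi> (transfer_op_star \<tau>1 a) = transfer_op_star \<tau>2 (\<phi> a)"
    using iso unfolding triple_isomorphic_def dimension_triple_def by auto
  have bij: "bij_betw \<phi> (DG_class \<tau>1 ` CXZ \<tau>1) (DG_class \<tau>2 ` CXZ \<tau>2)"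
    using \<phi>(1) unfolding iso_def A.DG_carrier B.DG_carrier by blast
  have mult: "\<phi> (x \<otimes>\<^bsub>DG \<tau>1\<^esub> y) = \<phi> x \<otimes>\<^bsub>DG \<tau>2\<^esub> \<phi> y"
    if "x \<in> carrier (DG \<tau>1)" "y \<in> carrier (DG \<tau>1)" for x y
    using \<phi>(1) that unfolding iso_def hom_def by blast
  have inj: "\<phi> x = \<phi> y \<longleftrightarrow> x = y" if "x \<in> DG_class \<tau>1 ` CXZ \<tau>1" "y \<in> DG_class \<tau>1 ` CXZ \<tau>1" for x y
    using bij that unfolding bij_betw_def inj_on_def by blast
  define R where "R f g \<longleftrightarrow> f \<in> CXZ \<tau>1 \<and> g \<in> CXZ \<tau>2 \<and> \<phi> (DG_class \<tau>1 f) = DG_class \<tau>2 g" for f g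
  have "dimension_relation \<tau>1 \<tau>2 R"
  proof (unfold_locales)
    fix f g f' g'
    show "f \<in> CXZ \<tau>1 \<and> g \<in> CXZ \<tau>2" if "R f g" using that by (simp add: R_def)
    show "\<exists>g. R f g" if "f \<in> CXZ \<tau>1"
    proof -
      have "\<phi> (DG_class \<tau>1 f) \<in> DG_class \<tau>2 ` CXZ \<tau>2"
        using bij that unfolding bij_betw_def by blast
      then show ?thesis using that by (auto simp: R_def)
    qed
    show "\<exists>f. R f g" if "g \<in> CXZ \<tau>2"
    proof -
      have "DG_class \<tau>2 g \<in> \<phi> ` DG_class \<tau>1 ` CXZ \<tau>1"
        using bij that unfolding bij_betw_def by blast
      then show ?thesis using that by (auto simp: R_def)
    qed
    show "R (pointwise_add \<tau>1 f f') (pointwise_add \<tau>2 g g')" if "R f g" "R f' g'"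
    proof -
      have "\<phi> (DG_class \<tau>1 (pointwise_add \<tau>1 f f')) = \<phi> (DG_class \<tau>1 f \<otimes>\<^bsub>DG \<tau>1\<^esub> DG_class \<tau>1 f')"
        using that A.DG_mult by (simp add: R_def)
      also have "\<dots> = \<phi> (DG_class \<tau>1 f) \<otimes>\<^bsub>DG \<tau>2\<^esub> \<phi> (DG_class \<tau>1 f')"
        using that by (intro mult) (auto simp: R_def A.DG_carrier)
      also have "\<dots> = DG_class \<tau>2 (pointwise_add \<tau>2 g g')"
        using that B.DG_mult by (simp add: R_def)
      finally show ?thesis
        using that A.pointwise_add_CXZ B.pointwise_add_CXZ by (simp add: R_def)
    qed
    show "R (transfer_op \<tau>1 f) (transfer_op \<tau>2 g)" if "R f g"
    proof -
      have "\<phi> (DG_class \<tau>1 (transfer_op \<tau>1 f)) = \<phi> (transfer_op_star \<tau>1 (DG_class \<tau>1 f))"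
        using that A.transfer_op_star_class by (simp add: R_def)
      also have "\<dots> = transfer_op_star \<tau>2 (DG_class \<tau>2 g)"
        using that \<phi>(3)[of "DG_class \<tau>1 f"] by (simp add: R_def A.DG_carrier)
      also have "\<dots> = DG_class \<tau>2 (transfer_op \<tau>2 g)"
        using that B.transfer_op_star_class by (simp add: R_def)
      finally show ?thesis
        using that A.transfer_op_CXZ B.transfer_op_CXZ by (simp add: R_def)
    qed
    show "eventually_nonneg \<tau>1 f \<longleftrightarrow> eventually_nonneg \<tau>2 g" if R: "R f g"
    proof -
      have f: "f \<in> CXZ \<tau>1" "g \<in> CXZ \<tau>2" "\<phi> (DG_class \<tau>1 f) = DG_class \<tau>2 g"
        using R by (auto simp: R_def)
      have pos: "DG_pos \<tau>1 \<subseteq> DG_class \<tau>1 ` CXZ \<tau>1" by (auto simp: DG_pos_def)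
      \<comment> \<open>Positivity is reflected as well as preserved because \<phi> is
        injective.\<close>
      have "DG_class \<tau>1 f \<in> DG_pos \<tau>1 \<longleftrightarrow> \<phi> (DG_class \<tau>1 f) \<in> \<phi> ` DG_pos \<tau>1"
      proof
        assume "\<phi> (DG_class \<tau>1 f) \<in> \<phi> ` DG_pos \<tau>1"
        then obtain c where "c \<in> DG_pos \<tau>1" "\<phi> (DG_class \<tau>1 f) = \<phi> c" by blast
        then show "DG_class \<tau>1 f \<in> DG_pos \<tau>1" using inj[of "DG_class \<tau>1 f" c] pos f by blast
      qed blast
      then show ?thesis
        unfolding A.DG_class_pos_iff[OF f(1), symmetric] B.DG_class_pos_iff[OF f(2), symmetric]
        using \<phi>(2) f(3) by simp
    qed
    show "eventually_equal \<tau>1 f f' \<longleftrightarrow> eventually_equal \<tau>2 g g'" if "R f g" "R f' g'"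
      using that inj[of "DG_class \<tau>1 f" "DG_class \<tau>1 f'"] A.DG_class_eq_iff[of f f'] B.DG_class_eq_iff[of g g']
      by (auto simp: R_def)
  qed
  then show ?thesis by blast
qed

text \<open>Factors linear in \<open>n\<close> become \<open>ln n\<close> under the logarithm and
  vanish after division by \<open>n\<close>; all comparisons of growth below lose no more than
  this.\<close>

lemma limsup_le_of_log_bound:
  fixes a b :: "nat \<Rightarrow> real"
  assumes "\<forall>\<^sub>F n in sequentially. a n \<le> b n + ln (real n) + E"
  shows "limsup (\<lambda>n. ereal (a n / real n)) \<le> limsup (\<lambda>n. ereal (b n / real n))"
proof -
  have "(\<lambda>n. ln (real n) / real n + E / real n) \<longlonglongrightarrow> 0 + 0"
    by (intro tendsto_add lim_ln_over_n lim_const_over_n)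
  then have lim: "(\<lambda>n. ereal (ln (real n) / real n + E / real n)) \<longlonglongrightarrow> 0"
    by (simp add: zero_ereal_def)
  have "limsup (\<lambda>n. ereal (a n / real n)) \<le>
      limsup (\<lambda>n. ereal (ln (real n) / real n + E / real n) + ereal (b n / real n))"
  proof (rule Limsup_mono)
    show "\<forall>\<^sub>F n in sequentially. ereal (a n / real n) \<le>
        ereal (ln (real n) / real n + E / real n) + ereal (b n / real n)"
      using assms eventually_gt_at_top[of 0]
    proof eventually_elim
      case (elim n)
      then have "a n / real n \<le> (b n + ln (real n) + E) / real n" by (intro divide_right_mono) auto
      then show ?case by (simp add: add_divide_distrib)
    qed
  qed
  also have "\<dots> = 0 + limsup (\<lambda>n. ereal (b n / real n))"
    by (rule ereal_limsup_lim_add[OF lim]) simp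
  finally show ?thesis by simp
qed

lemma limsup_le_of_linear_bound:
  fixes a :: "nat \<Rightarrow> real"
  assumes "\<forall>\<^sub>F n in sequentially. a n \<le> r * real n + ln (real n) + E"
  shows "limsup (\<lambda>n. ereal (a n / real n)) \<le> ereal r"
proof -
  have "limsup (\<lambda>n. ereal (r * real n / real n)) = limsup (\<lambda>n. ereal r)"
    by (intro Limsup_eq eventually_mono[OF eventually_gt_at_top[of 0]]) auto
  then show ?thesis
    using limsup_le_of_log_bound[OF assms] by (simp add: Limsup_const)
qed

context piecewise_monotonic_map
begin

definition growth_rate :: ereal where
  "growth_rate = limsup (\<lambda>n. ereal (ln (real (word_count n)) / real n))"

lemma ln_word_count_nonneg: "0 \<le> ln (real (word_count n))"
  using word_count_pos[of n] by (intro ln_ge_zero) (simp add: Suc_leI)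

end

context dimension_relation
begin

text \<open>A length is written as \<open>N = m + j * n + i\<close>. Submultiplicativity removes the
  last \<open>i\<close> letters, \<open>exists_many_preimages\<close> turns the remaining words into
  preimages of one germ, and these are bounded by \<open>C * K ^ j\<close>.\<close>

lemma growth_rate_le_word_count:
  assumes n: "0 < n"
  shows "B.growth_rate \<le> ereal (ln (real (A.word_count n)) / real n)"
proof -
  define K where "K = A.word_count n"
  obtain C m where C: "C > 0" and
    growth: "\<And>j g. g \<in> all_germs \<Longrightarrow> card (B.iterate_preimages (m + j * n) g) \<le> C * K ^ j"
    using card_iterate_preimages_growth[of n] unfolding K_def by blast
  define D where "D = card B.boundary_germs"
  \<comment> \<open>\<open>D\<close> comes from the boundary germs, \<open>C\<close> from the
    comparison of preimage counts, and the last factor from the incomplete block of fewer than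
    \<open>n\<close> letters.\<close>
  define F where "F = real (D * C * B.word_count n)"
  have K: "1 \<le> K" using A.word_count_pos[of n] by (simp add: K_def)
  have "ln (real (B.word_count N)) \<le> ln (real K) / real n * real N + ln (real N) + ln F"
    if N: "N \<ge> m + n" for N
  proof -
    define j where "j = (N - m) div n"
    define i where "i = (N - m) mod n"
    have N_eq: "N = m + j * n + i" using N by (simp add: j_def i_def)
    have "i \<le> n" using n by (simp add: i_def less_imp_le)
    \<comment> \<open>This is why \<open>N\<close> starts at \<open>m + n\<close>: the length
      \<open>m + j * n\<close> has to be positive.\<close>
    have "j \<ge> 1" using N n by (simp add: j_def div_greater_zero_iff Suc_leI)
    then have pos: "0 < m + j * n" using n by simp
    obtain g where g: "g \<in> all_germs"
        "B.word_count (m + j * n) \<le> (m + j * n) * D * card (B.iterate_preimages (m + j * n) g)"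
      using B.exists_many_preimages[OF pos] unfolding D_def by blast
    have "B.word_count N \<le> B.word_count (m + j * n) * B.word_count i"
      unfolding N_eq by (rule B.word_count_add_le)
    also have "\<dots> \<le> (N * D * (C * K ^ j)) * B.word_count n"
      using g(2) growth[OF g(1), of j] B.word_count_mono[OF \<open>i \<le> n\<close>] N_eq
      by (intro mult_le_mono order_trans[OF g(2)] mult_le_mono) auto
    finally have le: "B.word_count N \<le> N * (D * C * B.word_count n) * K ^ j" by (simp add: ac_simps)
    \<comment> \<open>The positivity that the logarithms require is inherited from the word count on
      the left.\<close>
    have "0 < N * (D * C * B.word_count n) * K ^ j" using le B.word_count_pos[of N] by linarith
    then have p: "0 < N" "F > 0" by (auto simp: F_def)
    have "real (B.word_count N) \<le> real N * F * real K ^ j"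
      using le unfolding F_def by (metis of_nat_le_iff of_nat_mult of_nat_power)
    then have "ln (real (B.word_count N)) \<le> ln (real N * F * real K ^ j)"
      using B.word_count_pos[of N] by simp
    also have "\<dots> = ln (real N) + ln F + real j * ln (real K)"
      using p K by (simp add: ln_mult ln_realpow)
    also have "real j * ln (real K) \<le> ln (real K) / real n * real N"
    proof -
      have "real (j * n) \<le> real N" using N_eq by simp
      then have "real j \<le> real N / real n" using n by (simp add: field_simps)
      then have "real j * ln (real K) \<le> real N / real n * ln (real K)"
        using K by (intro mult_right_mono) auto
      then show ?thesis by (simp add: field_simps)
    qed
    finally show ?thesis by simp
  qed
  then have "\<forall>\<^sub>F N in sequentially.
      ln (real (B.word_count N)) \<le> ln (real K) / real n * real N + ln (real N) + ln F"
    using eventually_ge_at_top[of "m + n"] by (rule eventually_mono[rotated])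
  from limsup_le_of_linear_bound[OF this] show ?thesis unfolding B.growth_rate_def K_def .
qed

text \<open>The bound by a word count of the first map holds for every positive \<open>n\<close>,
  hence also for the upper limit over \<open>n\<close>.\<close>

lemma growth_rate_le: "B.growth_rate \<le> A.growth_rate"
  unfolding A.growth_rate_def
  by (rule le_Limsup) (auto intro: eventually_mono[OF eventually_gt_at_top[of 0]] growth_rate_le_word_count)

end

lemma growth_rate_eq_of_isomorphic:
  assumes "piecewise_monotonic \<tau>1" "piecewise_monotonic \<tau>2"
    and "triple_isomorphic (dimension_triple \<tau>1) (dimension_triple \<tau>2)"
  shows "piecewise_monotonic_map.growth_rate \<tau>1 = piecewise_monotonic_map.growth_rate \<tau>2"
proof -
  obtain R where "dimension_relation \<tau>1 \<tau>2 R" using dimension_relation_of_isomorphic[OF assms] by blast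
  then show ?thesis
    using dimension_relation.growth_rate_le dimension_relation.converse by (intro antisym) blast+
qed

section \<open>Entropy of the shift\<close>

lemma cover_number_le:
  assumes "\<V> \<subseteq> \<U>" "finite \<V>" "\<Union>\<V> = topspace T"
  shows "cover_number T \<U> \<le> card \<V>"
  unfolding cover_number_def by (rule cInf_lower) (use assms in auto)

text \<open>An infimum of natural numbers is attained once its set is nonempty; the given finite
  subcover ensures this.\<close>

lemma cover_number_attained:
  assumes "\<V> \<subseteq> \<U>" "finite \<V>" "\<Union>\<V> = topspace T"
  shows "\<exists>\<W>\<subseteq>\<U>. finite \<W> \<and> \<Union>\<W> = topspace T \<and> card \<W> = cover_number T \<U>"
proof -
  let ?K = "{card \<V> |\<V>. \<V> \<subseteq> \<U> \<and> finite \<V> \<and> \<Union>\<V> = topspace T}"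
  have "card \<V> \<in> ?K" using assms by blast
  then have "?K \<noteq> {}" by blast
  from Inf_nat_def1[OF this] have "cover_number T \<U> \<in> ?K" unfolding cover_number_def .
  then obtain \<W> where "\<W> \<subseteq> \<U> \<and> finite \<W> \<and> \<Union>\<W> = topspace T" "cover_number T \<U> = card \<W>"
    by blast
  then show ?thesis by metis
qed

context piecewise_monotonic_map
begin

text \<open>By invariance of \<open>I1\<close> the orbit never meets a cut, so the values of \<tau>
  at the cuts do not enter and the germ orbit lies over the orbit of the point.\<close>

lemma iterate_off_I1:
  assumes "y \<notin> I1 \<tau>" "0 < y" "y < 1"
  shows "fst ((germ_step ^^ j) (y, True)) = (\<tau> ^^ j) y" "(\<tau> ^^ j) y \<notin> I1 \<tau>"
proof -
  have g: "(y, True) \<in> all_germs" using assms by (auto simp: germs_def)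
  have "fst ((germ_step ^^ j) (y, True)) = (\<tau> ^^ j) y \<and> (\<tau> ^^ j) y \<notin> I1 \<tau>"
  proof (induction j)
    case (Suc j)
    then show ?case
      using fst_germ_step_off_I1[OF iterate_in[OF g, of j]] germ_step_in_I1_iff[OF iterate_in[OF g, of j]]
      by auto
  qed (use assms in simp)
  then show "fst ((germ_step ^^ j) (y, True)) = (\<tau> ^^ j) y" "(\<tau> ^^ j) y \<notin> I1 \<tau>" by auto
qed

text \<open>From a point, the germ on its right follows the orbit as long as that stays in open
  pieces. Conversely the word of a germ is shared by a nearby point off \<open>I1\<close>, whose
  orbit avoids the cuts and so runs through open pieces.\<close>

lemma realised_word_iff:
  "(\<exists>x\<in>{0..1}. \<forall>i\<le>k. (\<tau> ^^ i) x \<in> open_piece \<tau> (s i)) \<and> (\<forall>i\<le>k. s i \<in> pieces \<tau>) \<longleftrightarrow>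
     map s [0..<Suc k] \<in> words (Suc k)"
proof
  assume "(\<exists>x\<in>{0..1}. \<forall>i\<le>k. (\<tau> ^^ i) x \<in> open_piece \<tau> (s i)) \<and> (\<forall>i\<le>k. s i \<in> pieces \<tau>)"
  then obtain x where x: "x \<in> {0..1}" "\<And>i. i \<le> k \<Longrightarrow> (\<tau> ^^ i) x \<in> open_piece \<tau> (s i)"
      "\<And>i. i \<le> k \<Longrightarrow> s i \<in> pieces \<tau>" by blast
  have "x < 1" using x(2)[of 0] piece_bounds[OF x(3)[of 0]] by (auto simp: open_piece_eq)
  then have g: "(x, True) \<in> all_germs" using x(1) by (auto simp: germs_def)
  have *: "piece_of ((germ_step ^^ i) (x, True)) = s i" if "i \<le> k" "fst ((germ_step ^^ i) (x, True)) = (\<tau> ^^ i) x" for i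
  proof (rule piece_of_eqI[OF x(3)[OF that(1)]])
    show "(germ_step ^^ i) (x, True) \<in> germs (lo (s i)) (hi (s i))"
      using x(2)[OF that(1)] that(2) by (cases "(germ_step ^^ i) (x, True)") (auto simp: germs_def open_piece_eq)
  qed
  have fst: "fst ((germ_step ^^ i) (x, True)) = (\<tau> ^^ i) x" if "i \<le> k" for i
    using that
  proof (induction i)
    case (Suc i)
    then show ?case
      using *[of i] branch_open_piece[OF x(3)[of i] x(2)[of i]] by (simp add: fst_germ_step)
  qed simp
  have "label_word piece_of (Suc k) (x, True) = map s [0..<Suc k]"
    unfolding label_word_def using * fst by (intro map_cong) auto
  then show "map s [0..<Suc k] \<in> words (Suc k)" using g unfolding words_def by (metis imageI)
next
  assume w: "map s [0..<Suc k] \<in> words (Suc k)"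
  then have "set (map s [0..<Suc k]) \<subseteq> pieces \<tau>" using words_subset by blast
  then have s: "\<forall>i\<le>k. s i \<in> pieces \<tau>" by (simp add: image_subset_iff less_Suc_eq_le del: upt_Suc)
  obtain g where g: "g \<in> all_germs" "label_word piece_of (Suc k) g = map s [0..<Suc k]"
    using w by (auto simp: words_def)
  obtain y where y: "y \<notin> I1 \<tau>" "0 < y" "y < 1"
      "label_word piece_of (Suc k) (y, True) = label_word piece_of (Suc k) g"
    using generic_germ_exists[OF g(1) label_word_locally_constant[OF piece_of_locally_constant g(1)]] by blast
  have yg: "(y, True) \<in> all_germs" using y by (auto simp: germs_def)
  have "(\<tau> ^^ i) y \<in> open_piece \<tau> (s i)" if "i \<le> k" for i
  proof -
    let ?h = "(germ_step ^^ i) (y, True)"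
    have "piece_of ?h = s i"
      using nth_label_word[of i "Suc k" piece_of "(y, True)"] y(4) g(2) that
      by (simp add: nth_append del: upt_Suc)
    then have "(\<tau> ^^ i) y \<in> closed_piece \<tau> (s i)"
      using fst_germ_closed_piece[OF iterate_in[OF yg, of i]] iterate_off_I1(1)[OF y(1-3)] by simp
    moreover have "lo (s i) \<in> I1 \<tau>" "hi (s i) \<in> I1 \<tau>"
      using piece_bounds(4,5) s that cuts_subset_I1 by blast+
    ultimately show ?thesis
      using iterate_off_I1(2)[OF y(1-3), of i] by (auto simp: closed_piece_eq open_piece_eq less_le)
  qed
  then show "(\<exists>x\<in>{0..1}. \<forall>i\<le>k. (\<tau> ^^ i) x \<in> open_piece \<tau> (s i)) \<and> (\<forall>i\<le>k. s i \<in> pieces \<tau>)"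
    using s y by (intro conjI bexI[of _ y]) auto
qed

lemma itineraries_iff: "s \<in> itineraries \<tau> \<longleftrightarrow> (\<forall>n. map s [0..<n] \<in> words n)"
proof -
  have "s \<in> itineraries \<tau> \<longleftrightarrow> (\<forall>k. (\<exists>x\<in>{0..1}. \<forall>i\<le>k. (\<tau> ^^ i) x \<in> open_piece \<tau> (s i)) \<and> (\<forall>i\<le>k. s i \<in> pieces \<tau>))"
    unfolding itineraries_def by blast
  also have "\<dots> \<longleftrightarrow> (\<forall>k. map s [0..<Suc k] \<in> words (Suc k))"
    unfolding realised_word_iff ..
  also have "\<dots> \<longleftrightarrow> (\<forall>n. map s [0..<n] \<in> words n)"
  proof -
    have "[] \<in> words 0" using all_germs_nonempty by (auto simp: words_def label_word_def)
    then show ?thesis by (metis list.simps(8) not0_implies_Suc upt_0)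
  qed
  finally show ?thesis .
qed

lemma itinerary_of_germ:
  assumes "g \<in> all_germs"
  shows "(\<lambda>i. piece_of ((germ_step ^^ i) g)) \<in> itineraries \<tau>"
  unfolding itineraries_iff using assms by (auto simp: words_def label_word_def)

lemma word_extends_to_itinerary:
  assumes "w \<in> words n"
  obtains s where "s \<in> itineraries \<tau>" "map s [0..<n] = w"
proof -
  obtain g where "g \<in> all_germs" "w = label_word piece_of n g" using assms by (auto simp: words_def)
  then show ?thesis using that[OF itinerary_of_germ[of g]] by (simp add: label_word_def)
qed

lemma shift_itinerary:
  assumes s: "s \<in> itineraries \<tau>"
  shows "(\<lambda>i. s (i + k)) \<in> itineraries \<tau>"
  unfolding itineraries_iff
proof
  fix n
  have "map s [0..<k + n] \<in> words (k + n)" using s itineraries_iff by blast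
  then obtain g where g: "g \<in> all_germs" "map s [0..<k + n] = label_word piece_of (k + n) g"
    by (auto simp: words_def)
  have "map (\<lambda>i. s (i + k)) [0..<n] = label_word piece_of n ((germ_step ^^ k) g)"
  proof (rule nth_equalityI)
    fix i assume "i < length (map (\<lambda>i. s (i + k)) [0..<n])"
    then have "i < n" by simp
    then have "map s [0..<k + n] ! (k + i) = label_word piece_of (k + n) g ! (k + i)" using g(2) by simp
    then show "map (\<lambda>i. s (i + k)) [0..<n] ! i = label_word piece_of n ((germ_step ^^ k) g) ! i"
      using \<open>i < n\<close> by (simp add: label_word_add nth_append add.commute)
  qed simp
  then show "map (\<lambda>i. s (i + k)) [0..<n] \<in> words n" using iterate_in[OF g(1)] by (auto simp: words_def)
qed

lemma shift_iterate: "((\<lambda>s i. s (Suc i)) ^^ k) s = (\<lambda>i. s (i + k))"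
  by (induction k) auto

section \<open>Cylinders and compactness of the space of itineraries\<close>

abbreviation sequence_top :: "(nat \<Rightarrow> nat) topology" where
  "sequence_top \<equiv> product_topology (\<lambda>_. discrete_topology (pieces \<tau>)) UNIV"

lemma topspace_sequence_top: "topspace sequence_top = {s. \<forall>i. s i \<in> pieces \<tau>}"
  by (auto simp: PiE_def Pi_def)

lemma openin_cylinder:
  assumes "\<And>i. s i \<in> pieces \<tau>"
  shows "openin sequence_top {t. (\<forall>i. t i \<in> pieces \<tau>) \<and> (\<forall>i<k. t i = s i)}"
proof -
  let ?U = "\<lambda>i. if i < k then {s i} else pieces \<tau>"
  have "openin sequence_top (Pi\<^sub>E UNIV ?U)"
  proof (rule product_topology_basis)
    show "openin (discrete_topology (pieces \<tau>)) (?U i)" for i using assms by auto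
    show "finite {i. ?U i \<noteq> topspace (discrete_topology (pieces \<tau>))}"
      by (rule finite_subset[of _ "{..<k}"]) auto
  qed
  moreover have "Pi\<^sub>E UNIV ?U = {t. (\<forall>i. t i \<in> pieces \<tau>) \<and> (\<forall>i<k. t i = s i)}"
    using assms by (auto simp: PiE_def Pi_def split: if_splits)
  ultimately show ?thesis by simp
qed

lemma itineraries_subset: "itineraries \<tau> \<subseteq> topspace sequence_top"
  unfolding topspace_sequence_top by (auto simp: itineraries_def)

lemma topspace_itinerary_top: "topspace (itinerary_top \<tau>) = itineraries \<tau>"
  unfolding itinerary_top_def using itineraries_subset by auto

text \<open>A sequence of pieces that is not an itinerary has an initial word that is not realised,
  and this excludes its whole cylinder. The itineraries thus form a closed subset of a compact
  product.\<close>

lemma compact_itinerary_top: "compact_space (itinerary_top \<tau>)"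
proof -
  have "compact_space sequence_top"
    using finite_pieces by (simp add: compact_space_product_topology compact_space_discrete_topology)
  moreover have "closedin sequence_top (itineraries \<tau>)"
    unfolding closedin_def
  proof (intro conjI itineraries_subset)
    show "openin sequence_top (topspace sequence_top - itineraries \<tau>)"
    proof (subst openin_subopen, rule ballI)
      fix s assume s: "s \<in> topspace sequence_top - itineraries \<tau>"
      then have sp: "\<And>i. s i \<in> pieces \<tau>" unfolding topspace_sequence_top by blast
      obtain k where k: "map s [0..<k] \<notin> words k" using s itineraries_iff by blast
      let ?T = "{t. (\<forall>i. t i \<in> pieces \<tau>) \<and> (\<forall>i<k. t i = s i)}"
      have "t \<notin> itineraries \<tau>" if "t \<in> ?T" for t
      proof -
        have "map t [0..<k] = map s [0..<k]" using that by auto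
        then show ?thesis using k itineraries_iff by metis
      qed
      then have "?T \<subseteq> topspace sequence_top - itineraries \<tau>" unfolding topspace_sequence_top by blast
      moreover have "s \<in> ?T" using sp by blast
      moreover have "openin sequence_top ?T" by (rule openin_cylinder[OF sp])
      ultimately show "\<exists>T. openin sequence_top T \<and> s \<in> T \<and> T \<subseteq> topspace sequence_top - itineraries \<tau>"
        by (intro exI[of _ ?T] conjI)
    qed
  qed
  ultimately have "compactin sequence_top (itineraries \<tau>)" by (rule closedin_compact_space)
  then show ?thesis unfolding itinerary_top_def by (rule compact_space_subtopology)
qed

lemma openin_itinerary_cylinder:
  assumes "s \<in> itineraries \<tau>"
  shows "openin (itinerary_top \<tau>) {t \<in> itineraries \<tau>. \<forall>i<k. t i = s i}"
proof -
  have "{t \<in> itineraries \<tau>. \<forall>i<k. t i = s i} =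
      {t. (\<forall>i. t i \<in> pieces \<tau>) \<and> (\<forall>i<k. t i = s i)} \<inter> itineraries \<tau>"
    by (auto simp: itineraries_def)
  then show ?thesis
    unfolding itinerary_top_def openin_subtopology
    using openin_cylinder[of s k] assms by (auto simp: itineraries_def)
qed

lemma open_contains_cylinder:
  assumes U: "openin (itinerary_top \<tau>) U" and s: "s \<in> U"
  shows "\<exists>k. \<forall>t\<in>itineraries \<tau>. (\<forall>i<k. t i = s i) \<longrightarrow> t \<in> U"
proof -
  obtain V where V: "openin sequence_top V" "U = V \<inter> itineraries \<tau>"
    using U unfolding itinerary_top_def openin_subtopology by blast
  then obtain Y where Y: "s \<in> Pi\<^sub>E UNIV Y" "finite {i. Y i \<noteq> topspace (discrete_topology (pieces \<tau>))}"
      "Pi\<^sub>E UNIV Y \<subseteq> V"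
    using product_topology_open_contains_basis[OF V(1), of s] s by blast
  obtain k where k: "\<And>i. i \<ge> k \<Longrightarrow> Y i = pieces \<tau>"
  proof -
    obtain m where "\<And>i. i \<in> {i. Y i \<noteq> topspace (discrete_topology (pieces \<tau>))} \<Longrightarrow> i \<le> m"
      using Y(2) finite_nat_set_iff_bounded_le by auto
    then have "Y i = pieces \<tau>" if "i \<ge> Suc m" for i using that by force
    then show ?thesis using that by blast
  qed
  have "t \<in> U" if t: "t \<in> itineraries \<tau>" "\<forall>i<k. t i = s i" for t
  proof -
    have "t i \<in> Y i" for i
    proof (cases "i < k")
      case True
      then show ?thesis using t(2) Y(1) by (auto simp: PiE_def Pi_def)
    next
      case False
      then show ?thesis using t(1) k[of i] by (auto simp: itineraries_def)
    qed
    then have "t \<in> Pi\<^sub>E UNIV Y" by auto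
    then show ?thesis using Y(3) V(2) t(1) by blast
  qed
  then show ?thesis by blast
qed

text \<open>A symbolic Lebesgue number: by compactness finitely many cylinders suffice, and a bound
  for their lengths serves for all itineraries.\<close>

lemma cover_refined_by_cylinders:
  assumes U: "\<U> \<in> open_covers (itinerary_top \<tau>)"
  shows "\<exists>k. \<forall>s\<in>itineraries \<tau>. \<exists>U\<in>\<U>. \<forall>t\<in>itineraries \<tau>. (\<forall>i<k. t i = s i) \<longrightarrow> t \<in> U"
proof -
  have cov: "\<Union>\<U> = itineraries \<tau>" "\<And>U. U \<in> \<U> \<Longrightarrow> openin (itinerary_top \<tau>) U"
    using U by (auto simp: open_covers_def topspace_itinerary_top)
  have "\<exists>k. \<exists>U\<in>\<U>. \<forall>t\<in>itineraries \<tau>. (\<forall>i<k. t i = s i) \<longrightarrow> t \<in> U" if "s \<in> itineraries \<tau>" for s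
  proof -
    obtain U where "U \<in> \<U>" "s \<in> U" using cov(1) \<open>s \<in> itineraries \<tau>\<close> by blast
    then show ?thesis using open_contains_cylinder[OF cov(2)] by blast
  qed
  then obtain K where K: "\<And>s. s \<in> itineraries \<tau> \<Longrightarrow>
      \<exists>U\<in>\<U>. \<forall>t\<in>itineraries \<tau>. (\<forall>i<K s. t i = s i) \<longrightarrow> t \<in> U" by metis
  let ?cyl = "\<lambda>s. {t \<in> itineraries \<tau>. \<forall>i<K s. t i = s i}"
  have "\<exists>\<F>. finite \<F> \<and> \<F> \<subseteq> ?cyl ` itineraries \<tau> \<and> itineraries \<tau> \<subseteq> \<Union>\<F>"
  proof (rule compactinD)
    show "compactin (itinerary_top \<tau>) (itineraries \<tau>)"
      using compact_itinerary_top by (simp add: compact_space_def topspace_itinerary_top)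
    show "openin (itinerary_top \<tau>) U" if "U \<in> ?cyl ` itineraries \<tau>" for U
      using that openin_itinerary_cylinder by (elim imageE) simp
    show "itineraries \<tau> \<subseteq> \<Union> (?cyl ` itineraries \<tau>)" by auto
  qed
  then obtain \<F> where F: "finite \<F>" "\<F> \<subseteq> ?cyl ` itineraries \<tau>" "itineraries \<tau> \<subseteq> \<Union>\<F>"
    by (elim exE conjE)
  obtain S where S': "S \<subseteq> itineraries \<tau>" "finite S" "\<F> = ?cyl ` S"
    using finite_subset_image[OF F(1,2)] by (elim exE conjE)
  have S: "finite S" "S \<subseteq> itineraries \<tau>" "itineraries \<tau> \<subseteq> (\<Union>s\<in>S. ?cyl s)"
    using S' F(3) by simp_all
  obtain k where k: "\<And>s. s \<in> S \<Longrightarrow> K s \<le> k"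
    using finite_nat_set_iff_bounded_le[of "K ` S"] S(1) by auto
  have "\<exists>U\<in>\<U>. \<forall>t\<in>itineraries \<tau>. (\<forall>i<k. t i = s i) \<longrightarrow> t \<in> U" if s: "s \<in> itineraries \<tau>" for s
  proof -
    obtain r where r: "r \<in> S" "\<forall>i<K r. s i = r i" using S(3) s by blast
    then obtain U where U: "U \<in> \<U>" "\<And>t. t \<in> itineraries \<tau> \<Longrightarrow> \<forall>i<K r. t i = r i \<Longrightarrow> t \<in> U"
      using K S(2) by blast
    have "t \<in> U" if "t \<in> itineraries \<tau>" "\<forall>i<k. t i = s i" for t
      using U(2)[OF that(1)] that(2) r k[OF r(1)] by auto
    then show ?thesis using U(1) by blast
  qed
  then show ?thesis by blast
qed

text \<open>The first \<open>n + k\<close> letters fix, for each \<open>i < n\<close>, the first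
  \<open>k\<close> letters of the \<open>i\<close>-th shift and thereby an element of the cover
  containing it. Each word of that length thus yields one element of the iterated cover.\<close>

lemma shift_cover_bound:
  assumes U: "\<U> \<in> open_covers (itinerary_top \<tau>)"
  shows "\<exists>k. \<forall>n. \<exists>\<V>\<subseteq>iterated_cover (itinerary_top \<tau>) (\<lambda>s i. s (Suc i)) \<U> n.
    finite \<V> \<and> \<Union>\<V> = itineraries \<tau> \<and> card \<V> \<le> word_count (n + k)"
proof -
  obtain k where k: "\<And>s. s \<in> itineraries \<tau> \<Longrightarrow>
      \<exists>U\<in>\<U>. \<forall>t\<in>itineraries \<tau>. (\<forall>i<k. t i = s i) \<longrightarrow> t \<in> U"
    using cover_refined_by_cylinders[OF U] by blast
  have "\<exists>\<V>\<subseteq>iterated_cover (itinerary_top \<tau>) (\<lambda>s i. s (Suc i)) \<U> n.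
      finite \<V> \<and> \<Union>\<V> = itineraries \<tau> \<and> card \<V> \<le> word_count (n + k)" for n
  proof -
    have "\<exists>u. (\<forall>i<n. u i \<in> \<U>) \<and>
        (\<forall>t\<in>itineraries \<tau>. map t [0..<n + k] = w \<longrightarrow> (\<forall>i<n. (\<lambda>j. t (j + i)) \<in> u i))"
      if "w \<in> words (n + k)" for w
    proof -
      obtain s where s: "s \<in> itineraries \<tau>" "map s [0..<n + k] = w"
        using word_extends_to_itinerary[OF \<open>w \<in> words (n + k)\<close>] .
      have "\<exists>U\<in>\<U>. \<forall>t\<in>itineraries \<tau>. (\<forall>j<k. t j = s (j + i)) \<longrightarrow> t \<in> U" for i
        using k[OF shift_itinerary[OF s(1), of i]] by simp
      then obtain u where u: "\<And>i. u i \<in> \<U>"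
          "\<And>i t. t \<in> itineraries \<tau> \<Longrightarrow> \<forall>j<k. t j = s (j + i) \<Longrightarrow> t \<in> u i" by metis
      have "(\<lambda>j. t (j + i)) \<in> u i" if t: "t \<in> itineraries \<tau>" "map t [0..<n + k] = w" "i < n" for t i
      proof (rule u(2)[OF shift_itinerary[OF t(1)]])
        have "t m = s m" if "m < n + k" for m
          using t(2) s(2) that nth_map_upt[of m "n + k" 0 t] nth_map_upt[of m "n + k" 0 s] by simp
        then show "\<forall>j<k. t (j + i) = s (j + i)" using t(3) by simp
      qed
      then show ?thesis using u(1) by blast
    qed
    then obtain u where u: "\<And>w i. w \<in> words (n + k) \<Longrightarrow> i < n \<Longrightarrow> u w i \<in> \<U>"
        "\<And>w t i. w \<in> words (n + k) \<Longrightarrow> t \<in> itineraries \<tau> \<Longrightarrow> map t [0..<n + k] = w \<Longrightarrow> i < n \<Longrightarrow>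
          (\<lambda>j. t (j + i)) \<in> u w i" by metis
    define V where "V w = {x \<in> itineraries \<tau>. \<forall>i<n. (\<lambda>j. x (j + i)) \<in> u w i}" for w
    have "V ` words (n + k) \<subseteq> iterated_cover (itinerary_top \<tau>) (\<lambda>s i. s (Suc i)) \<U> n"
      unfolding iterated_cover_def topspace_itinerary_top shift_iterate V_def using u(1) by blast
    moreover have "\<Union>(V ` words (n + k)) = itineraries \<tau>"
    proof (intro equalityI subsetI)
      fix t assume t: "t \<in> itineraries \<tau>"
      then have "map t [0..<n + k] \<in> words (n + k)" using itineraries_iff by blast
      then have "t \<in> V (map t [0..<n + k])" using u(2) t by (simp add: V_def)
      then show "t \<in> \<Union>(V ` words (n + k))" using \<open>map t [0..<n + k] \<in> words (n + k)\<close> by blast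
    qed (auto simp: V_def)
    moreover have "card (V ` words (n + k)) \<le> word_count (n + k)"
      unfolding word_count_def by (rule card_image_le[OF finite_words])
    ultimately show ?thesis using finite_words by (intro exI[of _ "V ` words (n + k)"]) auto
  qed
  then show ?thesis by blast
qed

lemma shift_entropy_le: "topological_entropy (itinerary_top \<tau>) (\<lambda>s i. s (Suc i)) \<le> growth_rate"
  unfolding topological_entropy_def
proof (rule SUP_least)
  fix \<U> assume U: "\<U> \<in> open_covers (itinerary_top \<tau>)"
  let ?N = "\<lambda>n. cover_number (itinerary_top \<tau>) (iterated_cover (itinerary_top \<tau>) (\<lambda>s i. s (Suc i)) \<U> n)"
  obtain k where k: "\<And>n. ?N n \<le> word_count (n + k)"
    using shift_cover_bound[OF U] cover_number_le topspace_itinerary_top by (metis order_trans)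
  have "ln (real (?N n)) \<le> ln (real (word_count n)) + ln (real n) + ln (real (word_count k))" if "n > 0" for n
  \<comment> \<open>Logarithms are compared for positive numbers only; in the remaining case
    \<open>ln 0\<close> is 0 by convention.\<close>
  proof (cases "?N n = 0")
    case True
    then show ?thesis using ln_word_count_nonneg[of n] ln_word_count_nonneg[of k] that by simp
  next
    case False
    have "?N n \<le> word_count n * word_count k" using k[of n] word_count_add_le order_trans by blast
    then have "real (?N n) \<le> real (word_count n) * real (word_count k)" by (metis of_nat_le_iff of_nat_mult)
    then have "ln (real (?N n)) \<le> ln (real (word_count n) * real (word_count k))" using False by simp
    also have "\<dots> = ln (real (word_count n)) + ln (real (word_count k))"
      using word_count_pos by (simp add: ln_mult)
    finally show ?thesis using ln_ge_zero[of "real n"] that by linarith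
  qed
  then have "\<forall>\<^sub>F n in sequentially.
      ln (real (?N n)) \<le> ln (real (word_count n)) + ln (real n) + ln (real (word_count k))"
    using eventually_gt_at_top[of 0] by (rule eventually_mono[rotated])
  from limsup_le_of_log_bound[OF this]
  show "limsup (\<lambda>n. ereal (ln (real (?N n)) / real n)) \<le> growth_rate" unfolding growth_rate_def .
qed

text \<open>For the cover by the first letter, all itineraries in one element of the
  \<open>n\<close>-th iterate share their initial word of length \<open>n\<close>, so a subcover has
  at least as many elements as there are words.\<close>

lemma shift_entropy_ge: "growth_rate \<le> topological_entropy (itinerary_top \<tau>) (\<lambda>s i. s (Suc i))"
proof -
  let ?U = "\<lambda>a. {t \<in> itineraries \<tau>. t 0 = a}"
  let ?\<U> = "?U ` pieces \<tau>"
  let ?I = "\<lambda>n. iterated_cover (itinerary_top \<tau>) (\<lambda>s i. s (Suc i)) ?\<U> n"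
  have "openin (itinerary_top \<tau>) (?U a)" for a
  proof (cases "?U a = {}")
    case False
    then obtain s where s: "s \<in> itineraries \<tau>" "s 0 = a" by blast
    then have "{t \<in> itineraries \<tau>. \<forall>i<Suc 0. t i = s i} = ?U a" by auto
    then show ?thesis using openin_itinerary_cylinder[OF s(1), of "Suc 0"] by simp
  qed (simp only: openin_empty)
  then have cover: "?\<U> \<in> open_covers (itinerary_top \<tau>)"
    unfolding open_covers_def topspace_itinerary_top by (auto simp: itineraries_def)
  have le: "word_count n \<le> cover_number (itinerary_top \<tau>) (?I n)" for n
  proof -
    obtain \<V> where "\<V> \<subseteq> ?I n" "finite \<V>" "\<Union>\<V> = topspace (itinerary_top \<tau>)"
      using shift_cover_bound[OF cover] unfolding topspace_itinerary_top by blast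
    then obtain \<W> where W: "\<W> \<subseteq> ?I n" "finite \<W>" "\<Union>\<W> = itineraries \<tau>"
        "card \<W> = cover_number (itinerary_top \<tau>) (?I n)"
      using cover_number_attained[of \<V> "?I n" "itinerary_top \<tau>"] unfolding topspace_itinerary_top by blast
    have same: "map s [0..<n] = map t [0..<n]" if st: "A \<in> \<W>" "s \<in> A" "t \<in> A" for A s t
    proof -
      obtain u where u: "\<forall>i<n. u i \<in> ?\<U>" "A = {x \<in> itineraries \<tau>. \<forall>i<n. (\<lambda>j. x (j + i)) \<in> u i}"
        using subsetD[OF W(1) st(1)]
        unfolding iterated_cover_def topspace_itinerary_top shift_iterate mem_Collect_eq
        by (elim exE conjE)
      have "s i = t i" if i: "i < n" for i
      proof -
        from u(1) i obtain a where a: "u i = ?U a" by blast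
        have "(\<lambda>j. s (j + i)) \<in> u i" "(\<lambda>j. t (j + i)) \<in> u i"
          using st(2,3) i unfolding u(2) by blast+
        then show ?thesis unfolding a by simp
      qed
      then show ?thesis by auto
    qed
    have "words n \<subseteq> (\<lambda>A. map (SOME s. s \<in> A) [0..<n]) ` \<W>"
    proof
      fix w assume "w \<in> words n"
      then obtain s where s: "s \<in> itineraries \<tau>" "map s [0..<n] = w" by (rule word_extends_to_itinerary)
      then obtain A where A: "A \<in> \<W>" "s \<in> A" using W(3) by blast
      then have "(SOME s. s \<in> A) \<in> A" by (metis someI)
      then have "w = map (SOME s. s \<in> A) [0..<n]" using same[OF A(1)] A(2) s(2) by metis
      then show "w \<in> (\<lambda>A. map (SOME s. s \<in> A) [0..<n]) ` \<W>" using A(1) by blast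
    qed
    then have "word_count n \<le> card \<W>" unfolding word_count_def using surj_card_le[OF W(2)] by blast
    then show ?thesis using W(4) by simp
  qed
  have "growth_rate \<le> limsup (\<lambda>n. ereal (ln (real (cover_number (itinerary_top \<tau>) (?I n))) / real n))"
    unfolding growth_rate_def
  proof (intro Limsup_mono always_eventually allI)
    fix n
    have "ln (real (word_count n)) \<le> ln (real (cover_number (itinerary_top \<tau>) (?I n)))"
      using le[of n] word_count_pos[of n] by simp
    then show "ereal (ln (real (word_count n)) / real n) \<le>
        ereal (ln (real (cover_number (itinerary_top \<tau>) (?I n))) / real n)"
      by (simp add: divide_right_mono)
  qed
  also have "\<dots> \<le> topological_entropy (itinerary_top \<tau>) (\<lambda>s i. s (Suc i))"
    unfolding topological_entropy_def by (rule SUP_upper[OF cover])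
  finally show ?thesis .
qed

end

section \<open>Entropy of continuous maps\<close>

locale continuous_piecewise_monotonic_map = piecewise_monotonic_map +
  assumes cont: "continuous_on {0..1} \<tau>"
begin

text \<open>For continuous \<tau> the one-sided limits at the cuts are the actual values, so germ
  orbits lie over true orbits without exception.\<close>

lemma fst_iterate:
  assumes g: "g \<in> all_germs"
  shows "fst ((germ_step ^^ j) g) = (\<tau> ^^ j) (fst g)"
proof (induction j)
  case (Suc j)
  let ?h = "(germ_step ^^ j) g"
  have h: "?h \<in> all_germs" using iterate_in[OF g] .
  note b = piece_bounds[OF piece_of(1)[OF h]]
  have c: "continuous_on {lo (piece_of ?h)..hi (piece_of ?h)} \<tau>"
    by (rule continuous_on_subset[OF cont]) (use b in auto)
  have "fst ?h \<in> {lo (piece_of ?h)..hi (piece_of ?h)}"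
    using fst_germ_closed_piece[OF h] by (simp add: closed_piece_eq)
  then have "branch \<tau> (piece_of ?h) (fst ?h) = \<tau> (fst ?h)"
    unfolding branch_def open_piece_eq
    by (intro Lim_within_interval_extension[OF b(2) c]) auto
  then show ?case using Suc by (simp add: fst_germ_step)
qed simp

section \<open>Upper bound for the entropy of the interval map by words of grid cells\<close>

lemma iterate_range: "x \<in> {0..1} \<Longrightarrow> (\<tau> ^^ j) x \<in> {0..1}"
  by (induction j) (use tau_range in auto)

text \<open>The index of the cell of length \<open>1 / r\<close> into which the germ points. Floor
  on the right and ceiling minus one on the left put a germ at a grid point into the cell on its own
  side, which makes the label locally constant.\<close>

definition grid_label :: "nat \<Rightarrow> germ \<Rightarrow> int" where
  "grid_label r g = (if snd g then \<lfloor>real r * fst g\<rfloor> else \<lceil>real r * fst g\<rceil> - 1)"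

lemma grid_label_bounds:
  "real_of_int (grid_label r g) \<le> real r * fst g" "real r * fst g \<le> real_of_int (grid_label r g) + 1"
  unfolding grid_label_def by (auto split: if_splits)

lemma grid_label_eqI:
  "real_of_int c < real r * y \<Longrightarrow> real r * y < real_of_int c + 1 \<Longrightarrow> grid_label r (y, s) = c"
  unfolding grid_label_def by (cases s) (simp_all, linarith+)

lemma grid_label_locally_constant:
  assumes r: "0 < r"
  shows "\<forall>\<^sub>F h in germ_nhds g. grid_label r h = grid_label r g"
proof -
  obtain x s where g: "g = (x, s)" by (cases g)
  define c where "c = grid_label r g"
  show ?thesis
  proof (cases s)
    case True
    then have "c = \<lfloor>real r * x\<rfloor>" by (simp add: c_def g grid_label_def)
    then have c: "real_of_int c \<le> real r * x" "real r * x < real_of_int c + 1" by linarith+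
    define e where "e = (real_of_int c + 1) / real r - x"
    have e: "e > 0" using c r by (simp add: e_def field_simps)
    have "grid_label r (y, t) = c" if "x < y" "y < x + e" for y t
    proof (rule grid_label_eqI)
      show "real_of_int c < real r * y"
        using c(1) mult_strict_left_mono[OF that(1), of "real r"] r by linarith
      show "real r * y < real_of_int c + 1" using that(2) r by (simp add: e_def field_simps)
    qed
    then have "\<forall>\<^sub>F h in germ_nhds (x, True). grid_label r h = c"
      unfolding eventually_germ_nhds_right using e True by (auto simp: c_def g)
    then show ?thesis using True by (simp add: c_def g)
  next
    case False
    then have "c = \<lceil>real r * x\<rceil> - 1" by (simp add: c_def g grid_label_def)
    then have c: "real_of_int c < real r * x" "real r * x \<le> real_of_int c + 1" by linarith+
    define e where "e = x - real_of_int c / real r"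
    have e: "e > 0" using c r by (simp add: e_def field_simps)
    have "grid_label r (y, t) = c" if "x - e < y" "y < x" for y t
    proof (rule grid_label_eqI)
      show "real r * y < real_of_int c + 1"
        using c(2) mult_strict_left_mono[OF that(2), of "real r"] r by linarith
      show "real_of_int c < real r * y" using that(1) r by (simp add: e_def field_simps)
    qed
    then have "\<forall>\<^sub>F h in germ_nhds (x, False). grid_label r h = c"
      unfolding eventually_germ_nhds_left using e False by (auto simp: c_def g)
    then show ?thesis using False by (simp add: c_def g)
  qed
qed

text \<open>The exceptional set for \<open>card_label_words_le\<close>: at other germs neither the
  piece nor the cell distinguishes the two sides.\<close>

definition grid_germs :: "nat \<Rightarrow> germ set" where
  "grid_germs r = boundary_germs \<union> (\<lambda>k. real k / real r) ` {..r} \<times> UNIV"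

lemma finite_grid_germs: "finite (grid_germs r)"
  unfolding grid_germs_def using finite_boundary_germs by auto

lemma grid_label_twin:
  assumes r: "0 < r" and g: "g \<in> all_germs" "g \<notin> grid_germs r"
  shows "grid_label r (twin g) = grid_label r g"
proof -
  obtain x s where gx: "g = (x, s)" by (cases g)
  have x: "0 \<le> x" "x \<le> 1" using g(1) by (auto simp: gx germs_def)
  have "real r * x \<noteq> of_int c" for c
  proof
    assume eq: "real r * x = of_int c"
    have "0 \<le> real r * x" "real r * x \<le> real r" using x by (auto simp: mult_left_le)
    then have "0 \<le> c" "c \<le> int r" unfolding eq by linarith+
    then have "x = real (nat c) / real r" "nat c \<le> r" using eq r by (auto simp: field_simps)
    then have "g \<in> grid_germs r" unfolding grid_germs_def gx by auto
    then show False using g(2) by blast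
  qed
  then have "real_of_int \<lfloor>real r * x\<rfloor> < real r * x" by (metis floor_correct order_le_less)
  moreover have "real r * x < real_of_int \<lfloor>real r * x\<rfloor> + 1" by linarith
  ultimately have "grid_label r (x, t) = \<lfloor>real r * x\<rfloor>" for t by (rule grid_label_eqI)
  then show ?thesis by (simp add: gx twin_def)
qed

text \<open>A Lebesgue number places every grid cell inside one element of the cover, so a word of
  cells selects an element of the iterated cover. The number of such words exceeds the word count at
  most by a factor linear in \<open>n\<close>, with \<open>c\<close> the number of exceptional
  germs.\<close>

lemma interval_cover_bound:
  assumes U: "\<U> \<in> open_covers (top_of_set {0..1})"
  shows "\<exists>c. \<forall>n>0. \<exists>\<V>\<subseteq>iterated_cover (top_of_set {0..1}) \<tau> \<U> n.
    finite \<V> \<and> \<Union>\<V> = {0..1} \<and> card \<V> \<le> n * c * word_count n"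
proof -
  have cov: "\<Union>\<U> = {0..1}" "\<And>U. U \<in> \<U> \<Longrightarrow> openin (top_of_set {0..1}) U"
    using U by (auto simp: open_covers_def)
  let ?C = "{V. open V \<and> {0..1} \<inter> V \<in> \<U>}"
  have sub: "{0..1} \<subseteq> \<Union>?C"
  proof
    fix x :: real assume "x \<in> {0..1}"
    then obtain U where "U \<in> \<U>" "x \<in> U" using cov(1) by blast
    moreover obtain V where "open V" "U = {0..1} \<inter> V"
      using cov(2)[OF \<open>U \<in> \<U>\<close>] by (auto simp: openin_open)
    ultimately show "x \<in> \<Union>?C" by blast
  qed
  then have ne: "?C \<noteq> {}" by force
  obtain \<delta> where d: "0 < \<delta>" "\<And>T. T \<subseteq> {0..1} \<Longrightarrow> diameter T < \<delta> \<Longrightarrow> \<exists>B\<in>?C. T \<subseteq> B"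
    by (rule Lebesgue_number_lemma[OF compact_Icc ne sub]) auto
  obtain r where r: "0 < r" "1 / real r < \<delta>"
    using real_arch_inverse[of \<delta>] d(1) by (auto simp: inverse_eq_divide)
  define cell where "cell c = {x \<in> {0..1}. real_of_int c \<le> real r * x \<and> real r * x \<le> real_of_int c + 1}" for c
  have "\<exists>U\<in>\<U>. cell c \<subseteq> U" for c
  proof -
    have "diameter (cell c) \<le> 1 / real r"
    proof (rule diameter_le)
      show "norm (x - y) \<le> 1 / real r" if "x \<in> cell c" "y \<in> cell c" for x y
      proof -
        have "real r * x - real r * y \<le> 1" "real r * y - real r * x \<le> 1" using that by (auto simp: cell_def)
        then show ?thesis using r(1) by (auto simp: field_simps abs_le_iff)
      qed
    qed (use r in auto)
    then obtain B where "B \<in> ?C" "cell c \<subseteq> B" using d(2)[of "cell c"] r(2) by (force simp: cell_def)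
    moreover have "cell c \<subseteq> {0..1}" by (auto simp: cell_def)
    ultimately show ?thesis by blast
  qed
  then obtain u where u: "\<And>c. u c \<in> \<U>" "\<And>c. cell c \<subseteq> u c" by metis
  have "\<exists>\<V>\<subseteq>iterated_cover (top_of_set {0..1}) \<tau> \<U> n.
      finite \<V> \<and> \<Union>\<V> = {0..1} \<and> card \<V> \<le> n * card (grid_germs r) * word_count n" if n: "n > 0" for n
  proof -
    let ?W = "label_word (grid_label r) n ` all_germs"
    have B: "boundary_germs \<subseteq> grid_germs r" by (simp add: grid_germs_def)
    have W: "finite ?W" "card ?W \<le> n * card (grid_germs r) * word_count n"
      using card_label_words_le[where lab = "grid_label r", OF grid_label_locally_constant[OF r(1)] grid_label_twin[OF r(1)] B finite_grid_germs n]
      by auto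
    define V where "V w = {x \<in> {0..1}. \<forall>i<n. (\<tau> ^^ i) x \<in> u (w ! i)}" for w
    have "V ` ?W \<subseteq> iterated_cover (top_of_set {0..1}) \<tau> \<U> n"
    proof (rule image_subsetI)
      fix w
      show "V w \<in> iterated_cover (top_of_set {0..1}) \<tau> \<U> n"
        unfolding iterated_cover_def V_def mem_Collect_eq
        by (intro exI[of _ "\<lambda>i. u (w ! i)"]) (simp add: u(1))
    qed
    moreover have "\<Union>(V ` ?W) = {0..1}"
    proof (intro equalityI subsetI)
      fix x :: real assume x: "x \<in> {0..1}"
      have "\<exists>s. (x, s) \<in> all_germs" using x by (cases "x < 1") (auto simp: germs_def)
      then obtain g where g: "g \<in> all_germs" "fst g = x" by auto
      have "(\<tau> ^^ i) x \<in> u (label_word (grid_label r) n g ! i)" if "i < n" for i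
      proof -
        have "(\<tau> ^^ i) x \<in> cell (grid_label r ((germ_step ^^ i) g))"
          using grid_label_bounds[of r "(germ_step ^^ i) g"] fst_iterate[OF g(1), of i] iterate_range[OF x, of i] g(2)
          by (simp add: cell_def)
        then show ?thesis using u(2) that by (auto simp: nth_label_word)
      qed
      then have "x \<in> V (label_word (grid_label r) n g)" using x by (simp add: V_def)
      then show "x \<in> \<Union>(V ` ?W)" using g(1) by blast
    qed (auto simp: V_def)
    moreover have "card (V ` ?W) \<le> n * card (grid_germs r) * word_count n"
      using card_image_le[OF W(1), of V] W(2) by linarith
    ultimately show ?thesis using W(1) by (intro exI[of _ "V ` ?W"]) auto
  qed
  then show ?thesis by blast
qed

lemma interval_entropy_le: "topological_entropy (top_of_set {0..1}) \<tau> \<le> growth_rate"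
  unfolding topological_entropy_def
proof (rule SUP_least)
  fix \<U> assume U: "\<U> \<in> open_covers (top_of_set {0..1::real})"
  let ?N = "\<lambda>n. cover_number (top_of_set {0..1}) (iterated_cover (top_of_set {0..1}) \<tau> \<U> n)"
  obtain c where cov: "\<forall>n>0. \<exists>\<V>\<subseteq>iterated_cover (top_of_set {0..1}) \<tau> \<U> n.
      finite \<V> \<and> \<Union>\<V> = {0..1} \<and> card \<V> \<le> n * c * word_count n"
    using interval_cover_bound[OF U] by (elim exE)
  have c: "?N n \<le> n * c * word_count n" if n: "n > 0" for n
  proof -
    obtain \<V> where V: "\<V> \<subseteq> iterated_cover (top_of_set {0..1}) \<tau> \<U> n" "finite \<V>" "\<Union>\<V> = {0..1}"
        "card \<V> \<le> n * c * word_count n"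
      using cov n by (elim allE[of _ n]) (elim impE exE conjE, assumption)
    then show ?thesis
      using cover_number_le[OF V(1,2), of "top_of_set {0..1}"] by simp
  qed
  \<comment> \<open>\<open>Suc c\<close> in place of \<open>c\<close> keeps the last logarithm
    nonnegative.\<close>
  have "ln (real (?N n)) \<le> ln (real (word_count n)) + ln (real n) + ln (real (Suc c))" if n: "n > 0" for n
  proof (cases "?N n = 0")
    case True
    have "0 \<le> ln (real n)" "0 \<le> ln (real (Suc c))" using n by auto
    then show ?thesis unfolding True using ln_word_count_nonneg[of n] by simp
  next
    case False
    have "n * c * word_count n \<le> word_count n * n * Suc c" by simp
    then have "?N n \<le> word_count n * n * Suc c" using c[OF n] by linarith
    then have "real (?N n) \<le> real (word_count n) * real n * real (Suc c)" by (metis of_nat_le_iff of_nat_mult)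
    then have "ln (real (?N n)) \<le> ln (real (word_count n) * real n * real (Suc c))" using False by simp
    also have "\<dots> = ln (real (word_count n)) + ln (real n) + ln (real (Suc c))"
      using word_count_pos[of n] n by (simp add: ln_mult del: of_nat_Suc)
    finally show ?thesis .
  qed
  then have "\<forall>\<^sub>F n in sequentially.
      ln (real (?N n)) \<le> ln (real (word_count n)) + ln (real n) + ln (real (Suc c))"
    using eventually_gt_at_top[of 0] by (rule eventually_mono[rotated])
  from limsup_le_of_log_bound[OF this]
  show "limsup (\<lambda>n. ereal (ln (real (?N n)) / real n)) \<le> growth_rate" unfolding growth_rate_def .
qed

text \<open>For the lower bound choose a cover by intervals over which at most two words of length \<open>k\<close>
  occur; the number of words of length \<open>m\<close> over an element of the iterated cover is then at most
  \<open>2 ^ \<lceil>m / k\<rceil>\<close>.\<close>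

lemma two_word_cover_exists:
  "\<exists>\<U>\<in>open_covers (top_of_set {0..1::real}). \<forall>U\<in>\<U>. \<exists>v w. \<forall>g\<in>all_germs. fst g \<in> U \<longrightarrow>
     label_word piece_of k g \<in> {v, w}"
proof -
  let ?w = "label_word piece_of k"
  have "\<exists>e>0. \<forall>g\<in>all_germs. \<bar>fst g - x\<bar> < e \<longrightarrow> ?w g \<in> {?w (x, True), ?w (x, False)}" if x: "x \<in> {0..1}" for x
  proof (rule eventually_germs_ball[OF _ x])
    fix s assume g: "(x, s) \<in> all_germs"
    have "\<forall>\<^sub>F h in germ_nhds (x, s). ?w h = ?w (x, s)"
      by (rule label_word_locally_constant[OF piece_of_locally_constant g])
    then show "\<forall>\<^sub>F h in germ_nhds (x, s). ?w h \<in> {?w (x, True), ?w (x, False)}"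
      by eventually_elim (cases s; simp)
  qed
  then obtain e where e: "\<And>x. x \<in> {0..1} \<Longrightarrow> e x > 0"
      "\<And>x g. x \<in> {0..1} \<Longrightarrow> g \<in> all_germs \<Longrightarrow> \<bar>fst g - x\<bar> < e x \<Longrightarrow> ?w g \<in> {?w (x, True), ?w (x, False)}"
    by metis
  let ?\<U> = "(\<lambda>x. {0..1} \<inter> ball x (e x)) ` {0..1}"
  have "?\<U> \<in> open_covers (top_of_set {0..1})"
    unfolding open_covers_def using e(1) by (auto simp: openin_open_Int)
  moreover have "\<exists>v w. \<forall>g\<in>all_germs. fst g \<in> U \<longrightarrow> ?w g \<in> {v, w}" if U: "U \<in> ?\<U>" for U
  proof -
    obtain x where x: "x \<in> {0..1}" "U = {0..1} \<inter> ball x (e x)" using U by blast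
    have "?w g \<in> {?w (x, True), ?w (x, False)}" if "g \<in> all_germs" "fst g \<in> U" for g
      using e(2)[OF x(1) that(1)] that(2) x(2) by (simp add: dist_real_def abs_minus_commute)
    then show ?thesis by blast
  qed
  ultimately show ?thesis by blast
qed

text \<open>The \<open>m\<close> steps are cut into \<open>Suc ((m - 1) div k)\<close> blocks of
  length \<open>k\<close>, that is, \<open>m / k\<close> rounded up. The iterate at the start of a
  block lies in a known element of the cover, which leaves at most two words for the block.\<close>

lemma words_over_cover_element:
  assumes k: "0 < k" and m: "0 < m"
    and U: "\<And>U. U \<in> \<U> \<Longrightarrow> \<exists>v w. \<forall>g\<in>all_germs. fst g \<in> U \<longrightarrow> label_word piece_of k g \<in> {v, w}"
    and E: "E \<in> iterated_cover (top_of_set {0..1}) \<tau> \<U> m"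
  shows "card (label_word piece_of m ` {g \<in> all_germs. fst g \<in> E}) \<le> 2 ^ Suc ((m - 1) div k)"
proof -
  let ?q = "Suc ((m - 1) div k)"
  obtain u where u: "\<And>i. i < m \<Longrightarrow> u i \<in> \<U>" "E = {x \<in> {0..1}. \<forall>i<m. (\<tau> ^^ i) x \<in> u i}"
    using E unfolding iterated_cover_def by auto
  have "\<exists>S. finite S \<and> card S \<le> 2 \<and> (\<forall>g\<in>all_germs. fst g \<in> U \<longrightarrow> label_word piece_of k g \<in> S)"
    if "U \<in> \<U>" for U
  proof -
    obtain v w where "\<forall>g\<in>all_germs. fst g \<in> U \<longrightarrow> label_word piece_of k g \<in> {v, w}"
      using U[OF \<open>U \<in> \<U>\<close>] by blast
    then show ?thesis by (intro exI[of _ "{v, w}"]) (auto simp: card_insert_if)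
  qed
  then obtain S where S: "\<And>U. U \<in> \<U> \<Longrightarrow> finite (S U)" "\<And>U. U \<in> \<U> \<Longrightarrow> card (S U) \<le> 2"
      "\<And>U g. U \<in> \<U> \<Longrightarrow> g \<in> all_germs \<Longrightarrow> fst g \<in> U \<Longrightarrow> label_word piece_of k g \<in> S U"
    by metis
  \<comment> \<open>Every block starts before time \<open>m\<close>, where the iterated cover still
    constrains the orbit; the last block may run beyond it.\<close>
  have jk: "j * k < m" if "j < ?q" for j
  proof -
    have "j * k \<le> (m - 1) div k * k" using that by (intro mult_le_mono1) simp
    also have "\<dots> \<le> m - 1" by (rule div_times_less_eq_dividend)
    finally show ?thesis using m by linarith
  qed
  let ?F = "\<Pi>\<^sub>E j\<in>{..<?q}. S (u (j * k))"
  have Su: "u (j * k) \<in> \<U>" if "j \<in> {..<?q}" for j using u(1)[OF jk] that by simp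
  have fin: "finite ?F" using S(1)[OF Su] by (intro finite_PiE) auto
  have "label_word piece_of m ` {g \<in> all_germs. fst g \<in> E} \<subseteq>
      (\<lambda>f. map (\<lambda>i. f (i div k) ! (i mod k)) [0..<m]) ` ?F"
  proof (rule image_subsetI)
    fix g assume "g \<in> {g \<in> all_germs. fst g \<in> E}"
    then have g: "g \<in> all_germs" "fst g \<in> E" by auto
    define f where "f = (\<lambda>j\<in>{..<?q}. label_word piece_of k ((germ_step ^^ (j * k)) g))"
    have "f \<in> ?F"
    proof (rule PiE_I)
      fix j assume j: "j \<in> {..<?q}"
      have "fst ((germ_step ^^ (j * k)) g) \<in> u (j * k)"
        using g jk[of j] j u(2) fst_iterate[OF g(1)] by auto
      then show "f j \<in> S (u (j * k))"
        using S(3)[OF Su[OF j] iterate_in[OF g(1)]] j by (simp add: f_def)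
    qed (simp add: f_def)
    moreover have "label_word piece_of m g = map (\<lambda>i. f (i div k) ! (i mod k)) [0..<m]"
    proof (rule nth_equalityI)
      fix i assume "i < length (label_word piece_of m g)"
      then have i: "i < m" by simp
      then have "i div k < ?q" using div_le_mono[of i "m - 1" k] by linarith
      moreover have "i = i mod k + i div k * k" by simp
      then have "(germ_step ^^ i) g = (germ_step ^^ (i mod k)) ((germ_step ^^ (i div k * k)) g)"
        by (metis comp_apply funpow_add)
      ultimately show "label_word piece_of m g ! i = map (\<lambda>i. f (i div k) ! (i mod k)) [0..<m] ! i"
        using i k by (simp add: nth_label_word f_def)
    qed simp
    ultimately show "label_word piece_of m g \<in> (\<lambda>f. map (\<lambda>i. f (i div k) ! (i mod k)) [0..<m]) ` ?F"
      by (intro image_eqI[of _ _ f])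
  qed
  then have "card (label_word piece_of m ` {g \<in> all_germs. fst g \<in> E}) \<le> card ?F"
    using surj_card_le[OF fin] by blast
  also have "\<dots> = (\<Prod>j\<in>{..<?q}. card (S (u (j * k))))" by (rule card_PiE) simp
  also have "\<dots> \<le> (\<Prod>j\<in>{..<?q}. 2)" using S(2)[OF Su] by (intro prod_mono) auto
  also have "\<dots> = 2 ^ ?q" by simp
  finally show ?thesis .
qed

text \<open>The two germs at a point may have different words, and no open cover separates them.
  Reading \<open>k\<close> letters at once charges this doubling once per \<open>k\<close> steps,
  hence the error \<open>ln 2 / k\<close>.\<close>

lemma growth_rate_le_interval_entropy_plus:
  assumes k: "0 < k"
  shows "growth_rate \<le> topological_entropy (top_of_set {0..1}) \<tau> + ereal (ln 2 / real k)"
proof -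
  obtain \<U> where U: "\<U> \<in> open_covers (top_of_set {0..1::real})"
      "\<And>U. U \<in> \<U> \<Longrightarrow> \<exists>v w. \<forall>g\<in>all_germs. fst g \<in> U \<longrightarrow> label_word piece_of k g \<in> {v, w}"
    using two_word_cover_exists[of k] by blast
  let ?I = "\<lambda>m. iterated_cover (top_of_set {0..1}) \<tau> \<U> m"
  let ?N = "\<lambda>m. cover_number (top_of_set {0..1}) (?I m)"
  have le: "word_count m \<le> ?N m * 2 ^ Suc ((m - 1) div k)" if m: "m > 0" for m
  proof -
    obtain \<V> where V: "\<V> \<subseteq> ?I m" "finite \<V>" "\<Union>\<V> = topspace (top_of_set {0..1::real})"
    proof -
      obtain c where "\<forall>n>0. \<exists>\<V>\<subseteq>?I n. finite \<V> \<and> \<Union>\<V> = {0..1} \<and> card \<V> \<le> n * c * word_count n"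
        using interval_cover_bound[OF U(1)] by (elim exE)
      then have "\<exists>\<V>\<subseteq>?I m. finite \<V> \<and> \<Union>\<V> = {0..1} \<and> card \<V> \<le> m * c * word_count m"
        using m by (elim allE[of _ m]) (elim impE, assumption+)
      then show ?thesis using that by (elim exE conjE) simp
    qed
    obtain \<W> where W: "\<W> \<subseteq> ?I m" "finite \<W>" "\<Union>\<W> = topspace (top_of_set {0..1::real})" "card \<W> = ?N m"
      using cover_number_attained[OF V] by (elim exE conjE)
    let ?S = "\<lambda>E. label_word piece_of m ` {g \<in> all_germs. fst g \<in> E}"
    have "words m \<subseteq> (\<Union>E\<in>\<W>. ?S E)"
    proof
      fix w assume "w \<in> words m"
      then obtain g where g: "g \<in> all_germs" "w = label_word piece_of m g" by (auto simp: words_def)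
      then have "fst g \<in> \<Union>\<W>" using W(3) by (auto simp: germs_def)
      then show "w \<in> (\<Union>E\<in>\<W>. ?S E)" using g by blast
    qed
    moreover have fin: "finite (?S E)" for E
      by (rule finite_subset[OF _ finite_words[of m]]) (auto simp: words_def)
    ultimately have "word_count m \<le> card (\<Union>E\<in>\<W>. ?S E)"
      unfolding word_count_def using W(2) by (intro card_mono) auto
    also have "\<dots> \<le> (\<Sum>E\<in>\<W>. card (?S E))" by (rule card_UN_le[OF W(2)])
    also have "\<dots> \<le> (\<Sum>E\<in>\<W>. 2 ^ Suc ((m - 1) div k))"
      using W(1) by (intro sum_mono words_over_cover_element[OF k m U(2)]) auto
    also have "\<dots> = ?N m * 2 ^ Suc ((m - 1) div k)" using W(4) by simp
    finally show ?thesis .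
  qed
  have "ln (real (word_count m)) \<le> (ln (real (?N m)) + ln 2 / real k * real m) + ln (real m) + ln 2"
    if m: "m > 0" for m
  proof -
    have "?N m \<noteq> 0" using le[OF m] word_count_pos[of m] by (metis gr_implies_not0 le_zero_eq mult_0)
    have "real (word_count m) \<le> real (?N m) * 2 ^ Suc ((m - 1) div k)"
      using le[OF m] by (metis of_nat_le_iff of_nat_mult of_nat_numeral of_nat_power)
    then have "ln (real (word_count m)) \<le> ln (real (?N m) * 2 ^ Suc ((m - 1) div k))"
      using word_count_pos[of m] by (intro ln_mono) auto
    also have "\<dots> = ln (real (?N m)) + real (Suc ((m - 1) div k)) * ln 2"
      using \<open>?N m \<noteq> 0\<close> by (simp add: ln_mult ln_realpow del: power_Suc of_nat_Suc)
    \<comment> \<open>Rounding up costs at most one extra block, whose \<open>ln 2\<close> becomes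
      the additive constant.\<close>
    also have "real (Suc ((m - 1) div k)) * ln 2 \<le> (real m / real k + 1) * ln 2"
    proof (rule mult_right_mono)
      have "real ((m - 1) div k) \<le> real (m - 1) / real k" by (rule of_nat_div_le_of_nat)
      also have "\<dots> \<le> real m / real k" by (intro divide_right_mono) auto
      finally show "real (Suc ((m - 1) div k)) \<le> real m / real k + 1" by simp
    qed simp
    finally have "ln (real (word_count m)) \<le> (ln (real (?N m)) + ln 2 / real k * real m) + ln 2"
      by (simp add: algebra_simps)
    moreover have "0 \<le> ln (real m)" using m by simp
    ultimately show ?thesis by linarith
  qed
  then have "\<forall>\<^sub>F m in sequentially.
      ln (real (word_count m)) \<le> (ln (real (?N m)) + ln 2 / real k * real m) + ln (real m) + ln 2"
    using eventually_gt_at_top[of 0] by (rule eventually_mono[rotated])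
  from limsup_le_of_log_bound[OF this]
  have "growth_rate \<le> limsup (\<lambda>m. ereal ((ln (real (?N m)) + ln 2 / real k * real m) / real m))"
    unfolding growth_rate_def .
  also have "\<dots> = limsup (\<lambda>m. ereal (ln 2 / real k) + ereal (ln (real (?N m)) / real m))"
    by (intro Limsup_eq eventually_mono[OF eventually_gt_at_top[of 0]]) (auto simp: add_divide_distrib)
  also have "\<dots> = ereal (ln 2 / real k) + limsup (\<lambda>m. ereal (ln (real (?N m)) / real m))"
    by (rule ereal_limsup_lim_add[OF tendsto_const]) simp
  also have "\<dots> \<le> ereal (ln 2 / real k) + topological_entropy (top_of_set {0..1}) \<tau>"
    unfolding topological_entropy_def by (intro add_left_mono SUP_upper U(1))
  finally show ?thesis by (simp add: add.commute)
qed

text \<open>The cover behind the lower bound depends on \<open>k\<close>, but the entropy is a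
  supremum over all covers, so the error can be made arbitrarily small.\<close>

lemma interval_entropy_eq: "topological_entropy (top_of_set {0..1}) \<tau> = growth_rate"
proof (rule antisym[OF interval_entropy_le ereal_le_epsilon2])
  show "growth_rate \<le> topological_entropy (top_of_set {0..1}) \<tau> + ereal e" if e: "e > 0" for e
  proof -
    obtain k where k: "ln 2 / e < real k" using reals_Archimedean2 by blast
    have "0 < ln 2 / e" using e by simp
    then have "0 < real k" using k by linarith
    then have "ln 2 / real k \<le> e" "0 < k" using k e by (auto simp: field_simps)
    then have "topological_entropy (top_of_set {0..1}) \<tau> + ereal (ln 2 / real k) \<le>
        topological_entropy (top_of_set {0..1}) \<tau> + ereal e"
      by (intro add_left_mono) simp
    then show ?thesis
      using growth_rate_le_interval_entropy_plus[OF \<open>0 < k\<close>] by (rule order_trans[rotated])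
  qed
qed

end

lemma entropy_eq_growth_rate:
  assumes "piecewise_monotonic \<tau>"
  shows "entropy \<tau> = piecewise_monotonic_map.growth_rate \<tau>"
proof -
  interpret piecewise_monotonic_map \<tau> by unfold_locales (rule assms)
  show ?thesis
  proof (cases "continuous_on {0..1} \<tau>")
    case True
    then interpret continuous_piecewise_monotonic_map \<tau> by unfold_locales
    show ?thesis using True interval_entropy_eq by (simp add: entropy_def)
  next
    case False
    then show ?thesis
      unfolding entropy_def using antisym[OF shift_entropy_le shift_entropy_ge] by simp
  qed
qed

theorem corollary5p4:
  fixes \<tau>1 \<tau>2 :: "real \<Rightarrow> real"
  assumes "piecewise_monotonic \<tau>1" and "piecewise_monotonic \<tau>2"
    and "transitive_map \<tau>1" and "transitive_map \<tau>2"
    and "triple_isomorphic (dimension_triple \<tau>1) (dimension_triple \<tau>2)"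
  shows "entropy \<tau>1 = entropy \<tau>2"
  unfolding entropy_eq_growth_rate[OF assms(1)] entropy_eq_growth_rate[OF assms(2)]
  by (rule growth_rate_eq_of_isomorphic[OF assms(1,2,5)])

end
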